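(* Let $\mathsf{NQ.L}$ be any properly closed nested calculus and let $\mathcal S$ be a nested sequent. If the formula $\mathtt{fm}(\mathcal S)$ is $\mathsf{Q.L}$-valid, then $\mathsf{NQ.L}\vdash\mathcal S$.
   Context: **Language.** Fix, for each $n$, an at most countable set of $n$-ary predicates $R^n_i$, and a denumerable set of variables. Formulas of $\mathcal L$: $A::=R_i^n(x_1,\dots,x_n)\mid x_1=x_2\mid\bot\mid A\supset A\mid\forall xA\mid\Box A$. Atomic formulas are those of shape $R_i^n(x_1,\dots,x_n)$ or $x_1=x_2$. Other connectives, $\exists$ and $\Diamond$ are defined as usual. $A(y/x)$ is capture-avoiding substitution (renaming bound variables if needed). **Semantics and axiom sets.** A frame is $\langle\mathcal W,\mathcal R,\mathcal D\rangle$ with $\mathcal W\neq\varnothing$, $\mathcal R\subseteq\mathcal W^2$, and $\mathcal D$ assigning to each $w\in\mathcal W$ a possibly empty set $\mathcal D_w$, with $\mathcal D_v\ne\varnothing$ for some $v$. Put $\mathcal D_{\mathcal W}=\bigcup_{v}\mathcal D_v$. A model is a frame with a valuation $\mathcal V$ such that $\mathcal V(w,R^n)\subseteq(\mathcal D_{\mathcal W})^n$. An assignment $\sigma$ maps variables to $\mathcal D_{\mathcal W}$; $\sigma^{x\triangleright o}$ is $\sigma$ modified to send $x$ to $o$. Satisfaction at $w$: $\sigma\Vdash_wR^n(x_1,\dots,x_n)$ iff $\langle\sigma(x_1),\dots,\sigma(x_n)\rangle\in\mathcal V(w,R^n)$; $\sigma\Vdash_wx=y$ iff $\sigma(x)=\sigma(y)$;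 $\sigma\not\Vdash_w\bot$; $\sigma\Vdash_wA\supset B$ iff $\sigma\not\Vdash_wA$ or $\sigma\Vdash_wB$; $\sigma\Vdash_w\forall xA$ iff $\sigma^{x\triangleright o}\Vdash_wA$ for every $o\in\mathcal D_w$; $\sigma\Vdash_w\Box A$ iff $\sigma\Vdash_vA$ for all $v$ with $w\mathcal Rv$. A formula is valid in a frame iff it is satisfied at all worlds of all models on the frame under all assignments. Axiom names correspond to frame properties: $\mathbf D$: $\mathcal R$ serial; $\mathbf T$: reflexive; $\mathbf B$: symmetric; $\mathbf 4$: transitive; $\mathbf 5$: Euclidean ($w\mathcal Rv$ and $w\mathcal Ru$ imply $v\mathcal Ru$); $\mathbf{CBF}$: $w\mathcal Rv$ implies $\mathcal D_w\subseteq\mathcal D_v$; $\mathbf{BF}$: $w\mathcal Rv$ implies $\mathcal D_w\supseteq\mathcal D_v$; $\mathbf{UI}$: $\mathcal D_w=\mathcal D_v$ for all $w,v$. For $\mathsf L\subseteq\{\mathbf D,\mathbf T,\mathbf B,\mathbf 4,\mathbf 5,\mathbf{CBF},\mathbf{BF},\mathbf{UI}\}$, a $\mathsf{Q.L}$-frame is a frame with the properties of all members of $\mathsf L$; a formula is $\mathsf{Q.L}$-valid iff it is valid in all $\mathsf{Q.L}$-frames. $\mathsf L$ is properly closed iff for every $Z\in\{\mathbf 4,\mathbf 5,\mathbf{CBF},\mathbf{BF}\}$, if all $\mathsf{Q.L}$-frames have the property of $Z$, then $Z\in\mathsf L$. **Nested sequents.** A sequent is $X;\Gamma\Rightarrow\Delta$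 with $X$ (the signature) a finite multiset of variables and $\Gamma,\Delta$ finite multisets of formulas (an omitted signature is empty). A nested sequent is $X;\Gamma\Rightarrow\Delta,[\mathcal S_1],\dots,[\mathcal S_n]$ with $\mathcal S_i$ nested sequents: a finite tree of sequents with root $X;\Gamma\Rightarrow\Delta$ and the $\mathcal S_i$ as immediate subtrees (order irrelevant). A context $\mathcal S\{\cdot\}\cdots\{\cdot\}$ is a nested sequent with finitely many holes, each located at some node, in arbitrary relative positions (several holes may be at one node). Plugging $Y;\Pi\Rightarrow\Sigma,[\mathcal S'_1],\dots,[\mathcal S_k']$ into a hole at a node adds $Y,\Pi,\Sigma$ to the signature, antecedent, succedent of that node (multiset union) and adds the $\mathcal S'_j$ as further children; plugging $\emptyset$ removes the hole. The depth of a hole is the distance of its node from the root. When a bracketed component $[Y;\Pi\Rightarrow\Sigma]$ is displayed in both premiss and conclusion of a rule, that node may have further children, which stay attached to it; components displayed as newly created are leaves. **Formula interpretation.** With $\mathcal Ex:=\exists y(y=x)$, empty conjunction $\top$ and empty disjunction $\bot$, $$\mathtt{fm}(X;\Gamma\Rightarrow\Delta,[\mathcal S_1],\dots,[\mathcal S_n])\equiv\Big(\bigwedge_{x\in X}\mathcal Ex\wedge\bigwedge\Gamma\supset\bigvee\Delta\Big)\lor\bigvee_{k=1}^n\Box\,\mathtt{fm}(\mathcal S_k).$$ **Rules** (premisses / conclusion). $\mathsf{NQ.K}$ consists of: - Initial sequents $\mathcal S\{X;P,\Gamma\Rightarrow\Delta,P\}$, $P$ atomic; and $L\bot$: $\mathcal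 S\{X;\bot,\Gamma\Rightarrow\Delta\}$ (no premisses). - $L{\supset}$: $\mathcal S\{X;\Gamma\Rightarrow\Delta,A\}$ and $\mathcal S\{X;B,\Gamma\Rightarrow\Delta\}$ / $\mathcal S\{X;A\supset B,\Gamma\Rightarrow\Delta\}$. $R{\supset}$: $\mathcal S\{X;A,\Gamma\Rightarrow\Delta,B\}$ / $\mathcal S\{X;\Gamma\Rightarrow\Delta,A\supset B\}$. - $L\forall$: $\mathcal S\{X,z;A(z/x),\forall xA,\Gamma\Rightarrow\Delta\}$ / $\mathcal S\{X,z;\forall xA,\Gamma\Rightarrow\Delta\}$. $R\forall$: $\mathcal S\{X,y;\Gamma\Rightarrow\Delta,A(y/x)\}$ / $\mathcal S\{X;\Gamma\Rightarrow\Delta,\forall xA\}$, $y$ (the eigenvariable) fresh, i.e. not occurring in the conclusion. - $L\Box$: $\mathcal S\{X;\Box A,\Gamma\Rightarrow\Delta,[Y;A,\Pi\Rightarrow\Sigma]\}$ / $\mathcal S\{X;\Box A,\Gamma\Rightarrow\Delta,[Y;\Pi\Rightarrow\Sigma]\}$. $R\Box$: $\mathcal S\{X;\Gamma\Rightarrow\Delta,[\emptyset;\Rightarrow A]\}$ / $\mathcal S\{X;\Gamma\Rightarrow\Delta,\Box A\}$. - $Ref$: $\mathcal S\{X;x=x,\Gamma\Rightarrow\Delta\}$ / $\mathcal S\{X;\Gamma\Rightarrow\Delta\}$. $Repl$ ($P$ atomic): $\mathcal S\{X;P(y/z),x=y,P(x/z),\Gamma\Rightarrow\Delta\}$ / $\mathcal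 S\{X;x=y,P(x/z),\Gamma\Rightarrow\Delta\}$. $Repl_X$: $\mathcal S\{X,x,y;x=y,\Gamma\Rightarrow\Delta\}$ / $\mathcal S\{X,x;x=y,\Gamma\Rightarrow\Delta\}$. $Rig$: $\mathcal S\{X;x=y,\Gamma\Rightarrow\Delta\}\{Y;x=y,\Pi\Rightarrow\Sigma\}$ / $\mathcal S\{X;x=y,\Gamma\Rightarrow\Delta\}\{Y;\Pi\Rightarrow\Sigma\}$. $\mathsf{NQ.L}$ adds the rule of each member of $\mathsf L$: - $R_D$ ($\mathbf D$): $\mathcal S\{X;\Gamma\Rightarrow\Delta,[\emptyset;\Rightarrow]\}$ / $\mathcal S\{X;\Gamma\Rightarrow\Delta\}$. $R_T$ ($\mathbf T$): $\mathcal S\{X;A,\Box A,\Gamma\Rightarrow\Delta\}$ / $\mathcal S\{X;\Box A,\Gamma\Rightarrow\Delta\}$. $R_B$ ($\mathbf B$): $\mathcal S\{X;A,\Gamma\Rightarrow\Delta,[Y;\Box A,\Pi\Rightarrow\Sigma]\}$ / $\mathcal S\{X;\Gamma\Rightarrow\Delta,[Y;\Box A,\Pi\Rightarrow\Sigma]\}$. $R_4$ ($\mathbf 4$): $\mathcal S\{X;\Box A,\Gamma\Rightarrow\Delta,[Y;\Box A,\Pi\Rightarrow\Sigma]\}$ / $\mathcal S\{X;\Box A,\Gamma\Rightarrow\Delta,[Y;\Pi\Rightarrow\Sigma]\}$. $R_5$ ($\mathbf 5$): $\mathcal S\{X;\Box A,\Gamma\Rightarrow\Delta\}\{Y;\Box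 A,\Pi\Rightarrow\Sigma\}$ / $\mathcal S\{X;\Box A,\Gamma\Rightarrow\Delta\}\{Y;\Pi\Rightarrow\Sigma\}$, first hole of depth $\ge1$. - $R_{cbf}$ ($\mathbf{CBF}$): $\mathcal S\{X,x;\Gamma\Rightarrow\Delta,[Y,x;\Pi\Rightarrow\Sigma]\}$ / $\mathcal S\{X,x;\Gamma\Rightarrow\Delta,[Y;\Pi\Rightarrow\Sigma]\}$. $R_{bf}$ ($\mathbf{BF}$): $\mathcal S\{X,x;\Gamma\Rightarrow\Delta,[Y,x;\Pi\Rightarrow\Sigma]\}$ / $\mathcal S\{X;\Gamma\Rightarrow\Delta,[Y,x;\Pi\Rightarrow\Sigma]\}$. $R_{ui}$ ($\mathbf{UI}$): $\mathcal S\{X,x;\Gamma\Rightarrow\Delta\}$ / $\mathcal S\{X;\Gamma\Rightarrow\Delta\}$. - $R_{5dom}$: $\mathcal S\{X,x;\Gamma\Rightarrow\Delta\}\{Y,x;\Pi\Rightarrow\Sigma\}$ / $\mathcal S\{X,x;\Gamma\Rightarrow\Delta\}\{Y;\Pi\Rightarrow\Sigma\}$, both holes of depth $\ge1$; it is a rule of $\mathsf{NQ.L}$ iff $\mathbf 5\in\mathsf L$ and $\{\mathbf{CBF},\mathbf{BF}\}\cap\mathsf L\ne\emptyset$. $\mathsf{NQ.L}$ is properly closed iff $\mathsf L$ is properly closed and $R_{5dom}$ is included exactly as just stated. **Derivations.** An $\mathsf{NQ.L}$-derivation of $\mathcal S$ is a finite tree of nested sequents with root $\mathcal S$, built by the rules,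 with leaves initial sequents (or instances of $L\bot$). Only derivations of pure sequents are considered: no variable occurs both free and bound, and eigenvariables are pairwise distinct. $\mathsf{NQ.L}\vdash\mathcal S$ iff $\mathcal S$ or an alphabetical variant (bound renaming) of it has a derivation. *)

theory Defs
  imports Main "HOL-Library.Multiset" "HOL-Library.Countable_Set"
begin

section \<open>Language\<close>

type_synonym var = nat

text \<open>
  An atom \<open>Pred i xs\<close> is \<open>R\<^sup>n\<^sub>i(xs)\<close> with \<open>n = length xs\<close>, so a predicate symbol is a pair of an
  arity and an index.  A language is given by the index sets \<open>Rel n\<close> of its \<open>n\<close>-ary predicates.
\<close>

datatype 'p fm =
    Pred 'p "var list"
  | Eq var var
  | Bot
  | Imp "'p fm" "'p fm"
  | All var "'p fm"
  | Box "'p fm"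

primrec in_lang :: "(nat \<Rightarrow> 'p set) \<Rightarrow> 'p fm \<Rightarrow> bool" where
  "in_lang Rel (Pred i xs) \<longleftrightarrow> i \<in> Rel (length xs)"
| "in_lang Rel (Eq x y) \<longleftrightarrow> True"
| "in_lang Rel Bot \<longleftrightarrow> True"
| "in_lang Rel (Imp A B) \<longleftrightarrow> in_lang Rel A \<and> in_lang Rel B"
| "in_lang Rel (All x A) \<longleftrightarrow> in_lang Rel A"
| "in_lang Rel (Box A) \<longleftrightarrow> in_lang Rel A"

fun atomic :: "'p fm \<Rightarrow> bool" where
  "atomic (Pred i xs) = True"
| "atomic (Eq x y) = True"
| "atomic _ = False"

definition Neg :: "'p fm \<Rightarrow> 'p fm" where
  "Neg A = Imp A Bot"

definition Top :: "'p fm" where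
  "Top = Neg Bot"

definition Conj :: "'p fm \<Rightarrow> 'p fm \<Rightarrow> 'p fm" where
  "Conj A B = Neg (Imp A (Neg B))"

definition Disj :: "'p fm \<Rightarrow> 'p fm \<Rightarrow> 'p fm" where
  "Disj A B = Imp (Neg A) B"

definition Ex :: "var \<Rightarrow> 'p fm \<Rightarrow> 'p fm" where
  "Ex x A = Neg (All x (Neg A))"

text \<open>The bound variable of \<open>\<exists>y(y = x)\<close> only has to differ from \<open>x\<close>.\<close>

definition Exists_pred :: "var \<Rightarrow> 'p fm" where
  "Exists_pred x = Ex (Suc x) (Eq (Suc x) x)"

primrec fv :: "'p fm \<Rightarrow> var set" where
  "fv (Pred i xs) = set xs"
| "fv (Eq x y) = {x, y}"
| "fv Bot = {}"
| "fv (Imp A B) = fv A \<union> fv B"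
| "fv (All x A) = fv A - {x}"
| "fv (Box A) = fv A"

primrec bv :: "'p fm \<Rightarrow> var set" where
  "bv (Pred i xs) = {}"
| "bv (Eq x y) = {}"
| "bv Bot = {}"
| "bv (Imp A B) = bv A \<union> bv B"
| "bv (All x A) = insert x (bv A)"
| "bv (Box A) = bv A"

text \<open>
  Capture-avoiding substitution is defined simultaneously for all variables so that it is
  structurally recursive; a bound variable is renamed only if it would capture a variable.
\<close>

primrec ssubst :: "(var \<Rightarrow> var) \<Rightarrow> 'p fm \<Rightarrow> 'p fm" where
  "ssubst s (Pred i xs) = Pred i (map s xs)"
| "ssubst s (Eq x y) = Eq (s x) (s y)"
| "ssubst s Bot = Bot"
| "ssubst s (Imp A B) = Imp (ssubst s A) (ssubst s B)"
| "ssubst s (All x A) =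
     (let F = s ` (fv A - {x});
          x' = (if x \<in> F then LEAST u. u \<notin> F else x)
      in All x' (ssubst (s(x := x')) A))"
| "ssubst s (Box A) = Box (ssubst s A)"

text \<open>\<open>subst A y x\<close> is \<open>A(y/x)\<close>.\<close>

definition subst :: "'p fm \<Rightarrow> var \<Rightarrow> var \<Rightarrow> 'p fm" where
  "subst A y x = ssubst (id(x := y)) A"

inductive alpha :: "'p fm \<Rightarrow> 'p fm \<Rightarrow> bool" where
  alpha_refl: "alpha A A"
| alpha_sym: "alpha A B \<Longrightarrow> alpha B A"
| alpha_trans: "alpha A B \<Longrightarrow> alpha B C \<Longrightarrow> alpha A C"
| alpha_Imp: "alpha A A' \<Longrightarrow> alpha B B' \<Longrightarrow> alpha (Imp A B) (Imp A' B')"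
| alpha_All: "alpha A A' \<Longrightarrow> alpha (All x A) (All x A')"
| alpha_Box: "alpha A A' \<Longrightarrow> alpha (Box A) (Box A')"
| alpha_rename: "y \<notin> fv A \<Longrightarrow> alpha (All x A) (All y (subst A y x))"


section \<open>Semantics\<close>

record ('w, 'd) frame =
  worlds :: "'w set"
  acc :: "('w \<times> 'w) set"
  dom :: "'w \<Rightarrow> 'd set"

definition is_frame :: "('w, 'd) frame \<Rightarrow> bool" where
  "is_frame F \<longleftrightarrow> worlds F \<noteq> {} \<and> acc F \<subseteq> worlds F \<times> worlds F \<and> (\<exists>v\<in>worlds F. dom F v \<noteq> {})"

definition dom_all :: "('w, 'd) frame \<Rightarrow> 'd set" where
  "dom_all F = (\<Union>v\<in>worlds F. dom F v)"

text \<open>\<open>V w n i\<close> is the extension of \<open>R\<^sup>n\<^sub>i\<close> at \<open>w\<close>.\<close>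

type_synonym ('w, 'd, 'p) valuation = "'w \<Rightarrow> nat \<Rightarrow> 'p \<Rightarrow> 'd list set"

definition is_valuation :: "('w, 'd) frame \<Rightarrow> ('w, 'd, 'p) valuation \<Rightarrow> bool" where
  "is_valuation F V \<longleftrightarrow>
     (\<forall>w\<in>worlds F. \<forall>n i. V w n i \<subseteq> {ds. length ds = n \<and> set ds \<subseteq> dom_all F})"

definition is_assignment :: "('w, 'd) frame \<Rightarrow> (var \<Rightarrow> 'd) \<Rightarrow> bool" where
  "is_assignment F \<sigma> \<longleftrightarrow> (\<forall>x. \<sigma> x \<in> dom_all F)"

primrec sat :: "('w, 'd) frame \<Rightarrow> ('w, 'd, 'p) valuation \<Rightarrow> (var \<Rightarrow> 'd) \<Rightarrow> 'w \<Rightarrow> 'p fm \<Rightarrow> bool" where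
  "sat F V \<sigma> w (Pred i xs) \<longleftrightarrow> map \<sigma> xs \<in> V w (length xs) i"
| "sat F V \<sigma> w (Eq x y) \<longleftrightarrow> \<sigma> x = \<sigma> y"
| "sat F V \<sigma> w Bot \<longleftrightarrow> False"
| "sat F V \<sigma> w (Imp A B) \<longleftrightarrow> \<not> sat F V \<sigma> w A \<or> sat F V \<sigma> w B"
| "sat F V \<sigma> w (All x A) \<longleftrightarrow> (\<forall>d\<in>dom F w. sat F V (\<sigma>(x := d)) w A)"
| "sat F V \<sigma> w (Box A) \<longleftrightarrow> (\<forall>v. (w, v) \<in> acc F \<longrightarrow> sat F V \<sigma> v A)"

definition valid_in :: "('w, 'd) frame \<Rightarrow> 'p fm \<Rightarrow> bool" where
  "valid_in F A \<longleftrightarrow>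
     (\<forall>V \<sigma>. \<forall>w\<in>worlds F. is_valuation F V \<longrightarrow> is_assignment F \<sigma> \<longrightarrow> sat F V \<sigma> w A)"

datatype axm = Ax_D | Ax_T | Ax_B | Ax_4 | Ax_5 | Ax_CBF | Ax_BF | Ax_UI

primrec has_property :: "('w, 'd) frame \<Rightarrow> axm \<Rightarrow> bool" where
  "has_property F Ax_D \<longleftrightarrow> (\<forall>w\<in>worlds F. \<exists>v. (w, v) \<in> acc F)"
| "has_property F Ax_T \<longleftrightarrow> (\<forall>w\<in>worlds F. (w, w) \<in> acc F)"
| "has_property F Ax_B \<longleftrightarrow> sym (acc F)"
| "has_property F Ax_4 \<longleftrightarrow> trans (acc F)"
| "has_property F Ax_5 \<longleftrightarrow> (\<forall>w v u. (w, v) \<in> acc F \<longrightarrow> (w, u) \<in> acc F \<longrightarrow> (v, u) \<in> acc F)"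
| "has_property F Ax_CBF \<longleftrightarrow> (\<forall>w v. (w, v) \<in> acc F \<longrightarrow> dom F w \<subseteq> dom F v)"
| "has_property F Ax_BF \<longleftrightarrow> (\<forall>w v. (w, v) \<in> acc F \<longrightarrow> dom F v \<subseteq> dom F w)"
| "has_property F Ax_UI \<longleftrightarrow> (\<forall>w\<in>worlds F. \<forall>v\<in>worlds F. dom F w = dom F v)"

definition QL_frame :: "axm set \<Rightarrow> ('w, 'd) frame \<Rightarrow> bool" where
  "QL_frame L F \<longleftrightarrow> is_frame F \<and> (\<forall>Z\<in>L. has_property F Z)"

text \<open>
  HOL cannot quantify over types inside a formula, so "all frames" means all frames whose worlds
  and objects are taken from two given types, passed as \<open>TYPE('w)\<close> and \<open>TYPE('d)\<close>.  By
  Loewenheim-Skolem, \<open>QL_valid\<close> and \<open>properly_closed\<close> do not depend on the choice as long as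
  both types are infinite.
\<close>

definition QL_valid :: "'w itself \<Rightarrow> 'd itself \<Rightarrow> axm set \<Rightarrow> 'p fm \<Rightarrow> bool" where
  "QL_valid _ _ L A \<longleftrightarrow> (\<forall>F :: ('w, 'd) frame. QL_frame L F \<longrightarrow> valid_in F A)"

definition properly_closed :: "'w itself \<Rightarrow> 'd itself \<Rightarrow> axm set \<Rightarrow> bool" where
  "properly_closed _ _ L \<longleftrightarrow>
     (\<forall>Z\<in>{Ax_4, Ax_5, Ax_CBF, Ax_BF}.
        (\<forall>F :: ('w, 'd) frame. QL_frame L F \<longrightarrow> has_property F Z) \<longrightarrow> Z \<in> L)"


section \<open>Nested sequents\<close>

text \<open>\<open>NS X \<Gamma> \<Delta> N\<close> is \<open>X; \<Gamma> \<Rightarrow> \<Delta>, [S\<^sub>1], \<dots>, [S\<^sub>n]\<close> where \<open>N\<close> is the multiset of the \<open>S\<^sub>k\<close>.\<close>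

datatype 'p nseq = NS "var multiset" "'p fm multiset" "'p fm multiset" "'p nseq multiset"

text \<open>Addition merges two nested sequents at their roots; \<open>0\<close> is the empty nested sequent.\<close>

instantiation nseq :: (type) comm_monoid_add
begin

definition zero_nseq :: "'a nseq" where
  "zero_nseq = NS {#} {#} {#} {#}"

fun plus_nseq :: "'a nseq \<Rightarrow> 'a nseq \<Rightarrow> 'a nseq" where
  "plus_nseq (NS X \<Gamma> \<Delta> N) (NS Y \<Pi> \<Sigma> M) = NS (X + Y) (\<Gamma> + \<Pi>) (\<Delta> + \<Sigma>) (N + M)"

instance
proof
  fix a b c :: "'a nseq"
  show "a + b + c = a + (b + c)"
    by (cases a; cases b; cases c) (simp add: add.assoc)
  show "a + b = b + a"
    by (cases a; cases b) (simp add: add.commute)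
  show "0 + a = a"
    by (cases a) (simp add: zero_nseq_def)
qed

end

primrec nseq_in_lang :: "(nat \<Rightarrow> 'p set) \<Rightarrow> 'p nseq \<Rightarrow> bool" where
  "nseq_in_lang Rel (NS X \<Gamma> \<Delta> N) \<longleftrightarrow>
     (\<forall>A\<in>#\<Gamma> + \<Delta>. in_lang Rel A) \<and> (\<forall>b\<in>#image_mset (nseq_in_lang Rel) N. b)"

primrec nseq_fv :: "'p nseq \<Rightarrow> var set" where
  "nseq_fv (NS X \<Gamma> \<Delta> N) =
     set_mset X \<union> (\<Union>A\<in>set_mset (\<Gamma> + \<Delta>). fv A) \<union> \<Union>(set_mset (image_mset nseq_fv N))"

primrec nseq_bv :: "'p nseq \<Rightarrow> var set" where
  "nseq_bv (NS X \<Gamma> \<Delta> N) =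
     (\<Union>A\<in>set_mset (\<Gamma> + \<Delta>). bv A) \<union> \<Union>(set_mset (image_mset nseq_bv N))"

definition pure :: "'p nseq \<Rightarrow> bool" where
  "pure S \<longleftrightarrow> nseq_fv S \<inter> nseq_bv S = {}"

inductive nseq_alpha :: "'p nseq \<Rightarrow> 'p nseq \<Rightarrow> bool" where
  "rel_mset alpha \<Gamma> \<Gamma>' \<Longrightarrow> rel_mset alpha \<Delta> \<Delta>' \<Longrightarrow> rel_mset nseq_alpha N N'
   \<Longrightarrow> nseq_alpha (NS X \<Gamma> \<Delta> N) (NS X \<Gamma>' \<Delta>' N')"

text \<open>The order in which the members of a multiset are joined is chosen arbitrarily.\<close>

definition enum_mset :: "'a multiset \<Rightarrow> 'a list" where
  "enum_mset M = (SOME xs. mset xs = M)"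

definition BigConj :: "'p fm multiset \<Rightarrow> 'p fm" where
  "BigConj M = foldr Conj (enum_mset M) Top"

definition BigDisj :: "'p fm multiset \<Rightarrow> 'p fm" where
  "BigDisj M = foldr Disj (enum_mset M) Bot"

primrec fm_of :: "'p nseq \<Rightarrow> 'p fm" where
  "fm_of (NS X \<Gamma> \<Delta> N) =
     Disj (Imp (Conj (BigConj (image_mset Exists_pred X)) (BigConj \<Gamma>)) (BigDisj \<Delta>))
          (BigDisj (image_mset Box (image_mset fm_of N)))"


section \<open>Contexts\<close>

text \<open>
  A context is a nested sequent each of whose nodes carries a multiset of holes, named by natural
  numbers; a context with \<open>n\<close> holes has exactly one hole named \<open>i\<close> for each \<open>i < n\<close>.
\<close>

datatype 'p ctx =
  Ctx "var multiset" "'p fm multiset" "'p fm multiset" "nat multiset" "'p ctx multiset"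

primrec holes :: "'p ctx \<Rightarrow> nat multiset" where
  "holes (Ctx X \<Gamma> \<Delta> H N) = H + sum_mset (image_mset holes N)"

definition is_ctx :: "nat \<Rightarrow> 'p ctx \<Rightarrow> bool" where
  "is_ctx n C \<longleftrightarrow> holes C = mset [0..<n]"

text \<open>\<open>hole_depth C i d\<close>: the hole \<open>i\<close> is at a node of distance \<open>d\<close> from the root.\<close>

inductive hole_depth :: "'p ctx \<Rightarrow> nat \<Rightarrow> nat \<Rightarrow> bool" where
  "i \<in># H \<Longrightarrow> hole_depth (Ctx X \<Gamma> \<Delta> H N) i 0"
| "C \<in># N \<Longrightarrow> hole_depth C i d \<Longrightarrow> hole_depth (Ctx X \<Gamma> \<Delta> H N) i (Suc d)"

primrec fill :: "(nat \<Rightarrow> 'p nseq) \<Rightarrow> 'p ctx \<Rightarrow> 'p nseq" where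
  "fill f (Ctx X \<Gamma> \<Delta> H N) = NS X \<Gamma> \<Delta> (image_mset (fill f) N) + sum_mset (image_mset f H)"

definition plug1 :: "'p ctx \<Rightarrow> 'p nseq \<Rightarrow> 'p nseq" where
  "plug1 C S = fill (\<lambda>_. S) C"

definition plug2 :: "'p ctx \<Rightarrow> 'p nseq \<Rightarrow> 'p nseq \<Rightarrow> 'p nseq" where
  "plug2 C S T = fill (\<lambda>i. if i = 0 then S else T) C"


section \<open>The nested calculi\<close>

text \<open>
  \<open>rule L E Ps S\<close>: the nested sequent \<open>S\<close> follows from the premisses \<open>Ps\<close> by a rule of the
  calculus for \<open>L\<close>; \<open>E\<close> lists the eigenvariables of this inference (at most one).  In a displayed
  component \<open>NS Y \<Pi> \<Sigma> M\<close>, the multiset \<open>M\<close> holds its further children.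
\<close>

abbreviation seq :: "var multiset \<Rightarrow> 'p fm multiset \<Rightarrow> 'p fm multiset \<Rightarrow> 'p nseq" where
  "seq X \<Gamma> \<Delta> \<equiv> NS X \<Gamma> \<Delta> {#}"

inductive rule :: "axm set \<Rightarrow> var list \<Rightarrow> 'p nseq list \<Rightarrow> 'p nseq \<Rightarrow> bool" for L :: "axm set" where
  Init:
    "is_ctx 1 C \<Longrightarrow> atomic P \<Longrightarrow>
     rule L [] [] (plug1 C (seq X (add_mset P \<Gamma>) (add_mset P \<Delta>)))"
| LBot:
    "is_ctx 1 C \<Longrightarrow>
     rule L [] [] (plug1 C (seq X (add_mset Bot \<Gamma>) \<Delta>))"
| LImp:
    "is_ctx 1 C \<Longrightarrow>
     rule L []
       [plug1 C (seq X \<Gamma> (add_mset A \<Delta>)), plug1 C (seq X (add_mset B \<Gamma>) \<Delta>)]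
       (plug1 C (seq X (add_mset (Imp A B) \<Gamma>) \<Delta>))"
| RImp:
    "is_ctx 1 C \<Longrightarrow>
     rule L []
       [plug1 C (seq X (add_mset A \<Gamma>) (add_mset B \<Delta>))]
       (plug1 C (seq X \<Gamma> (add_mset (Imp A B) \<Delta>)))"
| LAll:
    "is_ctx 1 C \<Longrightarrow>
     rule L []
       [plug1 C (seq (add_mset z X) (add_mset (subst A z x) (add_mset (All x A) \<Gamma>)) \<Delta>)]
       (plug1 C (seq (add_mset z X) (add_mset (All x A) \<Gamma>) \<Delta>))"
| RAll:
    "is_ctx 1 C \<Longrightarrow> S = plug1 C (seq X \<Gamma> (add_mset (All x A) \<Delta>)) \<Longrightarrow>
     y \<notin> nseq_fv S \<union> nseq_bv S \<Longrightarrow>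
     rule L [y]
       [plug1 C (seq (add_mset y X) \<Gamma> (add_mset (subst A y x) \<Delta>))]
       S"
| LBox:
    "is_ctx 1 C \<Longrightarrow>
     rule L []
       [plug1 C (NS X (add_mset (Box A) \<Gamma>) \<Delta> {#NS Y (add_mset A \<Pi>) \<Sigma> M#})]
       (plug1 C (NS X (add_mset (Box A) \<Gamma>) \<Delta> {#NS Y \<Pi> \<Sigma> M#}))"
| RBox:
    "is_ctx 1 C \<Longrightarrow>
     rule L []
       [plug1 C (NS X \<Gamma> \<Delta> {#seq {#} {#} {#A#}#})]
       (plug1 C (seq X \<Gamma> (add_mset (Box A) \<Delta>)))"
| Ref:
    "is_ctx 1 C \<Longrightarrow>
     rule L []
       [plug1 C (seq X (add_mset (Eq x x) \<Gamma>) \<Delta>)]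
       (plug1 C (seq X \<Gamma> \<Delta>))"
| Repl:
    "is_ctx 1 C \<Longrightarrow> atomic P \<Longrightarrow>
     rule L []
       [plug1 C (seq X (add_mset (subst P y z) (add_mset (Eq x y) (add_mset (subst P x z) \<Gamma>))) \<Delta>)]
       (plug1 C (seq X (add_mset (Eq x y) (add_mset (subst P x z) \<Gamma>)) \<Delta>))"
| ReplX:
    "is_ctx 1 C \<Longrightarrow>
     rule L []
       [plug1 C (seq (add_mset x (add_mset y X)) (add_mset (Eq x y) \<Gamma>) \<Delta>)]
       (plug1 C (seq (add_mset x X) (add_mset (Eq x y) \<Gamma>) \<Delta>))"
| Rig:
    "is_ctx 2 C \<Longrightarrow>
     rule L []
       [plug2 C (seq X (add_mset (Eq x y) \<Gamma>) \<Delta>) (seq Y (add_mset (Eq x y) \<Pi>) \<Sigma>)]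
       (plug2 C (seq X (add_mset (Eq x y) \<Gamma>) \<Delta>) (seq Y \<Pi> \<Sigma>))"
| R_D:
    "Ax_D \<in> L \<Longrightarrow> is_ctx 1 C \<Longrightarrow>
     rule L []
       [plug1 C (NS X \<Gamma> \<Delta> {#seq {#} {#} {#}#})]
       (plug1 C (seq X \<Gamma> \<Delta>))"
| R_T:
    "Ax_T \<in> L \<Longrightarrow> is_ctx 1 C \<Longrightarrow>
     rule L []
       [plug1 C (seq X (add_mset A (add_mset (Box A) \<Gamma>)) \<Delta>)]
       (plug1 C (seq X (add_mset (Box A) \<Gamma>) \<Delta>))"
| R_B:
    "Ax_B \<in> L \<Longrightarrow> is_ctx 1 C \<Longrightarrow>
     rule L []
       [plug1 C (NS X (add_mset A \<Gamma>) \<Delta> {#NS Y (add_mset (Box A) \<Pi>) \<Sigma> M#})]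
       (plug1 C (NS X \<Gamma> \<Delta> {#NS Y (add_mset (Box A) \<Pi>) \<Sigma> M#}))"
| R_4:
    "Ax_4 \<in> L \<Longrightarrow> is_ctx 1 C \<Longrightarrow>
     rule L []
       [plug1 C (NS X (add_mset (Box A) \<Gamma>) \<Delta> {#NS Y (add_mset (Box A) \<Pi>) \<Sigma> M#})]
       (plug1 C (NS X (add_mset (Box A) \<Gamma>) \<Delta> {#NS Y \<Pi> \<Sigma> M#}))"
| R_5:
    "Ax_5 \<in> L \<Longrightarrow> is_ctx 2 C \<Longrightarrow> hole_depth C 0 d \<Longrightarrow> d \<ge> 1 \<Longrightarrow>
     rule L []
       [plug2 C (seq X (add_mset (Box A) \<Gamma>) \<Delta>) (seq Y (add_mset (Box A) \<Pi>) \<Sigma>)]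
       (plug2 C (seq X (add_mset (Box A) \<Gamma>) \<Delta>) (seq Y \<Pi> \<Sigma>))"
| R_cbf:
    "Ax_CBF \<in> L \<Longrightarrow> is_ctx 1 C \<Longrightarrow>
     rule L []
       [plug1 C (NS (add_mset x X) \<Gamma> \<Delta> {#NS (add_mset x Y) \<Pi> \<Sigma> M#})]
       (plug1 C (NS (add_mset x X) \<Gamma> \<Delta> {#NS Y \<Pi> \<Sigma> M#}))"
| R_bf:
    "Ax_BF \<in> L \<Longrightarrow> is_ctx 1 C \<Longrightarrow>
     rule L []
       [plug1 C (NS (add_mset x X) \<Gamma> \<Delta> {#NS (add_mset x Y) \<Pi> \<Sigma> M#})]
       (plug1 C (NS X \<Gamma> \<Delta> {#NS (add_mset x Y) \<Pi> \<Sigma> M#}))"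
| R_ui:
    "Ax_UI \<in> L \<Longrightarrow> is_ctx 1 C \<Longrightarrow>
     rule L []
       [plug1 C (seq (add_mset x X) \<Gamma> \<Delta>)]
       (plug1 C (seq X \<Gamma> \<Delta>))"
| R_5dom:
    "Ax_5 \<in> L \<Longrightarrow> {Ax_CBF, Ax_BF} \<inter> L \<noteq> {} \<Longrightarrow> is_ctx 2 C \<Longrightarrow>
     hole_depth C 0 d \<Longrightarrow> d \<ge> 1 \<Longrightarrow> hole_depth C 1 e \<Longrightarrow> e \<ge> 1 \<Longrightarrow>
     rule L []
       [plug2 C (seq (add_mset x X) \<Gamma> \<Delta>) (seq (add_mset x Y) \<Pi> \<Sigma>)]
       (plug2 C (seq (add_mset x X) \<Gamma> \<Delta>) (seq Y \<Pi> \<Sigma>))"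

text \<open>
  \<open>derivation Rel L E S\<close>: there is a finite tree of pure nested sequents over the language, built
  by the rules, with root \<open>S\<close>, in which \<open>E\<close> lists the eigenvariables of all inferences, with
  repetitions.  The eigenvariables are required to be pairwise distinct in \<open>provable\<close>, across the
  whole tree.
\<close>

inductive derivation ::
  "(nat \<Rightarrow> 'p set) \<Rightarrow> axm set \<Rightarrow> var list \<Rightarrow> 'p nseq \<Rightarrow> bool"
  for Rel :: "nat \<Rightarrow> 'p set" and L :: "axm set" where
  "rule L E Ps S \<Longrightarrow> pure S \<Longrightarrow> nseq_in_lang Rel S \<Longrightarrow> list_all2 (derivation Rel L) Es Ps
   \<Longrightarrow> derivation Rel L (E @ concat Es) S"

definition provable :: "(nat \<Rightarrow> 'p set) \<Rightarrow> axm set \<Rightarrow> 'p nseq \<Rightarrow> bool" where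
  "provable Rel L S \<longleftrightarrow> (\<exists>S' E. nseq_alpha S S' \<and> derivation Rel L E S' \<and> distinct E)"

end

theory Submission
  imports Defs
begin

text \<open>
  Starting from an underivable nested sequent, one applies the rules bottom-up and fairly, each time
  keeping a premiss that is underivable; the limit is a possibly infinite tree of saturated sequents.
  The underivability that is propagated is that by derivations whose eigenvariables are pairwise
  distinct and belong to an infinite set \<open>V\<close>; this set is divided at rules with two
  premisses and loses the eigenvariable at \<open>R\<forall>\<close>, so that no renaming of derivations is needed.
  Passing to an alphabetical variant first, the bound variables form a finite set \<open>B\<close> that is
  disjoint from the free ones, and no substitution that occurs has to rename a bound variable.

  The nodes of the limit tree, related by the closure of the parent-child relation under the
  frame conditions of \<open>L\<close>, with domains the signatures modulo the equalities in the antecedents, form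
  a countermodel.  Proper closure of \<open>L\<close> is what makes the propagation rules of the calculus cover
  this closure.  An isolated reflexive world whose domain contains everything is added since
  variables outside all signatures must denote as well.
\<close>

section \<open>Substitution and renaming of bound variables\<close>

text \<open>Two features of the rules shape the construction. Most rules, read upwards, merely add a
  variable or an antecedent formula at one node, and these are not scheduled individually: the only
  demand is that an item be inserted whenever the result is still underivable. If the side
  conditions of some rule hold from some stage on, the insertion is permitted at all later stages,
  so a demand that recurs is met. The rules for \<supset> and the right rules for \<forall> and
  \<box>, however, consume their principal formula. Labels therefore grow only up to formulas that
  have been reduced, and the limit collects everything that was ever present. The relation of the
  countermodel is defined by cases on \<open>L\<close> instead of by iterated closure; in each case
  a box can be carried along it by the rules available there. Equations spread to all nodes, so the
  quotient of the variables can be computed at the root. Validity speaks of two arbitrary infinite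
  types, whereas this model is countable; an injective copy of it is used.\<close>

lemma finite_fv: "finite (fv A)" by (induction A) auto
lemma finite_bv: "finite (bv A)" by (induction A) auto

lemma fresh_Least: "finite (F :: nat set) \<Longrightarrow> (LEAST u. u \<notin> F) \<notin> F"
  by (metis LeastI_ex ex_new_if_finite infinite_UNIV_nat)

lemma sat_cong: "(\<And>x. x \<in> fv A \<Longrightarrow> \<sigma> x = \<tau> x) \<Longrightarrow> sat F V \<sigma> w A = sat F V \<tau> w A"
proof (induction A arbitrary: \<sigma> \<tau> w)
  case (Pred i xs)
  then have "map \<sigma> xs = map \<tau> xs" by simp
  then show ?case by (simp only: sat.simps)
next
  case (All x A)
  have "sat F V (\<sigma>(x := d)) w A = sat F V (\<tau>(x := d)) w A" for d
    by (rule All.IH) (use All.prems in auto)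
  then show ?case by simp
next
  case (Imp A B)
  have "sat F V \<sigma> w A = sat F V \<tau> w A" "sat F V \<sigma> w B = sat F V \<tau> w B"
    by (rule Imp.IH; use Imp.prems in simp)+
  then show ?case by simp
next
  case (Box A)
  have "sat F V \<sigma> v A = sat F V \<tau> v A" for v
    by (rule Box.IH) (use Box.prems in simp)
  then show ?case by simp
qed auto

text \<open>Below a quantifier the substitution becomes \<open>s(x := x')\<close>, which is why
  \<open>s\<close> is arbitrary. As \<open>x'\<close> is not the image of another free variable of
  the body, the two assignments to be compared agree on all its free variables, and
  \<open>sat_cong\<close> applies.\<close>

lemma sat_ssubst: "sat F V \<sigma> w (ssubst s A) = sat F V (\<sigma> \<circ> s) w A"
proof (induction A arbitrary: \<sigma> s w)
  case (All x A)
  define x' where "x' = (if x \<in> s ` (fv A - {x}) then LEAST u. u \<notin> s ` (fv A - {x}) else x)"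
  have x': "x' \<notin> s ` (fv A - {x})"
    unfolding x'_def by (auto intro!: fresh_Least simp: finite_fv)
  have "sat F V (\<sigma>(x' := d) \<circ> s(x := x')) w A = sat F V ((\<sigma> \<circ> s)(x := d)) w A" for d
    by (rule sat_cong) (use x' in auto)
  then show ?case
    by (simp only: ssubst.simps Let_def x'_def[symmetric] sat.simps All.IH)
qed auto

lemma sat_subst: "sat F V \<sigma> w (subst A y x) = sat F V (\<sigma>(x := \<sigma> y)) w A"
proof -
  have "\<sigma> \<circ> id(x := y) = \<sigma>(x := \<sigma> y)" by auto
  then show ?thesis by (simp add: subst_def sat_ssubst)
qed

lemma fv_ssubst: "fv (ssubst s A) = s ` fv A"
proof (induction A arbitrary: s)
  case (All x A)
  define x' where "x' = (if x \<in> s ` (fv A - {x}) then LEAST u. u \<notin> s ` (fv A - {x}) else x)"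
  have x': "x' \<notin> s ` (fv A - {x})"
    unfolding x'_def by (auto intro!: fresh_Least simp: finite_fv)
  have "(s(x := x')) ` fv A - {x'} = s ` (fv A - {x})"
    using x' by (auto split: if_splits)
  then show ?case by (simp add: Let_def x'_def[symmetric] All.IH)
qed auto

text \<open>\<open>ssubst\<close> renames a binder only when it equals the image of another free
  variable of its scope. The hypothesis rules this out: such an image is either that variable itself
  or no bound variable of \<open>A\<close>.\<close>

lemma bv_ssubst: "(\<And>y. y \<in> fv A \<Longrightarrow> s y = y \<or> s y \<notin> bv A) \<Longrightarrow> bv (ssubst s A) = bv A"
proof (induction A arbitrary: s)
  case (All x A)
  have "x \<notin> s ` (fv A - {x})"
  proof
    assume "x \<in> s ` (fv A - {x})"
    then obtain y where "y \<in> fv A" "y \<noteq> x" "x = s y" by auto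
    then show False using All.prems[of y] by auto
  qed
  moreover have "bv (ssubst (s(x := x)) A) = bv A"
    by (rule All.IH) (use All.prems in auto)
  ultimately show ?case by (simp add: Let_def)
next
  case (Imp A B)
  have "bv (ssubst s A) = bv A" by (rule Imp.IH) (use Imp.prems in auto)
  moreover have "bv (ssubst s B) = bv B" by (rule Imp.IH) (use Imp.prems in auto)
  ultimately show ?case by simp
qed auto

lemma in_lang_ssubst [simp]: "in_lang Rel (ssubst s A) = in_lang Rel A"
  by (induction A arbitrary: s) (auto simp: Let_def)

lemma in_lang_subst [simp]: "in_lang Rel (subst A y x) = in_lang Rel A"
  by (simp add: subst_def)

lemma fv_subst: "fv (subst A y x) = (id(x := y)) ` fv A"
  by (simp add: subst_def fv_ssubst)

lemma bv_subst: "y \<notin> bv A \<Longrightarrow> bv (subst A y x) = bv A"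
  unfolding subst_def by (rule bv_ssubst) auto

text \<open>Counts connectives and ignores variables, hence is invariant under substitution; the
  truth lemma descends to instances of a quantified formula, which are not subformulas of
  it.\<close>

primrec cpx :: "'p fm \<Rightarrow> nat" where
  "cpx (Pred i xs) = 0"
| "cpx (Eq x y) = 0"
| "cpx Bot = 0"
| "cpx (Imp A B) = Suc (cpx A + cpx B)"
| "cpx (All x A) = Suc (cpx A)"
| "cpx (Box A) = Suc (cpx A)"

lemma cpx_ssubst: "cpx (ssubst s A) = cpx A"
  by (induction A arbitrary: s) (auto simp: Let_def)

lemma cpx_subst [simp]: "cpx (subst A y x) = cpx A"
  by (simp add: subst_def cpx_ssubst)

lemma sat_alpha: "alpha A B \<Longrightarrow> sat F V \<sigma> w A = sat F V \<sigma> w B"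
proof (induction arbitrary: \<sigma> w rule: alpha.induct)
  case (alpha_rename y A x)
  have "sat F V (\<sigma>(y := d, x := d)) w A = sat F V (\<sigma>(x := d)) w A" for d
    by (rule sat_cong) (use alpha_rename in auto)
  then show ?case by (simp add: sat_subst)
qed auto

text \<open>Binders are numbered by nesting depth from \<open>n\<close> on. The body is treated
  first and with \<open>Suc n\<close>, so that its binders lie above \<open>n\<close>; if all
  variables of the formula lie below \<open>n\<close>, then \<open>n\<close> is fresh for the body
  and substituting it causes no capture.\<close>

primrec ren :: "nat \<Rightarrow> 'p fm \<Rightarrow> 'p fm" where
  "ren n (Pred i xs) = Pred i xs"
| "ren n (Eq x y) = Eq x y"
| "ren n Bot = Bot"
| "ren n (Imp A B) = Imp (ren n A) (ren n B)"
| "ren n (All x A) = All n (subst (ren (Suc n) A) n x)"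
| "ren n (Box A) = Box (ren n A)"

lemma ren_props:
  "fv A \<union> bv A \<subseteq> {..<n} \<Longrightarrow> fv (ren n A) = fv A \<and> bv (ren n A) \<subseteq> {n..} \<and> alpha A (ren n A)"
proof (induction A arbitrary: n)
  case (All x A)
  then have "fv A \<union> bv A \<subseteq> {..<Suc n}" by force
  then have IH: "fv (ren (Suc n) A) = fv A" "bv (ren (Suc n) A) \<subseteq> {Suc n..}" "alpha A (ren (Suc n) A)"
    using All.IH by blast+
  have x: "x < n" and A: "fv A \<subseteq> {..<n}" using All.prems by auto
  have n: "n \<notin> fv (ren (Suc n) A)" using A IH(1) by auto
  have "n \<notin> bv (ren (Suc n) A)" using IH(2) by auto
  then have "bv (subst (ren (Suc n) A) n x) \<subseteq> {n..}"
    using IH(2) by (force simp: bv_subst)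
  moreover have "fv (subst (ren (Suc n) A) n x) - {n} = fv A - {x}"
    using n x by (auto simp: fv_subst IH(1) split: if_splits)
  moreover have "alpha (All x A) (ren n (All x A))"
    using alpha_trans[OF alpha_All[OF IH(3)] alpha_rename[OF n]] by simp
  ultimately show ?case by simp
qed (auto intro: alpha_refl alpha_Imp alpha_Box)

lemma in_lang_ren [simp]: "in_lang Rel (ren n A) = in_lang Rel A"
  by (induction A arbitrary: n) auto

section \<open>Renaming and truth of nested sequents\<close>

primrec map_nseq_fm :: "('p fm \<Rightarrow> 'p fm) \<Rightarrow> 'p nseq \<Rightarrow> 'p nseq" where
  "map_nseq_fm f (NS X \<Gamma> \<Delta> N) =
     NS X (image_mset f \<Gamma>) (image_mset f \<Delta>) (image_mset (map_nseq_fm f) N)"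

lemma finite_nseq_fv: "finite (nseq_fv S)" by (induction S) (auto simp: finite_fv)
lemma finite_nseq_bv: "finite (nseq_bv S)" by (induction S) (auto simp: finite_bv)

lemma rel_mset_image: "(\<And>A. A \<in># M \<Longrightarrow> R A (f A)) \<Longrightarrow> rel_mset R M (image_mset f M)"
proof (induction M)
  case empty
  then show ?case by (simp add: rel_mset_Zero)
next
  case (add x M)
  then show ?case by (simp add: rel_mset_Plus)
qed

lemma nseq_rename:
  "nseq_fv S \<union> nseq_bv S \<subseteq> {..<n} \<Longrightarrow>
    nseq_alpha S (map_nseq_fm (ren n) S) \<and> nseq_fv (map_nseq_fm (ren n) S) = nseq_fv S \<and>
    nseq_bv (map_nseq_fm (ren n) S) \<subseteq> {n..} \<and>
    nseq_in_lang Rel (map_nseq_fm (ren n) S) = nseq_in_lang Rel S"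
proof (induction S)
  case (NS X \<Gamma> \<Delta> N)
  have A: "fv A \<union> bv A \<subseteq> {..<n}" if "A \<in># \<Gamma> + \<Delta>" for A
    using NS.prems that by fastforce
  have T: "nseq_fv T \<union> nseq_bv T \<subseteq> {..<n}" if "T \<in># N" for T
    using NS.prems that by fastforce
  have "rel_mset alpha \<Gamma> (image_mset (ren n) \<Gamma>)" "rel_mset alpha \<Delta> (image_mset (ren n) \<Delta>)"
    using ren_props[OF A] by (simp_all add: rel_mset_image)
  moreover have "rel_mset nseq_alpha N (image_mset (map_nseq_fm (ren n)) N)"
    using NS.IH T by (auto intro!: rel_mset_image)
  ultimately have "nseq_alpha (NS X \<Gamma> \<Delta> N) (map_nseq_fm (ren n) (NS X \<Gamma> \<Delta> N))"
    by (auto intro: nseq_alpha.intros)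
  moreover have "fv (ren n A) = fv A" if "A \<in># \<Gamma> + \<Delta>" for A
    using ren_props[OF A[OF that]] by auto
  then have "nseq_fv (map_nseq_fm (ren n) (NS X \<Gamma> \<Delta> N)) = nseq_fv (NS X \<Gamma> \<Delta> N)"
    using NS.IH T by simp
  moreover have "bv (ren n A) \<subseteq> {n..}" if "A \<in># \<Gamma> + \<Delta>" for A
    using ren_props[OF A[OF that]] by auto
  then have "nseq_bv (map_nseq_fm (ren n) (NS X \<Gamma> \<Delta> N)) \<subseteq> {n..}"
    using NS.IH T by (simp add: UN_subset_iff)
  moreover have "nseq_in_lang Rel (map_nseq_fm (ren n) (NS X \<Gamma> \<Delta> N)) = nseq_in_lang Rel (NS X \<Gamma> \<Delta> N)"
    using NS.IH T by (simp add: ball_Un)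
  ultimately show ?case by blast
qed

text \<open>The truth condition of \<open>fm_of\<close>, read off the tree, so that the arbitrary
  order behind \<open>BigConj\<close> and \<open>BigDisj\<close> disappears. It is a predicate of
  worlds because the recursion passes through \<open>image_mset\<close> while the box moves to
  another world.\<close>

primrec nseq_sat :: "('w, 'd) frame \<Rightarrow> ('w, 'd, 'p) valuation \<Rightarrow> (var \<Rightarrow> 'd) \<Rightarrow> 'p nseq \<Rightarrow> 'w \<Rightarrow> bool" where
  "nseq_sat F V \<sigma> (NS X \<Gamma> \<Delta> N) = (\<lambda>w.
     ((\<forall>x\<in>#X. \<sigma> x \<in> dom F w) \<longrightarrow> (\<forall>A\<in>#\<Gamma>. sat F V \<sigma> w A) \<longrightarrow> (\<exists>A\<in>#\<Delta>. sat F V \<sigma> w A)) \<or>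
     (\<exists>p\<in>#image_mset (nseq_sat F V \<sigma>) N. \<forall>v. (w, v) \<in> acc F \<longrightarrow> p v))"

lemma mset_enum_mset: "mset (enum_mset M) = M"
  unfolding enum_mset_def by (rule someI_ex) (rule ex_mset)

lemma set_enum_mset [simp]: "set (enum_mset M) = set_mset M"
  by (metis mset_enum_mset set_mset_mset)

lemma sat_BigConj: "sat F V \<sigma> w (BigConj M) \<longleftrightarrow> (\<forall>A\<in>#M. sat F V \<sigma> w A)"
proof -
  have "sat F V \<sigma> w (foldr Conj As Top) \<longleftrightarrow> (\<forall>A\<in>set As. sat F V \<sigma> w A)" for As
    by (induction As) (auto simp: Conj_def Neg_def Top_def)
  then show ?thesis by (simp add: BigConj_def)
qed

lemma sat_BigDisj: "sat F V \<sigma> w (BigDisj M) \<longleftrightarrow> (\<exists>A\<in>#M. sat F V \<sigma> w A)"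
proof -
  have "sat F V \<sigma> w (foldr Disj As Bot) \<longleftrightarrow> (\<exists>A\<in>set As. sat F V \<sigma> w A)" for As
    by (induction As) (auto simp: Disj_def Neg_def)
  then show ?thesis by (simp add: BigDisj_def)
qed

lemma sat_Exists_pred: "sat F V \<sigma> w (Exists_pred x) \<longleftrightarrow> \<sigma> x \<in> dom F w"
  by (auto simp: Exists_pred_def Ex_def Neg_def)

lemma sat_fm_of: "sat F V \<sigma> w (fm_of S) = nseq_sat F V \<sigma> S w"
proof (induction S arbitrary: w)
  case (NS X \<Gamma> \<Delta> N)
  then show ?case
    by (auto simp: Disj_def Conj_def Neg_def sat_BigConj sat_BigDisj sat_Exists_pred)
qed

lemma nseq_sat_rename:
  "nseq_fv S \<union> nseq_bv S \<subseteq> {..<n} \<Longrightarrow>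
    nseq_sat F V \<sigma> (map_nseq_fm (ren n) S) = nseq_sat F V \<sigma> S"
proof (induction S)
  case (NS X \<Gamma> \<Delta> N)
  have "sat F V \<sigma> w (ren n A) = sat F V \<sigma> w A" if "A \<in># \<Gamma> + \<Delta>" for A w
  proof -
    have "fv A \<union> bv A \<subseteq> {..<n}" using NS.prems that by fastforce
    then show ?thesis using ren_props sat_alpha by metis
  qed
  moreover have "image_mset (nseq_sat F V \<sigma>) (image_mset (map_nseq_fm (ren n)) N) = image_mset (nseq_sat F V \<sigma>) N"
    unfolding image_mset.compositionality
  proof (rule image_mset_cong)
    fix T assume "T \<in># N"
    moreover from this have "nseq_fv T \<union> nseq_bv T \<subseteq> {..<n}" using NS.prems by fastforce
    ultimately show "(nseq_sat F V \<sigma> \<circ> map_nseq_fm (ren n)) T = nseq_sat F V \<sigma> T"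
      using NS.IH by simp
  qed
  ultimately show ?case by (simp del: image_mset.compositionality multiset.map_comp cong: ball_cong bex_cong)
qed

section \<open>Labelled trees and contexts\<close>

text \<open>With one fixed \<open>B\<close> for all bound variables, purity splits into conditions
  on single formulas and variables, whereas \<open>pure\<close> itself compares different nodes.
  Each rule step then has to check only what it adds.\<close>

definition fmls_ok :: "var set \<Rightarrow> (nat \<Rightarrow> 'p set) \<Rightarrow> 'p nseq \<Rightarrow> bool" where
  "fmls_ok B Rel S \<longleftrightarrow> nseq_fv S \<inter> B = {} \<and> nseq_bv S \<subseteq> B \<and> nseq_in_lang Rel S"

definition fm_ok :: "var set \<Rightarrow> (nat \<Rightarrow> 'p set) \<Rightarrow> 'p fm \<Rightarrow> bool" where
  "fm_ok B Rel A \<longleftrightarrow> fv A \<inter> B = {} \<and> bv A \<subseteq> B \<and> in_lang Rel A"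

lemma fmls_ok_NS [simp]:
  "fmls_ok B Rel (NS X \<Gamma> \<Delta> N) \<longleftrightarrow> set_mset X \<inter> B = {} \<and>
     (\<forall>A\<in>set_mset \<Gamma> \<union> set_mset \<Delta>. fm_ok B Rel A) \<and> (\<forall>T\<in>#N. fmls_ok B Rel T)"
  unfolding fmls_ok_def fm_ok_def nseq_fv.simps nseq_bv.simps nseq_in_lang.simps
    Int_Un_distrib2 Int_UN_distrib2 Un_subset_iff UN_subset_iff Un_empty
  by (simp add: ball_Un ball_conj_distrib Int_UN_distrib2 UN_subset_iff) blast

lemma fmls_ok_plus [simp]: "fmls_ok B Rel (S + T) \<longleftrightarrow> fmls_ok B Rel S \<and> fmls_ok B Rel T"
  by (cases S; cases T) (simp add: ball_Un Int_Un_distrib2; blast)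

text \<open>Nodes are addressed by their path of child indices; the first argument is fuel.\<close>

primrec tree :: "nat \<Rightarrow> (nat list \<Rightarrow> nat set) \<Rightarrow> (nat list \<Rightarrow> 'p nseq) \<Rightarrow> 'p nseq" where
  "tree 0 c N = N []"
| "tree (Suc m) c N = N [] + NS {#} {#} {#}
     (image_mset (\<lambda>i. tree m (\<lambda>a. c (i # a)) (\<lambda>a. N (i # a))) (mset_set (c [])))"

definition addr :: "(nat list \<Rightarrow> nat set) \<Rightarrow> nat list \<Rightarrow> bool" where
  "addr c a \<longleftrightarrow> (\<forall>p i q. a = p @ i # q \<longrightarrow> i \<in> c p)"

definition bounded :: "nat \<Rightarrow> (nat list \<Rightarrow> nat set) \<Rightarrow> bool" where
  "bounded m c \<longleftrightarrow> (\<forall>a. finite (c a)) \<and> (\<forall>a. m \<le> length a \<longrightarrow> c a = {})"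

lemma addr_Nil [simp]: "addr c []" by (simp add: addr_def)

lemma addr_Cons: "addr c (i # a) \<longleftrightarrow> i \<in> c [] \<and> addr (\<lambda>b. c (i # b)) a"
  unfolding addr_def by (auto simp: Cons_eq_append_conv)

lemma addr_snoc: "addr c (a @ [i]) \<longleftrightarrow> i \<in> c a \<and> addr c a"
proof (induction a arbitrary: c)
  case (Cons j a)
  then show ?case by (simp add: addr_Cons conj_ac)
qed (simp add: addr_Cons)

lemma addr_append: "addr c (a @ b) \<Longrightarrow> addr c a"
  unfolding addr_def by (metis append.assoc append_Cons)

lemma addr_mono: "(\<And>a. addr c a \<Longrightarrow> c a \<subseteq> c' a) \<Longrightarrow> addr c a \<Longrightarrow> addr c' a"
proof (induction a rule: rev_induct)
  case (snoc i a)
  then show ?case by (auto simp: addr_snoc)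
qed simp

lemma bounded_shift: "bounded (Suc m) c \<Longrightarrow> bounded m (\<lambda>a. c (i # a))"
  by (auto simp: bounded_def)

lemma bounded_Suc: "bounded m c \<Longrightarrow> bounded (Suc m) c"
  by (auto simp: bounded_def)

lemma bounded_finite: "bounded m c \<Longrightarrow> finite (c a)" by (simp add: bounded_def)

lemma addr_length: "bounded m c \<Longrightarrow> addr c a \<Longrightarrow> length a \<le> m"
proof (cases a rule: rev_cases)
  case (snoc b i)
  assume "bounded m c" "addr c a"
  with snoc have "c b \<noteq> {}" by (auto simp: addr_snoc)
  then show ?thesis using \<open>bounded m c\<close> snoc by (fastforce simp: bounded_def not_le)
qed simp

lemma plus_zero_nseq [simp]: "S + NS {#} {#} {#} {#} = S"
  by (cases S) simp

lemma tree_Suc: "bounded m c \<Longrightarrow> tree (Suc m) c N = tree m c N"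
proof (induction m arbitrary: c N)
  case 0
  then show ?case by (simp add: bounded_def)
next
  case (Suc m)
  have "tree (Suc m) (\<lambda>a. c (i # a)) (\<lambda>a. N (i # a)) = tree m (\<lambda>a. c (i # a)) (\<lambda>a. N (i # a))" for i
    by (rule Suc.IH) (rule bounded_shift[OF Suc.prems])
  then show ?case by (simp only: tree.simps(2))
qed

text \<open>Fuel beyond the depth of the tree is never spent, so finitely many subtrees can share
  one value.\<close>

lemma tree_mono_fuel: "m \<le> m' \<Longrightarrow> bounded m c \<Longrightarrow> tree m' c N = tree m c N \<and> bounded m' c"
proof (induction m' rule: dec_induct)
  case (step k)
  then show ?case by (simp add: tree_Suc bounded_Suc del: tree.simps)
qed simp

lemma tree_cong:
  "(\<And>a. addr c a \<Longrightarrow> c a = c' a) \<Longrightarrow> (\<And>a. addr c a \<Longrightarrow> N a = N' a) \<Longrightarrow> bounded m c \<Longrightarrow>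
    tree m c N = tree m c' N'"
proof (induction m arbitrary: c c' N N')
  case (Suc m)
  have "c [] = c' []" "N [] = N' []" using Suc.prems by auto
  moreover have "tree m (\<lambda>a. c (i # a)) (\<lambda>a. N (i # a)) = tree m (\<lambda>a. c' (i # a)) (\<lambda>a. N' (i # a))"
    if "i \<in># mset_set (c [])" for i
  proof (rule Suc.IH)
    have i: "i \<in> c []" using that bounded_finite[OF Suc.prems(3)] by simp
    show "c (i # a) = c' (i # a)" if "addr (\<lambda>a. c (i # a)) a" for a
      using Suc.prems(1) that i by (simp add: addr_Cons)
    show "N (i # a) = N' (i # a)" if "addr (\<lambda>a. c (i # a)) a" for a
      using Suc.prems(2) that i by (simp add: addr_Cons)
    show "bounded m (\<lambda>a. c (i # a))" using Suc.prems(3) by (rule bounded_shift)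
  qed
  then have "image_mset (\<lambda>i. tree m (\<lambda>a. c (i # a)) (\<lambda>a. N (i # a))) (mset_set (c []))
      = image_mset (\<lambda>i. tree m (\<lambda>a. c' (i # a)) (\<lambda>a. N' (i # a))) (mset_set (c []))"
    by (rule image_mset_cong)
  ultimately show ?case by simp
qed simp

lemma fmls_ok_tree: "bounded m c \<Longrightarrow> fmls_ok B Rel (tree m c N) \<longleftrightarrow> (\<forall>a. addr c a \<longrightarrow> fmls_ok B Rel (N a))"
proof (induction m arbitrary: c N)
  case 0
  then have "addr c a \<longleftrightarrow> a = []" for a using addr_length by fastforce
  then show ?case by simp
next
  case (Suc m)
  have "fmls_ok B Rel (tree (Suc m) c N) \<longleftrightarrow>
      fmls_ok B Rel (N []) \<and> (\<forall>i\<in>c []. fmls_ok B Rel (tree m (\<lambda>a. c (i # a)) (\<lambda>a. N (i # a))))"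
    using bounded_finite[OF Suc.prems] by simp
  also have "\<dots> \<longleftrightarrow> fmls_ok B Rel (N []) \<and> (\<forall>i\<in>c []. \<forall>a. addr (\<lambda>a. c (i # a)) a \<longrightarrow> fmls_ok B Rel (N (i # a)))"
    using Suc.IH[OF bounded_shift[OF Suc.prems]] by simp
  also have "\<dots> \<longleftrightarrow> (\<forall>a. addr c a \<longrightarrow> fmls_ok B Rel (N a))"
    by (metis addr_Cons addr_Nil list.exhaust)
  finally show ?case .
qed

text \<open>Rules that display a bracketed component need this child as an explicit element of its
  parent and not as an address. So the subtree at \<open>a @ [i]\<close> is cut off from the
  addresses and stored in the label at \<open>a\<close>; \<open>m - length a - 1\<close> is the fuel
  left one level below \<open>a\<close>.\<close>

lemma tree_fold:
  assumes "bounded m c" "addr c (a @ [i])"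
  shows "tree m c N = tree m (c(a := c a - {i}))
     (N(a := N a + NS {#} {#} {#} {#tree (m - length a - 1) (\<lambda>b. c (a @ i # b)) (\<lambda>b. N (a @ i # b))#}))"
  using assms
proof (induction a arbitrary: m c N)
  case Nil
  then obtain m' where m: "m = Suc m'" by (cases m) (auto simp: bounded_def addr_Cons)
  have "mset_set (c []) = add_mset i (mset_set (c [] - {i}))"
    using Nil bounded_finite[OF Nil(1)] by (simp add: addr_Cons mset_set.remove)
  then have "NS {#} {#} {#} (image_mset (\<lambda>i. tree m' (\<lambda>a. c (i # a)) (\<lambda>a. N (i # a))) (mset_set (c [])))
    = NS {#} {#} {#} {#tree m' (\<lambda>a. c (i # a)) (\<lambda>a. N (i # a))#} +
      NS {#} {#} {#} (image_mset (\<lambda>i. tree m' (\<lambda>a. c (i # a)) (\<lambda>a. N (i # a))) (mset_set (c [] - {i})))"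
    by simp
  then show ?case by (simp add: m add.assoc del: plus_nseq.simps)
next
  case (Cons j a)
  then obtain m' where m: "m = Suc m'" by (cases m) (auto simp: bounded_def addr_Cons)
  let ?c = "c(j # a := c (j # a) - {i})"
  let ?N = "N(j # a := N (j # a) + NS {#} {#} {#}
    {#tree (m - length (j # a) - 1) (\<lambda>b. c ((j # a) @ i # b)) (\<lambda>b. N ((j # a) @ i # b))#})"
  have "tree m' (\<lambda>b. c (k # b)) (\<lambda>b. N (k # b)) = tree m' (\<lambda>b. ?c (k # b)) (\<lambda>b. ?N (k # b))" for k
  proof (cases "k = j")
    case True
    have "bounded m' (\<lambda>b. c (j # b))" "addr (\<lambda>b. c (j # b)) (a @ [i])"
      using Cons.prems m by (auto simp: addr_Cons bounded_shift)
    note IH = Cons.IH[OF this, of "\<lambda>b. N (j # b)"]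
    have c: "(\<lambda>b. ?c (j # b)) = (\<lambda>b. c (j # b))(a := c (j # a) - {i})" by auto
    have N: "(\<lambda>b. ?N (j # b)) = (\<lambda>b. N (j # b))(a := N (j # a) + NS {#} {#} {#}
        {#tree (m' - length a - 1) (\<lambda>b. c (j # a @ i # b)) (\<lambda>b. N (j # a @ i # b))#})"
      using m by auto
    show ?thesis unfolding True c N by (rule IH)
  next
    case False
    then show ?thesis by simp
  qed
  then show ?case unfolding m by simp
qed

section \<open>Contexts with holes at prescribed addresses\<close>

primrec ctx_of :: "'p nseq \<Rightarrow> 'p ctx" where
  "ctx_of (NS X \<Gamma> \<Delta> N) = Ctx X \<Gamma> \<Delta> {#} (image_mset ctx_of N)"

lemma holes_ctx_of [simp]: "holes (ctx_of S) = {#}"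
  by (induction S) (auto simp: sum_mset.neutral)

lemma fill_ctx_of [simp]: "fill f (ctx_of S) = S"
proof (induction S)
  case (NS X \<Gamma> \<Delta> N)
  then have "image_mset (fill f) (image_mset ctx_of N) = N"
    by (simp add: image_mset.compositionality o_def cong: image_mset_cong)
  then show ?case by simp
qed

definition node_ctx :: "'p nseq \<Rightarrow> nat multiset \<Rightarrow> 'p ctx multiset \<Rightarrow> 'p ctx" where
  "node_ctx S H M = (case S of NS X \<Gamma> \<Delta> N \<Rightarrow> Ctx X \<Gamma> \<Delta> H (image_mset ctx_of N + M))"

lemma holes_node_ctx [simp]: "holes (node_ctx S H M) = H + sum_mset (image_mset holes M)"
  by (cases S) (simp add: node_ctx_def image_mset.compositionality o_def sum_mset.neutral)

lemma fill_node_ctx [simp]: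
  "fill f (node_ctx S H M) = S + sum_mset (image_mset f H) + NS {#} {#} {#} (image_mset (fill f) M)"
proof (cases S)
  case (NS X \<Gamma> \<Delta> N)
  have "image_mset (fill f) (image_mset ctx_of N) = N"
    by (simp add: image_mset.compositionality o_def)
  then have "fill f (node_ctx S H M) =
      NS X \<Gamma> \<Delta> N + NS {#} {#} {#} (image_mset (fill f) M) + sum_mset (image_mset f H)"
    by (simp add: NS node_ctx_def)
  then show ?thesis by (simp add: NS ac_simps del: plus_nseq.simps)
qed

lemma hole_depth_node_ctx:
  "h \<in># H \<Longrightarrow> hole_depth (node_ctx S H M) h 0"
  "C \<in># M \<Longrightarrow> hole_depth C h d \<Longrightarrow> hole_depth (node_ctx S H M) h (Suc d)"
  by (cases S; auto simp: node_ctx_def intro: hole_depth.intros)+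

lemma tree_remove:
  assumes "finite (c [])" "i \<in> c []"
  shows "tree (Suc m) c N = N [] + NS {#} {#} {#}
     (add_mset (tree m (\<lambda>b. c (i # b)) (\<lambda>b. N (i # b)))
       (image_mset (\<lambda>k. tree m (\<lambda>b. c (k # b)) (\<lambda>b. N (k # b))) (mset_set (c [] - {i}))))"
  using assms by (simp add: mset_set.remove)

lemma shift_upd:
  "(\<lambda>b. (N(i # a := v)) (i # b)) = (\<lambda>b. N (i # b))(a := v)"
  "k \<noteq> i \<Longrightarrow> (\<lambda>b. (N(i # a := v)) (k # b)) = (\<lambda>b. N (k # b))"
  "(\<lambda>b. (N([] := v)) (k # b)) = (\<lambda>b. N (k # b))"
  by auto

abbreviation child_ctxs where
  "child_ctxs m c N I \<equiv> image_mset (\<lambda>k. ctx_of (tree m (\<lambda>b. c (k # b)) (\<lambda>b. N (k # b)))) (mset_set I)"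

lemma fill_child_ctxs:
  "image_mset (fill f) (child_ctxs m c N I) =
   image_mset (\<lambda>k. tree m (\<lambda>b. c (k # b)) (\<lambda>b. N (k # b))) (mset_set I)"
  by (simp add: image_mset.compositionality o_def)

lemma holes_child_ctxs: "sum_mset (image_mset holes (child_ctxs m c N I)) = {#}"
  by (simp add: image_mset.compositionality o_def sum_mset.neutral)

lemma image_tree_upd:
  assumes "\<And>k. k \<in> I \<Longrightarrow> (\<lambda>b. N (k # b)) = (\<lambda>b. N' (k # b))" "finite I"
  shows "image_mset (\<lambda>k. tree m (\<lambda>b. c (k # b)) (\<lambda>b. N (k # b))) (mset_set I) =
    image_mset (\<lambda>k. tree m (\<lambda>b. c (k # b)) (\<lambda>b. N' (k # b))) (mset_set I)"
  by (rule image_mset_cong) (use assms in simp)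

text \<open>The filling replaces the whole label at \<open>a\<close>, so the node carrying the hole
  starts out empty while all other labels are copied from \<open>N\<close>. The name
  \<open>h\<close> is arbitrary since contexts with different names are combined in
  \<open>two_holes\<close>.\<close>

lemma one_hole:
  assumes "bounded m c" "addr c a"
  shows "\<exists>C. holes C = {#h#} \<and> hole_depth C h (length a) \<and> (\<forall>f. fill f C = tree m c (N(a := f h)))"
  using assms
proof (induction a arbitrary: m c N)
  case Nil
  show ?case
  proof (cases m)
    case 0
    then show ?thesis
      by (intro exI[of _ "node_ctx (NS {#} {#} {#} {#}) {#h#} {#}"])
        (auto intro: hole_depth_node_ctx simp: add.commute[of "NS _ _ _ _"] simp del: plus_nseq.simps)
  next
    case (Suc m')
    let ?C = "node_ctx (NS {#} {#} {#} {#}) {#h#} (child_ctxs m' c N (c []))"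
    have "fill f ?C = tree m c (N([] := f h))" for f
      unfolding fill_node_ctx fill_child_ctxs
      by (simp add: Suc add.commute[of "NS {#} {#} {#} {#}"] del: plus_nseq.simps)
    moreover have "holes ?C = {#h#}" unfolding holes_node_ctx holes_child_ctxs by simp
    moreover have "hole_depth ?C h (length [])" by (simp add: hole_depth_node_ctx)
    ultimately show ?thesis by blast
  qed
next
  case (Cons i a)
  then obtain m' where m: "m = Suc m'" by (cases m) (auto simp: bounded_def addr_Cons)
  have i: "i \<in> c []" "finite (c [])" using Cons.prems by (auto simp: addr_Cons bounded_def)
  have "bounded m' (\<lambda>b. c (i # b))" "addr (\<lambda>b. c (i # b)) a"
    using Cons.prems m by (auto simp: addr_Cons bounded_shift)
  from Cons.IH[OF this, of "\<lambda>b. N (i # b)"] obtain C where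
    C: "holes C = {#h#}" "hole_depth C h (length a)"
      "fill f C = tree m' (\<lambda>b. c (i # b)) ((\<lambda>b. N (i # b))(a := f h))" for f by blast
  let ?C = "node_ctx (N []) {#} (add_mset C (child_ctxs m' c N (c [] - {i})))"
  have "fill f ?C = tree m c (N(i # a := f h))" for f
    unfolding m tree_remove[where c=c and i=i, OF i(2,1)] shift_upd fill_node_ctx image_mset_add_mset fill_child_ctxs C(3)
    using image_tree_upd[of "c [] - {i}" N "N(i # a := f h)"] i by simp
  moreover have "holes ?C = {#h#}"
    unfolding holes_node_ctx image_mset_add_mset sum_mset.add_mset holes_child_ctxs C by simp
  moreover have "hole_depth ?C h (length (i # a))" by (auto intro: hole_depth_node_ctx C)
  ultimately show ?case by blast
qed

lemma two_holes_root:
  assumes "bounded m c" "addr c (i # a)"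
  shows "\<exists>C. holes C = {#h, k#} \<and> hole_depth C h 0 \<and> hole_depth C k (length (i # a)) \<and>
    (\<forall>f. fill f C = tree m c (N([] := f h, i # a := f k)))"
proof -
  obtain m' where m: "m = Suc m'" using assms by (cases m) (auto simp: bounded_def addr_Cons)
  have i: "i \<in> c []" "finite (c [])" using assms by (auto simp: addr_Cons bounded_def)
  have "bounded m' (\<lambda>b. c (i # b))" "addr (\<lambda>b. c (i # b)) a"
    using assms m by (auto simp: addr_Cons bounded_shift)
  from one_hole[OF this, of k "\<lambda>b. N (i # b)"] obtain C where
    C: "holes C = {#k#}" "hole_depth C k (length a)"
      "fill f C = tree m' (\<lambda>b. c (i # b)) ((\<lambda>b. N (i # b))(a := f k))" for f by blast
  let ?C = "node_ctx (NS {#} {#} {#} {#}) {#h#} (add_mset C (child_ctxs m' c N (c [] - {i})))"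
  have "fill f ?C = tree m c (N([] := f h, i # a := f k))" for f
    unfolding m tree_remove[where c=c and i=i, OF i(2,1)] shift_upd fill_node_ctx image_mset_add_mset fill_child_ctxs C(3)
    using image_tree_upd[of "c [] - {i}" N "N([] := f h, i # a := f k)"] i
    by (simp add: add.commute[of "NS {#} {#} {#} {#}"] del: plus_nseq.simps)
  moreover have "holes ?C = {#h, k#}"
    unfolding holes_node_ctx image_mset_add_mset sum_mset.add_mset holes_child_ctxs C by simp
  moreover have "hole_depth ?C k (length (i # a))" "hole_depth ?C h 0"
    by (auto intro: hole_depth_node_ctx C)
  ultimately show ?thesis by blast
qed

text \<open>The induction follows the common prefix of the two paths. Where they diverge, two
  one-hole contexts hang below the same node; where one path ends, its hole sits at that node and
  \<open>two_holes_root\<close> applies.\<close>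

lemma two_holes:
  assumes "bounded m c" "addr c a" "addr c b" "a \<noteq> b"
  shows "\<exists>C. holes C = {#h, k#} \<and> hole_depth C h (length a) \<and> hole_depth C k (length b) \<and>
    (\<forall>f. fill f C = tree m c (N(a := f h, b := f k)))"
  using assms
proof (induction a arbitrary: m c N b)
  case Nil
  then obtain j b' where b: "b = j # b'" by (cases b) auto
  show ?case
    using two_holes_root[of m c j b' h k N] Nil.prems unfolding b list.size(3) by blast
next
  case (Cons i a)
  show ?case
  proof (cases b)
    case Nil
    have "N([] := f k, i # a := f h) = N(i # a := f h, [] := f k)" for f
      by (rule fun_upd_twist) simp
    then show ?thesis
      using two_holes_root[of m c i a k h N] Cons.prems
      unfolding Nil list.size(3) add_mset_commute[of h k] by (simp del: fun_upd_apply) blast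
  next
    case b: (Cons j b')
    obtain m' where m: "m = Suc m'" using Cons.prems by (cases m) (auto simp: bounded_def addr_Cons)
    have i: "i \<in> c []" "j \<in> c []" "finite (c [])"
      using Cons.prems b by (auto simp: addr_Cons bounded_def)
    have bd: "bounded m' (\<lambda>b. c (l # b))" for l using Cons.prems m by (auto simp: bounded_shift)
    have ad: "addr (\<lambda>b. c (i # b)) a" "addr (\<lambda>b. c (j # b)) b'"
      using Cons.prems b by (auto simp: addr_Cons)
    show ?thesis
    proof (cases "i = j")
      case True
      with Cons.IH[OF bd ad(1), of b' "\<lambda>b. N (i # b)"] ad Cons.prems b obtain C where
        C: "holes C = {#h, k#}" "hole_depth C h (length a)" "hole_depth C k (length b')"
          "fill f C = tree m' (\<lambda>b. c (i # b)) ((\<lambda>b. N (i # b))(a := f h, b' := f k))" for f by blast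
      let ?C = "node_ctx (N []) {#} (add_mset C (child_ctxs m' c N (c [] - {i})))"
      have "fill f ?C = tree m c (N(i # a := f h, i # b' := f k))" for f
        unfolding m tree_remove[where c=c and i=i, OF i(3,1)] shift_upd fill_node_ctx image_mset_add_mset fill_child_ctxs C(4)
        using image_tree_upd[of "c [] - {i}" N "N(i # a := f h, i # b' := f k)"] i by simp
      moreover have "holes ?C = {#h, k#}"
        unfolding holes_node_ctx image_mset_add_mset sum_mset.add_mset holes_child_ctxs C by simp
      moreover have "hole_depth ?C h (length (i # a))" "hole_depth ?C k (length (i # b'))"
        by (auto intro: hole_depth_node_ctx C)
      ultimately show ?thesis using b True by blast
    next
      case False
      from one_hole[OF bd ad(1), of h "\<lambda>b. N (i # b)"] obtain C where
        C: "holes C = {#h#}" "hole_depth C h (length a)"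
          "fill f C = tree m' (\<lambda>b. c (i # b)) ((\<lambda>b. N (i # b))(a := f h))" for f by blast
      from one_hole[OF bd ad(2), of k "\<lambda>b. N (j # b)"] obtain D where
        D: "holes D = {#k#}" "hole_depth D k (length b')"
          "fill f D = tree m' (\<lambda>b. c (j # b)) ((\<lambda>b. N (j # b))(b' := f k))" for f by blast
      let ?C = "node_ctx (N []) {#} (add_mset C (add_mset D (child_ctxs m' c N (c [] - {i} - {j}))))"
      have ij: "mset_set (c [] - {i}) = add_mset j (mset_set (c [] - {i} - {j}))"
        using i False by (intro mset_set.remove) auto
      have "fill f ?C = tree m c (N(i # a := f h, j # b' := f k))" for f
      proof -
        have "(\<lambda>b. (N(i # a := f h, j # b' := f k)) (i # b)) = (\<lambda>b. N (i # b))(a := f h)"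
          "(\<lambda>b. (N(i # a := f h, j # b' := f k)) (j # b)) = (\<lambda>b. N (j # b))(b' := f k)"
          using False by auto
        then show ?thesis
          unfolding m tree_remove[where c=c and i=i, OF i(3,1)] fill_node_ctx image_mset_add_mset fill_child_ctxs C(3) D(3) ij
          using image_tree_upd[of "c [] - {i} - {j}" N "N(i # a := f h, j # b' := f k)"] i by simp
      qed
      moreover have "holes ?C = {#h, k#}"
        unfolding holes_node_ctx image_mset_add_mset sum_mset.add_mset holes_child_ctxs C D by simp
      moreover have "hole_depth ?C h (length (i # a))" "hole_depth ?C k (length (j # b'))"
        by (auto intro: hole_depth_node_ctx C D)
      ultimately show ?thesis using b by blast
    qed
  qed
qed

lemma plug1_tree:
  assumes "bounded m c" "addr c a"
  obtains C where "is_ctx 1 C" "\<And>T. plug1 C T = tree m c (N(a := T))"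
  using one_hole[OF assms, of 0 N] by (auto simp: is_ctx_def plug1_def)

lemma plug2_tree:
  assumes "bounded m c" "addr c a" "addr c b" "a \<noteq> b"
  obtains C where "is_ctx 2 C" "hole_depth C 0 (length a)" "hole_depth C 1 (length b)"
    "\<And>S T. plug2 C S T = tree m c (N(a := S, b := T))"
  using two_holes[OF assms, of 0 1 N] by (auto simp: is_ctx_def plug2_def numeral_2_eq_2 add_mset_commute)

lemma tree_exists:
  "\<exists>m c N. bounded m c \<and> (\<forall>a. \<exists>X \<Gamma> \<Delta>. N a = seq X \<Gamma> \<Delta>) \<and> tree m c N = S"
proof (induction S)
  case (NS X \<Gamma> \<Delta> M)
  obtain Ts where M: "M = mset Ts" using ex_mset by metis
  have "\<forall>k<length Ts. \<exists>m c N. bounded m c \<and> (\<forall>a. \<exists>X \<Gamma> \<Delta>. N a = seq X \<Gamma> \<Delta>) \<and> tree m c N = Ts ! k"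
    using NS M by auto
  then obtain m c N where T: "\<And>k. k < length Ts \<Longrightarrow> bounded (m k) (c k) \<and>
      (\<forall>a. \<exists>X \<Gamma> \<Delta>. N k a = seq X \<Gamma> \<Delta>) \<and> tree (m k) (c k) (N k) = Ts ! k"
    by metis
  \<comment> \<open>All subtrees get the largest of their fuels; the extra \<open>0\<close> covers
    the case without children.\<close>
  define m' where "m' = Max (m ` {..<length Ts} \<union> {0})"
  define c' where "c' a = (case a of [] \<Rightarrow> {..<length Ts} | k # b \<Rightarrow> if k < length Ts then c k b else {})" for a
  define N' where "N' a = (case a of [] \<Rightarrow> seq X \<Gamma> \<Delta> | k # b \<Rightarrow> if k < length Ts then N k b else seq {#} {#} {#})" for a
  have m': "bounded m' (c k)" "tree m' (c k) (N k) = Ts ! k" if "k < length Ts" for k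
  proof -
    have "m k \<le> m'" unfolding m'_def using that by (intro Max_ge) auto
    then show "bounded m' (c k)" "tree m' (c k) (N k) = Ts ! k"
      using T[OF that] tree_mono_fuel by metis+
  qed
  have "finite (c' a)" "Suc m' \<le> length a \<longrightarrow> c' a = {}" for a
    using m' by (cases a; auto simp: c'_def bounded_def)+
  then have "bounded (Suc m') c'" by (simp add: bounded_def)
  moreover have "\<exists>X \<Gamma> \<Delta>. N' a = seq X \<Gamma> \<Delta>" for a
    using T by (cases a) (auto simp: N'_def)
  moreover have "image_mset (\<lambda>k. tree m' (\<lambda>b. c' (k # b)) (\<lambda>b. N' (k # b))) (mset_set (c' [])) = M"
  proof -
    have "image_mset (\<lambda>k. tree m' (\<lambda>b. c' (k # b)) (\<lambda>b. N' (k # b))) (mset_set (c' [])) =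
        image_mset (\<lambda>k. Ts ! k) (mset_set {..<length Ts})"
    proof -
      have "tree m' (\<lambda>b. c' (k # b)) (\<lambda>b. N' (k # b)) = Ts ! k" if "k < length Ts" for k
        using that m'(2)[OF that] by (simp add: c'_def N'_def)
      moreover have c': "c' [] = {..<length Ts}" by (simp add: c'_def)
      ultimately show ?thesis unfolding c' by (intro image_mset_cong) simp
    qed
    also have "\<dots> = mset (map ((!) Ts) [0..<length Ts])" by (simp add: lessThan_atLeast0)
    finally show ?thesis by (simp add: map_nth M)
  qed
  then have "tree (Suc m') c' N' = NS X \<Gamma> \<Delta> M" by (simp add: N'_def)
  ultimately show ?case by blast
qed

section \<open>Extending underivable trees\<close>

lemma tree_root: "\<exists>M. \<forall>T. tree m c (N([] := T)) = T + NS {#} {#} {#} M"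
proof (cases m)
  case 0
  then show ?thesis by (intro exI[of _ "{#}"]) simp
next
  case (Suc m')
  then show ?thesis by auto
qed

lemma tree_leaf: "c [] = {} \<Longrightarrow> tree m c N = N []"
  by (cases m) auto

lemma bounded_remove: "bounded m c \<Longrightarrow> bounded m (c(a := c a - I))"
  by (auto simp: bounded_def)

lemma tree_child_fold:
  assumes "bounded m c" "addr c (a @ [i])"
  shows "tree m c (N(a := S, a @ [i] := T)) = tree m (c(a := c a - {i}))
    (N(a := S + NS {#} {#} {#} {#tree (m - length a - 1) (\<lambda>b. c (a @ i # b)) ((\<lambda>b. N (a @ i # b))([] := T))#}))"
proof -
  let ?c = "c(a := c a - {i})" and ?N = "N(a := S, a @ [i] := T)"
  have "(\<lambda>b. ?N (a @ i # b)) = (\<lambda>b. N (a @ i # b))([] := T)" by auto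
  then have "tree m c ?N = tree m ?c (?N(a := S + NS {#} {#} {#}
      {#tree (m - length a - 1) (\<lambda>b. c (a @ i # b)) ((\<lambda>b. N (a @ i # b))([] := T))#}))"
    using tree_fold[OF assms, of ?N] by simp
  also have "\<dots> = tree m ?c (N(a := S + NS {#} {#} {#}
      {#tree (m - length a - 1) (\<lambda>b. c (a @ i # b)) ((\<lambda>b. N (a @ i # b))([] := T))#}))"
    by (rule tree_cong) (use bounded_remove[OF assms(1)] in \<open>auto simp: addr_snoc\<close>)
  finally show ?thesis .
qed

lemma addr_remove: "addr c a \<Longrightarrow> addr (c(a := I)) a"
  unfolding addr_def by auto

text \<open>After folding the child into its parent, one hole at the parent is enough.
  \<open>M\<close> collects the further children of the child; \<open>C\<close> and \<open>M\<close>
  do not depend on the labels \<open>S\<close> and \<open>T\<close>, so one choice serves premiss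
  and conclusion.\<close>

lemma plug1_child:
  assumes "bounded m c" "addr c (a @ [i])"
  obtains C M where "is_ctx 1 C"
    "\<And>S T. tree m c (N(a := S, a @ [i] := T)) = plug1 C (S + NS {#} {#} {#} {#T + NS {#} {#} {#} M#})"
proof -
  have "addr (c(a := c a - {i})) a" using assms(2) by (auto simp: addr_snoc addr_remove)
  then obtain C where C: "is_ctx 1 C" "\<And>T. plug1 C T = tree m (c(a := c a - {i})) (N(a := T))"
    using plug1_tree[OF bounded_remove[where a=a and I="{i}", OF assms(1)], where a=a and N=N] by metis
  obtain M where "\<And>T. tree (m - length a - 1) (\<lambda>b. c (a @ i # b)) ((\<lambda>b. N (a @ i # b))([] := T)) =
      T + NS {#} {#} {#} M" using tree_root by metis
  then show ?thesis using that[OF C(1), of M] unfolding tree_child_fold[OF assms] C(2) by simp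
qed

lemma bounded_new:
  assumes "bounded m c" "addr c a"
  shows "bounded (Suc m) (c(a := insert i (c a), a @ [i] := {}))"
  using assms addr_length[OF assms] by (auto simp: bounded_def)

text \<open>Removing the new index again yields the old tree up to one unit of fuel, so the context
  of the old tree also describes the new one, with the leaf displayed at \<open>a\<close>.\<close>

lemma plug1_new:
  assumes "bounded m c" "addr c a" "i \<notin> c a"
  obtains C where "is_ctx 1 C" "\<And>S. tree m c (N(a := S)) = plug1 C S"
    "\<And>S T. tree (Suc m) (c(a := insert i (c a), a @ [i] := {})) (N(a := S, a @ [i] := T)) =
       plug1 C (S + NS {#} {#} {#} {#T#})"
proof -
  let ?c = "c(a := insert i (c a), a @ [i] := {})"
  have a: "addr ?c (a @ [i])"
  proof -
    have "addr ?c a" using assms(2) unfolding addr_def by auto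
    then show ?thesis by (simp add: addr_snoc)
  qed
  obtain C where C: "is_ctx 1 C" "\<And>T. plug1 C T = tree m c (N(a := T))"
    using plug1_tree[OF assms(1,2), of N] by metis
  have eq: "tree (Suc m) (?c(a := ?c a - {i})) N' = tree m c N'" for N'
  proof -
    have "tree (Suc m) c N' = tree (Suc m) (?c(a := ?c a - {i})) N'"
      by (rule tree_cong) (use assms bounded_Suc in \<open>auto simp: addr_snoc\<close>)
    then show ?thesis using tree_Suc[OF assms(1)] by metis
  qed
  have leaf: "tree (Suc m - length a - 1) (\<lambda>b. ?c (a @ i # b)) ((\<lambda>b. N (a @ i # b))([] := T)) = T" for T
    by (subst tree_leaf) auto
  show ?thesis
    by (rule that[OF C(1)]) (simp_all only: C(2) tree_child_fold[OF bounded_new[OF assms(1,2)] a] leaf eq)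
qed

section \<open>Underivability relative to a pool of eigenvariables\<close>

definition underivable :: "(nat \<Rightarrow> 'p set) \<Rightarrow> axm set \<Rightarrow> var set \<Rightarrow> 'p nseq \<Rightarrow> bool" where
  "underivable Rel L V S \<longleftrightarrow> (\<nexists>E. derivation Rel L E S \<and> distinct E \<and> set E \<subseteq> V)"

lemma underivable_no_premiss:
  assumes "rule L [] [] S" "pure S" "nseq_in_lang Rel S"
  shows "\<not> underivable Rel L V S"
  using derivation.intros[OF assms, of "[]"] by (auto simp: underivable_def intro: exI[of _ "[]"])

lemma underivable_premiss:
  assumes "rule L [] [S'] S" "pure S" "nseq_in_lang Rel S" "underivable Rel L V S"
  shows "underivable Rel L V S'"
  unfolding underivable_def
proof clarify
  fix E assume "derivation Rel L E S'" "distinct E" "set E \<subseteq> V"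
  then show False
    using derivation.intros[OF assms(1-3), of "[E]"] assms(4) by (auto simp: underivable_def)
qed

lemma underivable_eigen:
  assumes "rule L [y] [S'] S" "pure S" "nseq_in_lang Rel S" "underivable Rel L V S" "y \<in> V"
  shows "underivable Rel L (V - {y}) S'"
  unfolding underivable_def
proof clarify
  fix E assume "derivation Rel L E S'" "distinct E" "set E \<subseteq> V - {y}"
  then show False
    using derivation.intros[OF assms(1-3), of "[E]"] assms(4,5)
    unfolding underivable_def by (auto dest!: spec[of _ "y # E"])
qed

lemma infinite_split:
  assumes "infinite (V :: nat set)"
  obtains V1 V2 where "infinite V1" "infinite V2" "V1 \<union> V2 \<subseteq> V" "V1 \<inter> V2 = {}"
proof -
  let ?e = "enumerate V"
  have inj: "inj ?e" using strict_mono_enumerate[OF assms] by (rule strict_mono_imp_inj_on)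
  have "infinite (range ((*) (2 :: nat)))" "infinite (range (\<lambda>n :: nat. 2 * n + 1))"
    by (intro range_inj_infinite injI; simp)+
  then have "infinite (?e ` range ((*) 2))" "infinite (?e ` range (\<lambda>n. 2 * n + 1))"
    using inj by (auto simp: finite_image_iff inj_on_subset)
  moreover have "?e ` range ((*) 2) \<union> ?e ` range (\<lambda>n. 2 * n + 1) \<subseteq> V"
    using enumerate_in_set[OF assms] by auto
  moreover have "range ((*) (2 :: nat)) \<inter> range (\<lambda>n. 2 * n + 1) = {}"
    by (auto, presburger)
  then have "?e ` range ((*) 2) \<inter> ?e ` range (\<lambda>n. 2 * n + 1) = {}"
    using inj by (metis image_Int image_empty)
  ultimately show ?thesis using that by blast
qed

text \<open>If both premisses had derivations with eigenvariables from disjoint parts of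
  \<open>V\<close>, the concatenated list would still be distinct, and the conclusion would be
  derivable. Which part is kept depends on the premiss that fails.\<close>

lemma underivable_split:
  assumes "rule L [] [S1, S2] S" "pure S" "nseq_in_lang Rel S" "underivable Rel L V S" "infinite V"
  obtains V' where "infinite V'" "V' \<subseteq> V" "underivable Rel L V' S1 \<or> underivable Rel L V' S2"
proof -
  obtain V1 V2 where V: "infinite V1" "infinite V2" "V1 \<union> V2 \<subseteq> V" "V1 \<inter> V2 = {}"
    using infinite_split[OF assms(5)] by blast
  have "underivable Rel L V1 S1 \<or> underivable Rel L V2 S2"
  proof (rule ccontr)
    assume "\<not> ?thesis"
    then obtain E1 E2 where E: "derivation Rel L E1 S1" "distinct E1" "set E1 \<subseteq> V1"
        "derivation Rel L E2 S2" "distinct E2" "set E2 \<subseteq> V2"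
      by (auto simp: underivable_def)
    then have "derivation Rel L (E1 @ E2) S"
      using derivation.intros[OF assms(1-3), of "[E1, E2]"] by simp
    moreover have "distinct (E1 @ E2)" "set (E1 @ E2) \<subseteq> V" using E V by auto
    ultimately show False using assms(4) unfolding underivable_def by blast
  qed
  then show ?thesis using that V by blast
qed

text \<open>\<open>vars\<close> holds the variables that are still available as eigenvariables.\<close>

record 'p state =
  depth :: nat
  kids :: "nat list \<Rightarrow> nat set"
  sig :: "nat list \<Rightarrow> var multiset"
  ante :: "nat list \<Rightarrow> 'p fm multiset"
  succ :: "nat list \<Rightarrow> 'p fm multiset"
  vars :: "var set"

definition node :: "'p state \<Rightarrow> nat list \<Rightarrow> 'p nseq" where
  "node s a = seq (sig s a) (ante s a) (succ s a)"

definition nseq_of :: "'p state \<Rightarrow> 'p nseq" where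
  "nseq_of s = tree (depth s) (kids s) (node s)"

definition upd :: "nat list \<Rightarrow> var multiset \<Rightarrow> 'p fm multiset \<Rightarrow> 'p fm multiset \<Rightarrow> 'p state \<Rightarrow> 'p state" where
  "upd a X \<Gamma> \<Delta> s = s\<lparr>sig := (sig s)(a := X), ante := (ante s)(a := \<Gamma>), succ := (succ s)(a := \<Delta>)\<rparr>"

text \<open>The entries at \<open>a @ [i]\<close> are overwritten because the label functions are
  total and may hold arbitrary values at addresses outside the tree.\<close>

definition new :: "nat list \<Rightarrow> nat \<Rightarrow> 'p fm multiset \<Rightarrow> 'p state \<Rightarrow> 'p state" where
  "new a i \<Delta> s = s\<lparr>depth := Suc (depth s), kids := (kids s)(a := insert i (kids s a), a @ [i] := {}),
     sig := (sig s)(a @ [i] := {#}), ante := (ante s)(a @ [i] := {#}), succ := (succ s)(a @ [i] := \<Delta>)\<rparr>"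

definition addX :: "nat list \<Rightarrow> var \<Rightarrow> 'p state \<Rightarrow> 'p state" where
  "addX a x s = upd a (add_mset x (sig s a)) (ante s a) (succ s a) s"

definition addL :: "nat list \<Rightarrow> 'p fm \<Rightarrow> 'p state \<Rightarrow> 'p state" where
  "addL a A s = upd a (sig s a) (add_mset A (ante s a)) (succ s a) s"

lemma upd_sel [simp]:
  "depth (upd a X \<Gamma> \<Delta> s) = depth s" "kids (upd a X \<Gamma> \<Delta> s) = kids s" "vars (upd a X \<Gamma> \<Delta> s) = vars s"
  "sig (upd a X \<Gamma> \<Delta> s) = (sig s)(a := X)" "ante (upd a X \<Gamma> \<Delta> s) = (ante s)(a := \<Gamma>)"
  "succ (upd a X \<Gamma> \<Delta> s) = (succ s)(a := \<Delta>)"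
  by (simp_all add: upd_def)

lemma new_sel [simp]:
  "depth (new a i \<Delta> s) = Suc (depth s)" "vars (new a i \<Delta> s) = vars s"
  "kids (new a i \<Delta> s) = (kids s)(a := insert i (kids s a), a @ [i] := {})"
  "sig (new a i \<Delta> s) = (sig s)(a @ [i] := {#})" "ante (new a i \<Delta> s) = (ante s)(a @ [i] := {#})"
  "succ (new a i \<Delta> s) = (succ s)(a @ [i] := \<Delta>)"
  by (simp_all add: new_def)

lemma upd_same: "sig s a = X \<Longrightarrow> ante s a = \<Gamma> \<Longrightarrow> succ s a = \<Delta> \<Longrightarrow> upd a X \<Gamma> \<Delta> s = s"
  by (auto simp: upd_def)

lemma node_upd: "node (upd a X \<Gamma> \<Delta> s) = (node s)(a := seq X \<Gamma> \<Delta>)"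
  by (auto simp: node_def)

lemma node_new: "node (new a i \<Delta> s) = (node s)(a @ [i] := seq {#} {#} \<Delta>)"
  by (auto simp: node_def)

text \<open>A task names an item and not a rule: \<open>TX\<close> and \<open>TL\<close> insert a
  variable or an antecedent formula, whichever rule allows it, \<open>TC\<close> provides a child,
  and \<open>TRedL\<close>, \<open>TRedR\<close> reduce a formula that its rule consumes.\<close>

datatype 'p task = TX "nat list" var | TL "nat list" "'p fm" | TC "nat list"
  | TRedL "nat list" "'p fm" | TRedR "nat list" "'p fm"

declare One_nat_def [simp del]

section \<open>Underivable states\<close>

locale calculus =
  fixes Rel :: "nat \<Rightarrow> 'p set" and L :: "axm set" and B :: "var set"
begin

definition wf_state :: "'p state \<Rightarrow> bool" where
  "wf_state s \<longleftrightarrow> bounded (depth s) (kids s) \<and> infinite (vars s) \<and> vars s \<inter> B = {} \<and> fmls_ok B Rel (nseq_of s)"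

definition good :: "'p state \<Rightarrow> bool" where
  "good s \<longleftrightarrow> wf_state s \<and> underivable Rel L (vars s) (nseq_of s)"

lemma fmls_ok_pure: "fmls_ok B Rel S \<Longrightarrow> pure S \<and> nseq_in_lang Rel S"
  unfolding fmls_ok_def pure_def by blast

lemma wf_node: "wf_state s \<Longrightarrow> addr (kids s) a \<Longrightarrow> fmls_ok B Rel (node s a)"
  by (auto simp: wf_state_def nseq_of_def fmls_ok_tree)

lemma wf_sig: "wf_state s \<Longrightarrow> addr (kids s) a \<Longrightarrow> x \<in># sig s a \<Longrightarrow> x \<notin> B"
  using wf_node[of s a] by (auto simp: node_def)

lemma wf_ante: "wf_state s \<Longrightarrow> addr (kids s) a \<Longrightarrow> A \<in># ante s a \<Longrightarrow> fm_ok B Rel A"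
  using wf_node[of s a] by (auto simp: node_def)

lemma wf_succ: "wf_state s \<Longrightarrow> addr (kids s) a \<Longrightarrow> A \<in># succ s a \<Longrightarrow> fm_ok B Rel A"
  using wf_node[of s a] by (auto simp: node_def)

lemma wf_upd:
  assumes "wf_state s" "addr (kids s) a" "fmls_ok B Rel (seq X \<Gamma> \<Delta>)"
  shows "wf_state (upd a X \<Gamma> \<Delta> s)"
  using assms by (auto simp: wf_state_def nseq_of_def fmls_ok_tree node_upd)

lemma wf_new:
  assumes "wf_state s" "addr (kids s) a" "\<forall>A\<in>#\<Delta>. fm_ok B Rel A"
  shows "wf_state (new a i \<Delta> s)"
proof -
  let ?c = "(kids s)(a := insert i (kids s a), a @ [i] := {})"
  have bd: "bounded (Suc (depth s)) ?c" using assms by (auto simp: wf_state_def bounded_new)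
  \<comment> \<open>Since the new node is a leaf, every other address of the enlarged tree was an
    address before.\<close>
  have "addr (kids s) b" if "addr ?c b" "b \<noteq> a @ [i]" for b
    using that
  proof (induction b rule: rev_induct)
    case (snoc j b)
    then have "j \<in> ?c b" "addr ?c b" by (auto simp: addr_snoc simp del: fun_upd_apply)
    moreover from this have "b \<noteq> a @ [i]" by auto
    ultimately have "addr (kids s) b" using snoc.IH by blast
    moreover have "j \<in> kids s b" using \<open>j \<in> ?c b\<close> snoc.prems(2) by (auto split: if_splits)
    ultimately show ?case by (simp add: addr_snoc)
  qed simp
  then have "\<forall>b. addr ?c b \<longrightarrow> fmls_ok B Rel (((node s)(a @ [i] := seq {#} {#} \<Delta>)) b)"
    using wf_node[OF assms(1)] assms(3) by simp
  then have "fmls_ok B Rel (nseq_of (new a i \<Delta> s))"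
    unfolding nseq_of_def new_sel node_new fmls_ok_tree[OF bd] .
  then show ?thesis using assms(1) bd unfolding wf_state_def by simp
qed

lemma at_node:
  assumes "wf_state s" "addr (kids s) a"
  obtains C where "is_ctx 1 C" "\<And>X \<Gamma> \<Delta>. nseq_of (upd a X \<Gamma> \<Delta> s) = plug1 C (seq X \<Gamma> \<Delta>)"
proof -
  obtain C where "is_ctx 1 C" "\<And>T. plug1 C T = tree (depth s) (kids s) ((node s)(a := T))"
    using plug1_tree[of "depth s" "kids s" a "node s"] assms by (auto simp: wf_state_def)
  then show ?thesis using that by (simp add: nseq_of_def node_upd)
qed

lemma at_nodes:
  assumes "wf_state s" "addr (kids s) a" "addr (kids s) b" "a \<noteq> b"
  obtains C where "is_ctx 2 C" "hole_depth C 0 (length a)" "hole_depth C 1 (length b)"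
    "\<And>X \<Gamma> \<Delta> Y \<Pi> \<Sigma>. nseq_of (upd b Y \<Pi> \<Sigma> (upd a X \<Gamma> \<Delta> s)) = plug2 C (seq X \<Gamma> \<Delta>) (seq Y \<Pi> \<Sigma>)"
proof -
  obtain C where "is_ctx 2 C" "hole_depth C 0 (length a)" "hole_depth C 1 (length b)"
    "\<And>S T. plug2 C S T = tree (depth s) (kids s) ((node s)(a := S, b := T))"
    using plug2_tree[of "depth s" "kids s" a b "node s"] assms by (auto simp: wf_state_def)
  then show ?thesis using that by (simp add: nseq_of_def node_upd)
qed

lemma at_child:
  assumes "wf_state s" "addr (kids s) (a @ [i])"
  obtains C M where "is_ctx 1 C"
    "\<And>X \<Gamma> \<Delta> Y \<Pi> \<Sigma>. nseq_of (upd (a @ [i]) Y \<Pi> \<Sigma> (upd a X \<Gamma> \<Delta> s)) =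
       plug1 C (NS X \<Gamma> \<Delta> {#NS Y \<Pi> \<Sigma> M#})"
proof -
  obtain C M where "is_ctx 1 C"
    "\<And>S T. tree (depth s) (kids s) ((node s)(a := S, a @ [i] := T)) =
      plug1 C (S + NS {#} {#} {#} {#T + NS {#} {#} {#} M#})"
    using plug1_child[of "depth s" "kids s" a i "node s"] assms by (auto simp: wf_state_def)
  then show ?thesis using that by (simp add: nseq_of_def node_upd)
qed

lemma at_new:
  assumes "wf_state s" "addr (kids s) a" "i \<notin> kids s a"
  obtains C where "is_ctx 1 C" "\<And>X \<Gamma> \<Delta>. nseq_of (upd a X \<Gamma> \<Delta> s) = plug1 C (seq X \<Gamma> \<Delta>)"
    "\<And>X \<Gamma> \<Delta> \<Delta>'. nseq_of (upd a X \<Gamma> \<Delta> (new a i \<Delta>' s)) = plug1 C (NS X \<Gamma> \<Delta> {#seq {#} {#} \<Delta>'#})"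
proof -
  obtain C where C: "is_ctx 1 C" "\<And>S. tree (depth s) (kids s) ((node s)(a := S)) = plug1 C S"
    "\<And>S T. tree (Suc (depth s)) ((kids s)(a := insert i (kids s a), a @ [i] := {}))
       ((node s)(a := S, a @ [i] := T)) = plug1 C (S + NS {#} {#} {#} {#T#})"
    using plug1_new[of "depth s" "kids s" a i "node s"] assms by (auto simp: wf_state_def)
  have "(node s)(a @ [i] := T, a := S) = (node s)(a := S, a @ [i] := T)" for S T
    by (rule fun_upd_twist) simp
  note twist = this
  show ?thesis
  proof (rule that[OF C(1)])
    show "nseq_of (upd a X \<Gamma> \<Delta> s) = plug1 C (seq X \<Gamma> \<Delta>)" for X \<Gamma> \<Delta>
      by (simp only: nseq_of_def node_upd upd_sel C(2))
    show "nseq_of (upd a X \<Gamma> \<Delta> (new a i \<Delta>' s)) = plug1 C (NS X \<Gamma> \<Delta> {#seq {#} {#} \<Delta>'#})" for X \<Gamma> \<Delta> \<Delta>'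
      unfolding nseq_of_def node_upd upd_sel node_new new_sel twist C(3) by simp
  qed
qed

lemma good_premiss:
  assumes "good s" "wf_state s'" "vars s' = vars s" "rule L [] [nseq_of s'] (nseq_of s)"
  shows "good s'"
  using assms underivable_premiss[OF assms(4)] fmls_ok_pure unfolding good_def wf_state_def by metis

lemma fmls_ok_node: "good s \<Longrightarrow> addr (kids s) a \<Longrightarrow> fmls_ok B Rel (seq (sig s a) (ante s a) (succ s a))"
  using wf_node[of s a] by (auto simp: good_def node_def)

text \<open>A rule instance in every context turns into preservation of \<open>good\<close>: premiss
  and conclusion are one context filled with the new and the old label of the node. The next three
  lemmas do the same for a pair of nodes, a child and a parent.\<close>

lemma good_upd_node:
  assumes "good s" "addr (kids s) a" "fmls_ok B Rel (seq X \<Gamma> \<Delta>)"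
    "\<And>C. is_ctx 1 C \<Longrightarrow> rule L [] [plug1 C (seq X \<Gamma> \<Delta>)] (plug1 C (seq (sig s a) (ante s a) (succ s a)))"
  shows "good (upd a X \<Gamma> \<Delta> s)"
proof -
  have wf: "wf_state s" using assms(1) by (simp add: good_def)
  obtain C where C: "is_ctx 1 C" "\<And>X \<Gamma> \<Delta>. nseq_of (upd a X \<Gamma> \<Delta> s) = plug1 C (seq X \<Gamma> \<Delta>)"
    using at_node[OF wf assms(2)] by metis
  show ?thesis
    by (rule good_premiss[OF assms(1)])
      (use assms(4)[OF C(1)] wf_upd[OF wf assms(2,3)] in \<open>simp_all add: upd_same flip: C(2)\<close>)
qed

lemma good_upd_nodes:
  assumes "good s" "addr (kids s) a" "addr (kids s) b" "a \<noteq> b" "fmls_ok B Rel (seq Y \<Pi> \<Sigma>)"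
    "\<And>C. is_ctx 2 C \<Longrightarrow> hole_depth C 0 (length a) \<Longrightarrow> hole_depth C 1 (length b) \<Longrightarrow>
      rule L [] [plug2 C (seq (sig s a) (ante s a) (succ s a)) (seq Y \<Pi> \<Sigma>)]
        (plug2 C (seq (sig s a) (ante s a) (succ s a)) (seq (sig s b) (ante s b) (succ s b)))"
  shows "good (upd b Y \<Pi> \<Sigma> s)"
proof -
  have wf: "wf_state s" using assms(1) by (simp add: good_def)
  obtain C where C: "is_ctx 2 C" "hole_depth C 0 (length a)" "hole_depth C 1 (length b)"
    "\<And>X \<Gamma> \<Delta> Y \<Pi> \<Sigma>. nseq_of (upd b Y \<Pi> \<Sigma> (upd a X \<Gamma> \<Delta> s)) = plug2 C (seq X \<Gamma> \<Delta>) (seq Y \<Pi> \<Sigma>)"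
    using at_nodes[OF wf assms(2-4)] by metis
  show ?thesis
    by (rule good_premiss[OF assms(1)])
      (use assms(6)[OF C(1-3)] wf_upd[OF wf assms(3,5)] in \<open>simp_all add: upd_same flip: C(4)\<close>)
qed

lemma good_upd_child:
  assumes "good s" "addr (kids s) (a @ [i])" "fmls_ok B Rel (seq Y \<Pi> \<Sigma>)"
    "\<And>C M. is_ctx 1 C \<Longrightarrow>
      rule L [] [plug1 C (NS (sig s a) (ante s a) (succ s a) {#NS Y \<Pi> \<Sigma> M#})]
        (plug1 C (NS (sig s a) (ante s a) (succ s a)
          {#NS (sig s (a @ [i])) (ante s (a @ [i])) (succ s (a @ [i])) M#}))"
  shows "good (upd (a @ [i]) Y \<Pi> \<Sigma> s)"
proof -
  have wf: "wf_state s" using assms(1) by (simp add: good_def)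
  obtain C M where C: "is_ctx 1 C"
    "\<And>X \<Gamma> \<Delta> Y \<Pi> \<Sigma>. nseq_of (upd (a @ [i]) Y \<Pi> \<Sigma> (upd a X \<Gamma> \<Delta> s)) =
       plug1 C (NS X \<Gamma> \<Delta> {#NS Y \<Pi> \<Sigma> M#})"
    using at_child[OF wf assms(2)] by metis
  show ?thesis
    by (rule good_premiss[OF assms(1)])
      (use assms(4)[OF C(1), of M] wf_upd[OF wf assms(2,3)] in \<open>simp_all add: upd_same flip: C(2)\<close>)
qed

lemma good_upd_parent:
  assumes "good s" "addr (kids s) (a @ [i])" "fmls_ok B Rel (seq X \<Gamma> \<Delta>)"
    "\<And>C M. is_ctx 1 C \<Longrightarrow>
      rule L [] [plug1 C (NS X \<Gamma> \<Delta> {#NS (sig s (a @ [i])) (ante s (a @ [i])) (succ s (a @ [i])) M#})]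
        (plug1 C (NS (sig s a) (ante s a) (succ s a)
          {#NS (sig s (a @ [i])) (ante s (a @ [i])) (succ s (a @ [i])) M#}))"
  shows "good (upd a X \<Gamma> \<Delta> s)"
proof -
  have wf: "wf_state s" and a: "addr (kids s) a" using assms(1,2) by (simp_all add: good_def addr_snoc)
  obtain C M where C: "is_ctx 1 C"
    "\<And>X \<Gamma> \<Delta> Y \<Pi> \<Sigma>. nseq_of (upd (a @ [i]) Y \<Pi> \<Sigma> (upd a X \<Gamma> \<Delta> s)) =
       plug1 C (NS X \<Gamma> \<Delta> {#NS Y \<Pi> \<Sigma> M#})"
    using at_child[OF wf assms(2)] by metis
  show ?thesis
    by (rule good_premiss[OF assms(1)])
      (use assms(4)[OF C(1), of M] wf_upd[OF wf a assms(3)] in \<open>simp_all add: upd_same flip: C(2)\<close>)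
qed

lemma good_fm_ok: "good s \<Longrightarrow> addr (kids s) a \<Longrightarrow> A \<in># ante s a \<Longrightarrow> fm_ok B Rel A"
  using wf_ante[of s a A] by (simp add: good_def)

lemma good_sig: "good s \<Longrightarrow> addr (kids s) a \<Longrightarrow> x \<in># sig s a \<Longrightarrow> x \<notin> B"
  using wf_sig[of s a x] by (simp add: good_def)

lemma fm_ok_subst: "fm_ok B Rel (All x A) \<Longrightarrow> y \<notin> B \<Longrightarrow> fm_ok B Rel (subst A y x)"
  using bv_subst[of y A x] by (auto simp: fm_ok_def fv_subst)

section \<open>The rules that only add to a state\<close>

lemma good_Ref:
  assumes "good s" "addr (kids s) a" "x \<notin> B"
  shows "good (addL a (Eq x x) s)"
  unfolding addL_def using assms
  by (intro good_upd_node) (use fmls_ok_node[OF assms(1,2)] in \<open>auto simp: fm_ok_def intro: rule.Ref\<close>)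

text \<open>The rule displays the equation and the atom as two occurrences in the antecedent. If
  they were the same formula, one copy might be all there is; hence the inequality.\<close>

lemma good_Repl:
  assumes "good s" "addr (kids s) a" "Eq x y \<in># ante s a" "subst P x z \<in># ante s a" "atomic P"
    "Eq x y \<noteq> subst P x z"
  shows "good (addL a (subst P y z) s)"
proof -
  obtain \<Gamma> where \<Gamma>: "ante s a = add_mset (Eq x y) (add_mset (subst P x z) \<Gamma>)"
    using assms(3,4,6) by (metis insert_noteq_member multi_member_split)
  have "fm_ok B Rel (Eq x y)" "fm_ok B Rel (subst P x z)" using good_fm_ok assms by blast+
  then have "fm_ok B Rel (subst P y z)"
    using assms(5) by (cases P) (auto simp: fm_ok_def fv_subst subst_def split: if_splits)
  then show ?thesis
    unfolding addL_def using assms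
    by (intro good_upd_node) (use fmls_ok_node[OF assms(1,2)] in \<open>auto simp: \<Gamma> intro: rule.Repl\<close>)
qed

lemma good_LAll:
  assumes "good s" "addr (kids s) a" "All x A \<in># ante s a" "z \<in># sig s a"
  shows "good (addL a (subst A z x) s)"
proof -
  obtain X \<Gamma> where \<Gamma>: "ante s a = add_mset (All x A) \<Gamma>" "sig s a = add_mset z X"
    using assms(3,4) by (meson multi_member_split)
  have "fm_ok B Rel (subst A z x)" using fm_ok_subst good_fm_ok good_sig assms by blast
  then show ?thesis
    unfolding addL_def using assms
    by (intro good_upd_node) (use fmls_ok_node[OF assms(1,2)] in \<open>auto simp: \<Gamma> intro: rule.LAll\<close>)
qed

lemma good_T:
  assumes "good s" "addr (kids s) a" "Box A \<in># ante s a" "Ax_T \<in> L"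
  shows "good (addL a A s)"
proof -
  obtain \<Gamma> where \<Gamma>: "ante s a = add_mset (Box A) \<Gamma>" using assms(3) by (meson multi_member_split)
  have "fm_ok B Rel A" using good_fm_ok[OF assms(1-3)] by (simp add: fm_ok_def)
  then show ?thesis
    unfolding addL_def using assms
    by (intro good_upd_node) (use fmls_ok_node[OF assms(1,2)] in \<open>auto simp: \<Gamma> intro: rule.R_T\<close>)
qed

lemma good_ui:
  assumes "good s" "addr (kids s) a" "x \<notin> B" "Ax_UI \<in> L"
  shows "good (addX a x s)"
  unfolding addX_def using assms
  by (intro good_upd_node) (use fmls_ok_node[OF assms(1,2)] in \<open>auto intro: rule.R_ui\<close>)

lemma good_LBox:
  assumes "good s" "addr (kids s) (a @ [i])" "Box A \<in># ante s a"
  shows "good (addL (a @ [i]) A s)"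
proof -
  obtain \<Gamma> where \<Gamma>: "ante s a = add_mset (Box A) \<Gamma>" using assms(3) by (meson multi_member_split)
  have "fm_ok B Rel A" using good_fm_ok[OF assms(1) _ assms(3)] assms(2) by (simp add: fm_ok_def addr_snoc)
  then show ?thesis
    unfolding addL_def using assms
    by (intro good_upd_child) (use fmls_ok_node[OF assms(1,2)] in \<open>auto simp: \<Gamma> intro: rule.LBox\<close>)
qed

lemma good_4:
  assumes "good s" "addr (kids s) (a @ [i])" "Box A \<in># ante s a" "Ax_4 \<in> L"
  shows "good (addL (a @ [i]) (Box A) s)"
proof -
  obtain \<Gamma> where \<Gamma>: "ante s a = add_mset (Box A) \<Gamma>" using assms(3) by (meson multi_member_split)
  have "fm_ok B Rel (Box A)" using good_fm_ok[OF assms(1) _ assms(3)] assms(2) by (simp add: addr_snoc)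
  then show ?thesis
    unfolding addL_def using assms
    by (intro good_upd_child) (use fmls_ok_node[OF assms(1,2)] in \<open>auto simp: \<Gamma> intro: rule.R_4\<close>)
qed

lemma good_B:
  assumes "good s" "addr (kids s) (a @ [i])" "Box A \<in># ante s (a @ [i])" "Ax_B \<in> L"
  shows "good (addL a A s)"
proof -
  obtain \<Gamma> where \<Gamma>: "ante s (a @ [i]) = add_mset (Box A) \<Gamma>" using assms(3) by (meson multi_member_split)
  have "fm_ok B Rel A" using good_fm_ok[OF assms(1-3)] by (simp add: fm_ok_def)
  moreover have "addr (kids s) a" using assms(2) by (simp add: addr_snoc)
  ultimately show ?thesis
    unfolding addL_def using assms
    by (intro good_upd_parent) (use fmls_ok_node[of s a] in \<open>auto simp: \<Gamma> intro: rule.R_B\<close>)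
qed

lemma good_cbf:
  assumes "good s" "addr (kids s) (a @ [i])" "x \<in># sig s a" "Ax_CBF \<in> L"
  shows "good (addX (a @ [i]) x s)"
proof -
  obtain X where X: "sig s a = add_mset x X" using assms(3) by (meson multi_member_split)
  have "x \<notin> B" using good_sig[OF assms(1) _ assms(3)] assms(2) by (simp add: addr_snoc)
  then show ?thesis
    unfolding addX_def using assms
    by (intro good_upd_child) (use fmls_ok_node[OF assms(1,2)] in \<open>auto simp: X intro: rule.R_cbf\<close>)
qed

lemma good_bf:
  assumes "good s" "addr (kids s) (a @ [i])" "x \<in># sig s (a @ [i])" "Ax_BF \<in> L"
  shows "good (addX a x s)"
proof -
  obtain X where X: "sig s (a @ [i]) = add_mset x X" using assms(3) by (meson multi_member_split)
  have "x \<notin> B" using good_sig[OF assms(1-3)] .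
  moreover have "addr (kids s) a" using assms(2) by (simp add: addr_snoc)
  ultimately show ?thesis
    unfolding addX_def using assms
    by (intro good_upd_parent) (use fmls_ok_node[of s a] in \<open>auto simp: X intro: rule.R_bf\<close>)
qed

lemma good_Rig:
  assumes "good s" "addr (kids s) a" "addr (kids s) b" "a \<noteq> b" "Eq x y \<in># ante s a"
  shows "good (addL b (Eq x y) s)"
proof -
  obtain \<Gamma> where \<Gamma>: "ante s a = add_mset (Eq x y) \<Gamma>" using assms(5) by (meson multi_member_split)
  have "fm_ok B Rel (Eq x y)" using good_fm_ok[OF assms(1,2,5)] .
  then show ?thesis
    unfolding addL_def using assms
    by (intro good_upd_nodes[OF assms(1-4)])
      (use fmls_ok_node[OF assms(1,3)] in \<open>auto simp: \<Gamma> intro: rule.Rig\<close>)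
qed

lemma good_5:
  assumes "good s" "addr (kids s) a" "addr (kids s) b" "a \<noteq> b" "a \<noteq> []" "Box A \<in># ante s a" "Ax_5 \<in> L"
  shows "good (addL b (Box A) s)"
proof -
  obtain \<Gamma> where \<Gamma>: "ante s a = add_mset (Box A) \<Gamma>" using assms(6) by (meson multi_member_split)
  have "fm_ok B Rel (Box A)" using good_fm_ok[OF assms(1,2,6)] .
  moreover have "1 \<le> length a" using assms(5) by (cases a) auto
  ultimately show ?thesis
    unfolding addL_def using assms
    by (intro good_upd_nodes[OF assms(1-4)])
      (use fmls_ok_node[OF assms(1,3)] in \<open>auto simp: \<Gamma> intro: rule.R_5\<close>)
qed

lemma good_5dom:
  assumes "good s" "addr (kids s) a" "addr (kids s) b" "a \<noteq> b" "a \<noteq> []" "b \<noteq> []" "x \<in># sig s a"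
    "Ax_5 \<in> L" "{Ax_CBF, Ax_BF} \<inter> L \<noteq> {}"
  shows "good (addX b x s)"
proof -
  obtain X where X: "sig s a = add_mset x X" using assms(7) by (meson multi_member_split)
  have x: "x \<notin> B" using good_sig[OF assms(1,2,7)] .
  have l: "1 \<le> length a" "1 \<le> length b" using assms(5,6) by (cases a; cases b; simp)+
  show ?thesis
    unfolding addX_def
  proof (rule good_upd_nodes[OF assms(1-4)])
    show "fmls_ok B Rel (seq (add_mset x (sig s b)) (ante s b) (succ s b))"
      using fmls_ok_node[OF assms(1,3)] x by auto
    show "rule L [] [plug2 C (seq (sig s a) (ante s a) (succ s a)) (seq (add_mset x (sig s b)) (ante s b) (succ s b))]
        (plug2 C (seq (sig s a) (ante s a) (succ s a)) (seq (sig s b) (ante s b) (succ s b)))"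
      if "is_ctx 2 C" "hole_depth C 0 (length a)" "hole_depth C 1 (length b)" for C
      unfolding X by (rule rule.R_5dom[OF assms(8,9) that(1,2) l(1) that(3) l(2)])
  qed
qed

lemma good_new:
  assumes "good s" "addr (kids s) a" "i \<notin> kids s a" "Ax_D \<in> L"
  shows "good (new a i {#} s)"
proof -
  have wf: "wf_state s" using assms(1) by (simp add: good_def)
  obtain C where C: "is_ctx 1 C" "\<And>X \<Gamma> \<Delta>. nseq_of (upd a X \<Gamma> \<Delta> s) = plug1 C (seq X \<Gamma> \<Delta>)"
    "\<And>X \<Gamma> \<Delta> \<Delta>'. nseq_of (upd a X \<Gamma> \<Delta> (new a i \<Delta>' s)) = plug1 C (NS X \<Gamma> \<Delta> {#seq {#} {#} \<Delta>'#})"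
    using at_new[OF wf assms(2,3)] by metis
  have "rule L [] [plug1 C (NS (sig s a) (ante s a) (succ s a) {#seq {#} {#} {#}#})]
      (plug1 C (seq (sig s a) (ante s a) (succ s a)))"
    by (rule rule.R_D[OF assms(4) C(1)])
  then have "rule L [] [nseq_of (new a i {#} s)] (nseq_of s)"
    by (simp add: upd_same flip: C(2,3))
  then show ?thesis
    using wf_new[OF wf assms(2)] by (intro good_premiss[OF assms(1)]) simp_all
qed

lemma good_no_axiom:
  assumes "good s" "addr (kids s) a"
  shows "Bot \<notin># ante s a" "atomic P \<Longrightarrow> P \<in># ante s a \<Longrightarrow> P \<notin># succ s a"
proof -
  have wf: "wf_state s" using assms(1) by (simp add: good_def)
  obtain C where C: "is_ctx 1 C" "\<And>X \<Gamma> \<Delta>. nseq_of (upd a X \<Gamma> \<Delta> s) = plug1 C (seq X \<Gamma> \<Delta>)"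
    using at_node[OF wf assms(2)] by metis
  have eq: "nseq_of s = plug1 C (seq (sig s a) (ante s a) (succ s a))"
    by (simp add: upd_same flip: C(2))
  have no: "\<not> rule L [] [] (nseq_of s)"
    using underivable_no_premiss fmls_ok_pure assms(1) unfolding good_def wf_state_def by metis
  show "Bot \<notin># ante s a"
    using no rule.LBot[OF C(1)] unfolding eq by (metis multi_member_split)
  show "atomic P \<Longrightarrow> P \<in># ante s a \<Longrightarrow> P \<notin># succ s a"
    using no rule.Init[OF C(1)] unfolding eq by (metis multi_member_split)
qed

text \<open>On the left only an implication is consumed by its rule; what one of the two premisses
  leaves behind witnesses that this has happened. \<open>redR\<close> serves the right rules, all of
  which consume.\<close>

definition redL :: "'p state \<Rightarrow> nat list \<Rightarrow> 'p fm \<Rightarrow> bool" where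
  "redL s a A \<longleftrightarrow> (\<exists>A1 A2. A = Imp A1 A2 \<and> (A1 \<in># succ s a \<or> A2 \<in># ante s a))"

definition redR :: "'p state \<Rightarrow> nat list \<Rightarrow> 'p fm \<Rightarrow> bool" where
  "redR s a A \<longleftrightarrow> (case A of
      Imp A1 A2 \<Rightarrow> A1 \<in># ante s a \<and> A2 \<in># succ s a
    | All x A1 \<Rightarrow> \<exists>y\<in>#sig s a. subst A1 y x \<in># succ s a
    | Box A1 \<Rightarrow> \<exists>i\<in>kids s a. A1 \<in># succ s (a @ [i])
    | _ \<Rightarrow> False)"

definition extends :: "'p state \<Rightarrow> 'p state \<Rightarrow> bool" where
  "extends s s' \<longleftrightarrow> (\<forall>a. addr (kids s) a \<longrightarrow> kids s a \<subseteq> kids s' a \<and> set_mset (sig s a) \<subseteq> set_mset (sig s' a) \<and>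
     (\<forall>A\<in>#ante s a. A \<in># ante s' a \<or> redL s' a A) \<and> (\<forall>A\<in>#succ s a. A \<in># succ s' a \<or> redR s' a A))"

lemma vars_update [simp]:
  "nseq_of (s\<lparr>vars := V\<rparr>) = nseq_of s" "redL (s\<lparr>vars := V\<rparr>) a A = redL s a A"
  "redR (s\<lparr>vars := V\<rparr>) a A = redR s a A" "extends s' (s\<lparr>vars := V\<rparr>) = extends s' s"
proof -
  show red: "redL (s\<lparr>vars := V\<rparr>) a A = redL s a A" "redR (s\<lparr>vars := V\<rparr>) a A = redR s a A" for a A
    by (cases A; simp add: redL_def redR_def)+
  show "nseq_of (s\<lparr>vars := V\<rparr>) = nseq_of s" by (simp add: nseq_of_def node_def[abs_def])
  show "extends s' (s\<lparr>vars := V\<rparr>) = extends s' s" by (simp add: extends_def red)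
qed

lemma extends_refl: "extends s s" by (simp add: extends_def)

lemma extends_upd:
  assumes "set_mset (sig s a) \<subseteq> set_mset X" "\<forall>A\<in>#ante s a. A \<in># \<Gamma> \<or> redL (upd a X \<Gamma> \<Delta> s) a A"
    "\<forall>A\<in>#succ s a. A \<in># \<Delta> \<or> redR (upd a X \<Gamma> \<Delta> s) a A"
  shows "extends s (upd a X \<Gamma> \<Delta> s)"
  using assms by (auto simp: extends_def)

lemma extends_new:
  assumes "i \<notin> kids s a"
  shows "extends s (new a i \<Delta> s)"
  using assms by (auto simp: extends_def addr_snoc)

text \<open>For \<open>TX\<close> and \<open>TL\<close> the insertion is demanded exactly when it
  preserves \<open>good\<close>, so these tasks can be executed without inspecting the rules; which
  insertions are permitted is settled for the limit.\<close>

primrec does :: "'p task \<Rightarrow> 'p state \<Rightarrow> 'p state \<Rightarrow> bool" where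
  "does (TX a x) s s' \<longleftrightarrow> (addr (kids s) a \<and> good (addX a x s) \<longrightarrow> x \<in># sig s' a)"
| "does (TL a A) s s' \<longleftrightarrow> (addr (kids s) a \<and> good (addL a A s) \<longrightarrow> A \<in># ante s' a)"
| "does (TC a) s s' \<longleftrightarrow> (addr (kids s) a \<and> Ax_D \<in> L \<longrightarrow> kids s' a \<noteq> {})"
| "does (TRedL a A) s s' \<longleftrightarrow>
    (addr (kids s) a \<and> A \<in># ante s a \<and> (\<exists>A1 A2. A = Imp A1 A2) \<longrightarrow> redL s' a A)"
| "does (TRedR a A) s s' \<longleftrightarrow>
    (addr (kids s) a \<and> A \<in># succ s a \<and> \<not> atomic A \<and> A \<noteq> Bot \<longrightarrow> redR s' a A)"

lemma step_ImpL:
  assumes "good s" "addr (kids s) a" "Imp A1 A2 \<in># ante s a"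
  shows "\<exists>s'. good s' \<and> extends s s' \<and> redL s' a (Imp A1 A2)"
proof -
  have wf: "wf_state s" using assms(1) by (simp add: good_def)
  obtain \<Gamma> where \<Gamma>: "ante s a = add_mset (Imp A1 A2) \<Gamma>" using assms(3) by (meson multi_member_split)
  obtain C where C: "is_ctx 1 C" "\<And>X \<Gamma> \<Delta>. nseq_of (upd a X \<Gamma> \<Delta> s) = plug1 C (seq X \<Gamma> \<Delta>)"
    using at_node[OF wf assms(2)] by metis
  let ?s1 = "upd a (sig s a) \<Gamma> (add_mset A1 (succ s a)) s"
  let ?s2 = "upd a (sig s a) (add_mset A2 \<Gamma>) (succ s a) s"
  have "rule L [] [nseq_of ?s1, nseq_of ?s2] (nseq_of (upd a (sig s a) (ante s a) (succ s a) s))"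
    unfolding C(2) \<Gamma> by (rule rule.LImp[OF C(1)])
  then have r: "rule L [] [nseq_of ?s1, nseq_of ?s2] (nseq_of s)" by (simp add: upd_same)
  have "pure (nseq_of s)" "nseq_in_lang Rel (nseq_of s)" "infinite (vars s)"
    using wf fmls_ok_pure by (auto simp: wf_state_def)
  then obtain V where V: "infinite V" "V \<subseteq> vars s"
    "underivable Rel L V (nseq_of ?s1) \<or> underivable Rel L V (nseq_of ?s2)"
    using underivable_split[OF r] assms(1) unfolding good_def by metis
  have ok: "fmls_ok B Rel (seq (sig s a) \<Gamma> (succ s a))" "fm_ok B Rel A1" "fm_ok B Rel A2"
    using fmls_ok_node[OF assms(1,2)] good_fm_ok[OF assms] by (auto simp: \<Gamma> fm_ok_def)
  have w: "wf_state ?s1" "wf_state ?s2" using ok by (auto intro!: wf_upd[OF wf assms(2)])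
  have g: "good (s'\<lparr>vars := V\<rparr>)" if "wf_state s'" "vars s' = vars s" "underivable Rel L V (nseq_of s')" for s'
    using that V by (auto simp: good_def wf_state_def)
  have "redL ?s1 a (Imp A1 A2)" "redL ?s2 a (Imp A1 A2)" by (auto simp: redL_def)
  moreover from this have "extends s ?s1" "extends s ?s2"
    by (auto intro!: extends_upd simp: \<Gamma>)
  ultimately show ?thesis using V(3) g w by (metis upd_sel(3) vars_update(2,4))
qed

lemma step_R:
  assumes "good s" "addr (kids s) a" "A \<in># succ s a" "\<not> atomic A" "A \<noteq> Bot"
  shows "\<exists>s'. good s' \<and> extends s s' \<and> redR s' a A"
proof -
  have wf: "wf_state s" using assms(1) by (simp add: good_def)
  obtain \<Delta> where \<Delta>: "succ s a = add_mset A \<Delta>" using assms(3) by (meson multi_member_split)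
  have ok: "fmls_ok B Rel (seq (sig s a) (ante s a) \<Delta>)" "fm_ok B Rel A"
    using fmls_ok_node[OF assms(1,2)] by (auto simp: \<Delta>)
  show ?thesis
  proof (cases A)
    case (Imp A1 A2)
    let ?s = "upd a (sig s a) (add_mset A1 (ante s a)) (add_mset A2 \<Delta>) s"
    have "good ?s"
      by (rule good_upd_node[OF assms(1,2)])
        (use ok in \<open>auto simp: Imp fm_ok_def \<Delta> intro: rule.RImp\<close>)
    moreover have r: "redR ?s a A" by (simp add: redR_def Imp)
    moreover have "extends s ?s" by (rule extends_upd) (use r in \<open>auto simp: \<Delta>\<close>)
    ultimately show ?thesis by blast
  next
    case (All x A1)
    obtain C where C: "is_ctx 1 C" "\<And>X \<Gamma> \<Delta>. nseq_of (upd a X \<Gamma> \<Delta> s) = plug1 C (seq X \<Gamma> \<Delta>)"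
      using at_node[OF wf assms(2)] by metis
    have "infinite (vars s)" using wf by (simp add: wf_state_def)
    then obtain y where y: "y \<in> vars s" "y \<notin> nseq_fv (nseq_of s) \<union> nseq_bv (nseq_of s)"
      by (metis finite_UnI finite_nseq_bv finite_nseq_fv finite_subset subsetI)
    let ?s = "upd a (add_mset y (sig s a)) (ante s a) (add_mset (subst A1 y x) \<Delta>) s"
    let ?s' = "?s\<lparr>vars := vars s - {y}\<rparr>"
    have "nseq_of s = plug1 C (seq (sig s a) (ante s a) (add_mset (All x A1) \<Delta>))"
      using C(2)[of "sig s a" "ante s a" "succ s a"] by (simp add: upd_same \<Delta> All)
    then have "rule L [y] [nseq_of ?s] (nseq_of s)"
      unfolding C(2) using rule.RAll[OF C(1) _ y(2)] by blast
    then have "underivable Rel L (vars s - {y}) (nseq_of ?s)"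
      using underivable_eigen y(1) assms(1) fmls_ok_pure unfolding good_def wf_state_def by metis
    moreover have "y \<notin> B" using wf y(1) by (auto simp: wf_state_def)
    then have "wf_state ?s"
      using ok fm_ok_subst[of x A1 y] by (intro wf_upd[OF wf assms(2)]) (auto simp: All)
    ultimately have "good ?s'" by (auto simp: good_def wf_state_def)
    moreover have r: "redR ?s a A" by (auto simp: redR_def All)
    moreover have "extends s ?s" by (rule extends_upd) (use r in \<open>auto simp: \<Delta>\<close>)
    ultimately show ?thesis by (metis vars_update(3,4))
  next
    case (Box A1)
    have "finite (kids s a)" using wf by (simp add: wf_state_def bounded_def)
    then obtain i where i: "i \<notin> kids s a" using ex_new_if_finite infinite_UNIV_nat by metis
    obtain C where C: "is_ctx 1 C" "\<And>X \<Gamma> \<Delta>. nseq_of (upd a X \<Gamma> \<Delta> s) = plug1 C (seq X \<Gamma> \<Delta>)"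
      "\<And>X \<Gamma> \<Delta> \<Delta>'. nseq_of (upd a X \<Gamma> \<Delta> (new a i \<Delta>' s)) = plug1 C (NS X \<Gamma> \<Delta> {#seq {#} {#} \<Delta>'#})"
      using at_new[OF wf assms(2) i] by metis
    let ?s1 = "new a i {#A1#} s"
    let ?s = "upd a (sig s a) (ante s a) \<Delta> ?s1"
    have "nseq_of s = plug1 C (seq (sig s a) (ante s a) (add_mset (Box A1) \<Delta>))"
      using C(2)[of "sig s a" "ante s a" "succ s a"] by (simp add: upd_same \<Delta> Box)
    then have "rule L [] [nseq_of ?s] (nseq_of s)"
      unfolding C(3) using rule.RBox[OF C(1)] by simp
    moreover have "wf_state ?s1" using ok(2) by (intro wf_new[OF wf assms(2)]) (simp add: Box fm_ok_def)
    moreover have "addr (kids ?s1) a"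
      using assms(2) unfolding addr_def by auto
    ultimately have "good ?s"
      using ok(1) by (intro good_premiss[OF assms(1)]) (auto intro: wf_upd)
    moreover have r: "redR ?s a A" by (auto simp: redR_def Box)
    moreover have "extends s ?s"
      using r i by (auto simp: extends_def addr_snoc \<Delta>)
    ultimately show ?thesis by blast
  qed (use assms in auto)
qed

lemma step:
  assumes "good s"
  shows "\<exists>s'. good s' \<and> extends s s' \<and> does t s s'"
proof (cases t)
  case (TX a x)
  have "extends s (addX a x s)" by (auto simp: addX_def intro: extends_upd)
  moreover have "does t s (addX a x s)" by (simp add: TX addX_def)
  ultimately show ?thesis using assms extends_refl[of s] TX
    by (cases "good (addX a x s)") (metis, metis does.simps(1))
next
  case (TL a A)
  have "extends s (addL a A s)" by (auto simp: addL_def intro: extends_upd)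
  moreover have "does t s (addL a A s)" by (simp add: TL addL_def)
  ultimately show ?thesis using assms extends_refl[of s] TL
    by (cases "good (addL a A s)") (metis, metis does.simps(2))
next
  case (TC a)
  show ?thesis
  proof (cases "addr (kids s) a \<and> Ax_D \<in> L")
    case True
    have "finite (kids s a)" using assms by (simp add: good_def wf_state_def bounded_def)
    then obtain i where i: "i \<notin> kids s a" using ex_new_if_finite infinite_UNIV_nat by metis
    then show ?thesis
      using True good_new[OF assms _ i] extends_new[of i s a "{#}"] TC
      by (intro exI[of _ "new a i {#} s"]) simp
  next
    case False
    then show ?thesis using assms extends_refl[of s] TC by (metis does.simps(3))
  qed
next
  case (TRedL a A)
  then show ?thesis
    using assms extends_refl[of s] step_ImpL[OF assms, of a] by (metis does.simps(4))
next
  case (TRedR a A)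
  then show ?thesis
    using assms extends_refl[of s] step_R[OF assms, of a A] by (metis does.simps(5))
qed

end

section \<open>The limit tree\<close>

text \<open>Recurrence beyond every \<open>n\<close> matters: a task may come up while its
  precondition still fails.\<close>

locale saturation = calculus Rel L B for Rel :: "nat \<Rightarrow> 'p set" and L B +
  fixes s :: "nat \<Rightarrow> 'p state"
  assumes good_s: "good (s n)"
    and extends_s: "extends (s n) (s (Suc n))"
    and tasks: "\<And>a x n. \<exists>k\<ge>n. does (TX a x) (s k) (s (Suc k))"
      "\<And>a A n. in_lang Rel A \<Longrightarrow> \<exists>k\<ge>n. does (TL a A) (s k) (s (Suc k))"
      "\<And>a n. \<exists>k\<ge>n. does (TC a) (s k) (s (Suc k))"
      "\<And>a A n. in_lang Rel A \<Longrightarrow> \<exists>k\<ge>n. does (TRedL a A) (s k) (s (Suc k))"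
      "\<And>a A n. in_lang Rel A \<Longrightarrow> \<exists>k\<ge>n. does (TRedR a A) (s k) (s (Suc k))"
begin

definition W :: "nat list set" where
  "W = {a. \<exists>n. addr (kids (s n)) a}"

text \<open>The guard \<open>addr\<close> excludes the arbitrary labels outside the tree. In
  \<open>Gs\<close> and \<open>Ds\<close> a formula stays a member even when it is consumed later,
  which is harmless since its reducts are members as well.\<close>

definition Xs :: "nat list \<Rightarrow> var set" where
  "Xs a = {x. \<exists>n. addr (kids (s n)) a \<and> x \<in># sig (s n) a}"

definition Gs :: "nat list \<Rightarrow> 'p fm set" where
  "Gs a = {A. \<exists>n. addr (kids (s n)) a \<and> A \<in># ante (s n) a}"

definition Ds :: "nat list \<Rightarrow> 'p fm set" where
  "Ds a = {A. \<exists>n. addr (kids (s n)) a \<and> A \<in># succ (s n) a}"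

lemma addr_Suc: "addr (kids (s n)) a \<Longrightarrow> addr (kids (s (Suc n))) a"
  by (rule addr_mono) (use extends_s[of n] in \<open>auto simp: extends_def\<close>)

lemma addr_le: "k \<le> n \<Longrightarrow> addr (kids (s k)) a \<Longrightarrow> addr (kids (s n)) a"
  by (induction n rule: dec_induct) (auto intro: addr_Suc)

lemma sig_le: "k \<le> n \<Longrightarrow> addr (kids (s k)) a \<Longrightarrow> x \<in># sig (s k) a \<Longrightarrow> x \<in># sig (s n) a"
proof (induction n rule: dec_induct)
  case (step n)
  then show ?case using extends_s[of n] addr_le[of k n a] unfolding extends_def by blast
qed simp

text \<open>Once the formula has left the label, some stage \<open>j\<close> shows its reduct;
  \<open>j\<close> cannot be replaced by \<open>n\<close>, since the reduct may itself have been
  consumed by then.\<close>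

lemma ante_le:
  "k \<le> n \<Longrightarrow> addr (kids (s k)) a \<Longrightarrow> A \<in># ante (s k) a \<Longrightarrow>
    A \<in># ante (s n) a \<or> (\<exists>j. addr (kids (s j)) a \<and> redL (s j) a A)"
proof (induction n rule: dec_induct)
  case (step n)
  then show ?case
    using extends_s[of n] addr_le[of k n a] addr_le[of k "Suc n" a] unfolding extends_def
    by (metis le_SucI)
qed simp

lemma succ_le:
  "k \<le> n \<Longrightarrow> addr (kids (s k)) a \<Longrightarrow> A \<in># succ (s k) a \<Longrightarrow>
    A \<in># succ (s n) a \<or> (\<exists>j. addr (kids (s j)) a \<and> redR (s j) a A)"
proof (induction n rule: dec_induct)
  case (step n)
  then show ?case
    using extends_s[of n] addr_le[of k n a] addr_le[of k "Suc n" a] unfolding extends_def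
    by (metis le_SucI)
qed simp

lemma W_ev: "a \<in> W \<Longrightarrow> \<forall>\<^sub>F n in sequentially. addr (kids (s n)) a"
  unfolding W_def eventually_sequentially using addr_le by blast

lemma Xs_ev: "x \<in> Xs a \<Longrightarrow> \<forall>\<^sub>F n in sequentially. x \<in># sig (s n) a"
  unfolding Xs_def eventually_sequentially using sig_le by blast

text \<open>Only implications leave an antecedent, so any other member stays from its first stage
  on. This makes the side conditions of the additive rules hold eventually.\<close>

lemma Gs_ev:
  assumes "A \<in> Gs a" "\<nexists>A1 A2. A = Imp A1 A2"
  shows "\<forall>\<^sub>F n in sequentially. A \<in># ante (s n) a"
proof -
  have "\<not> redL (s j) a A" for j using assms(2) by (auto simp: redL_def)
  then show ?thesis
    using assms(1) ante_le unfolding Gs_def eventually_sequentially by blast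
qed

lemma in_W: "x \<in> Xs a \<Longrightarrow> a \<in> W" "A \<in> Gs a \<Longrightarrow> a \<in> W" "A \<in> Ds a \<Longrightarrow> a \<in> W"
  by (auto simp: W_def Xs_def Gs_def Ds_def)

lemma fm_ok_Gs: "A \<in> Gs a \<Longrightarrow> fm_ok B Rel A"
  using good_s wf_ante unfolding Gs_def good_def by blast

lemma fm_ok_Ds: "A \<in> Ds a \<Longrightarrow> fm_ok B Rel A"
  using good_s wf_succ unfolding Ds_def good_def by blast

lemma Xs_B: "x \<in> Xs a \<Longrightarrow> x \<notin> B"
  using good_s wf_sig unfolding Xs_def good_def by blast

lemma Nil_in_W: "[] \<in> W" by (simp add: W_def)

lemma W_snoc: "a @ [i] \<in> W \<Longrightarrow> a \<in> W" by (auto simp: W_def addr_snoc)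

lemma W_append: "a @ b \<in> W \<Longrightarrow> a \<in> W" by (auto simp: W_def intro: addr_append)

text \<open>The task inserting \<open>A\<close> recurs, so it is executed at a stage where the
  insertion is permitted. Closure of \<open>Gs\<close> under an additive rule thus reduces to
  checking that the rule permits the insertion from some stage on.\<close>

lemma Gs_add:
  assumes "a \<in> W" "fm_ok B Rel A" "\<forall>\<^sub>F n in sequentially. good (addL a A (s n))"
  shows "A \<in> Gs a"
proof -
  have "\<forall>\<^sub>F n in sequentially. addr (kids (s n)) a \<and> good (addL a A (s n))"
    using W_ev[OF assms(1)] assms(3) by eventually_elim simp
  then obtain n0 where n0: "\<And>n. n \<ge> n0 \<Longrightarrow> addr (kids (s n)) a \<and> good (addL a A (s n))"
    unfolding eventually_sequentially by blast
  obtain k where "k \<ge> n0" "does (TL a A) (s k) (s (Suc k))"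
    using tasks(2) assms(2) unfolding fm_ok_def by blast
  then have "A \<in># ante (s (Suc k)) a" "addr (kids (s (Suc k))) a" using n0 by auto
  then show ?thesis unfolding Gs_def by blast
qed

lemma Xs_add:
  assumes "a \<in> W" "\<forall>\<^sub>F n in sequentially. good (addX a x (s n))"
  shows "x \<in> Xs a"
proof -
  have "\<forall>\<^sub>F n in sequentially. addr (kids (s n)) a \<and> good (addX a x (s n))"
    using W_ev[OF assms(1)] assms(2) by eventually_elim simp
  then obtain n0 where n0: "\<And>n. n \<ge> n0 \<Longrightarrow> addr (kids (s n)) a \<and> good (addX a x (s n))"
    unfolding eventually_sequentially by blast
  obtain k where "k \<ge> n0" "does (TX a x) (s k) (s (Suc k))"
    using tasks(1) by blast
  then have "x \<in># sig (s (Suc k)) a" "addr (kids (s (Suc k))) a" using n0 by auto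
  then show ?thesis unfolding Xs_def by blast
qed

lemma Gs_Imp:
  assumes "Imp A1 A2 \<in> Gs a"
  shows "A1 \<in> Ds a \<or> A2 \<in> Gs a"
proof -
  obtain n where n: "addr (kids (s n)) a" "Imp A1 A2 \<in># ante (s n) a"
    using assms by (auto simp: Gs_def)
  have "in_lang Rel (Imp A1 A2)" using fm_ok_Gs[OF assms] by (simp add: fm_ok_def)
  then obtain k where k: "k \<ge> n" "does (TRedL a (Imp A1 A2)) (s k) (s (Suc k))"
    using tasks(4) by blast
  \<comment> \<open>By stage \<open>k\<close> the implication may have been consumed already;
    otherwise the task reduces it in the next state.\<close>
  have "\<exists>j. addr (kids (s j)) a \<and> redL (s j) a (Imp A1 A2)"
    using ante_le[OF k(1) n] k addr_le[of n k a] addr_le[of n "Suc k" a] n(1) by auto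
  then show ?thesis by (auto simp: redL_def Gs_def Ds_def)
qed

lemma Ds_reduced:
  assumes "A \<in> Ds a" "\<not> atomic A" "A \<noteq> Bot"
  shows "\<exists>j. addr (kids (s j)) a \<and> redR (s j) a A"
proof -
  obtain n where n: "addr (kids (s n)) a" "A \<in># succ (s n) a"
    using assms by (auto simp: Ds_def)
  have "in_lang Rel A" using fm_ok_Ds[OF assms(1)] by (simp add: fm_ok_def)
  then obtain k where k: "k \<ge> n" "does (TRedR a A) (s k) (s (Suc k))"
    using tasks(5) by blast
  show ?thesis
    using succ_le[OF k(1) n] k addr_le[of n k a] addr_le[of n "Suc k" a] n(1) assms(2,3) by auto
qed

lemma Ds_Imp: "Imp A1 A2 \<in> Ds a \<Longrightarrow> A1 \<in> Gs a \<and> A2 \<in> Ds a"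
  using Ds_reduced[of "Imp A1 A2" a] by (auto simp: redR_def Gs_def Ds_def)

lemma Ds_All: "All x A \<in> Ds a \<Longrightarrow> \<exists>y\<in>Xs a. subst A y x \<in> Ds a"
  using Ds_reduced[of "All x A" a] by (auto simp: redR_def Xs_def Ds_def)

lemma Ds_Box: "Box A \<in> Ds a \<Longrightarrow> \<exists>i. a @ [i] \<in> W \<and> A \<in> Ds (a @ [i])"
  using Ds_reduced[of "Box A" a] by (auto simp: redR_def W_def Ds_def addr_snoc)

lemma Bot_Gs: "Bot \<notin> Gs a"
  using good_no_axiom(1)[OF good_s] by (auto simp: Gs_def)

text \<open>Atoms are never consumed, so occurrences on both sides, found at possibly different
  stages, meet at the later one and would make the sequent there initial.\<close>

lemma atomic_Gs_Ds:
  assumes "atomic P" "P \<in> Gs a"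
  shows "P \<notin> Ds a"
proof
  assume "P \<in> Ds a"
  then obtain k where k: "addr (kids (s k)) a" "P \<in># succ (s k) a" by (auto simp: Ds_def)
  obtain n where n: "addr (kids (s n)) a" "P \<in># ante (s n) a" using assms(2) by (auto simp: Gs_def)
  let ?m = "max k n"
  have "\<not> redL (s j) a P" "\<not> redR (s j) a P" for j
    using assms(1) by (cases P; simp add: redL_def redR_def)+
  then have "P \<in># succ (s ?m) a" "P \<in># ante (s ?m) a" "addr (kids (s ?m)) a"
    using succ_le[of k ?m a P] ante_le[of n ?m a P] addr_le[of k ?m a] k n by auto
  then show False using good_no_axiom(2)[OF good_s] assms(1) by blast
qed

section \<open>Closure of the limit under the additive rules\<close>

lemma Gs_All: assumes "All x A \<in> Gs a" "z \<in> Xs a" shows "subst A z x \<in> Gs a"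
proof (rule Gs_add)
  show "a \<in> W" using assms in_W by blast
  show "fm_ok B Rel (subst A z x)" using fm_ok_subst[OF fm_ok_Gs[OF assms(1)]] Xs_B assms(2) by blast
  show "\<forall>\<^sub>F n in sequentially. good (addL a (subst A z x) (s n))"
    using W_ev[OF \<open>a \<in> W\<close>] Xs_ev[OF assms(2)] Gs_ev[OF assms(1), simplified]
    by eventually_elim (rule good_LAll[OF good_s])
qed

lemma Gs_Box: assumes "Box A \<in> Gs a" "a @ [i] \<in> W" shows "A \<in> Gs (a @ [i])"
proof (rule Gs_add[OF assms(2)])
  show "fm_ok B Rel A" using fm_ok_Gs[OF assms(1)] by (simp add: fm_ok_def)
  show "\<forall>\<^sub>F n in sequentially. good (addL (a @ [i]) A (s n))"
    using W_ev[OF assms(2)] Gs_ev[OF assms(1), simplified] by eventually_elim (rule good_LBox[OF good_s])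
qed

lemma Gs_4:
  assumes "Box A \<in> Gs a" "a @ [i] \<in> W" "Ax_4 \<in> L" shows "Box A \<in> Gs (a @ [i])"
proof (rule Gs_add[OF assms(2)])
  show "fm_ok B Rel (Box A)" using fm_ok_Gs[OF assms(1)] .
  show "\<forall>\<^sub>F n in sequentially. good (addL (a @ [i]) (Box A) (s n))"
    using W_ev[OF assms(2)] Gs_ev[OF assms(1), simplified] by eventually_elim (rule good_4[OF good_s _ _ assms(3)])
qed

lemma Gs_B:
  assumes "Box A \<in> Gs (a @ [i])" "Ax_B \<in> L" shows "A \<in> Gs a"
proof (rule Gs_add)
  have W: "a @ [i] \<in> W" using assms in_W by blast
  then show "a \<in> W" by (rule W_snoc)
  show "fm_ok B Rel A" using fm_ok_Gs[OF assms(1)] by (simp add: fm_ok_def)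
  show "\<forall>\<^sub>F n in sequentially. good (addL a A (s n))"
    using W_ev[OF W] Gs_ev[OF assms(1), simplified] by eventually_elim (rule good_B[OF good_s _ _ assms(2)])
qed

lemma Gs_T:
  assumes "Box A \<in> Gs a" "Ax_T \<in> L" shows "A \<in> Gs a"
proof (rule Gs_add)
  show W: "a \<in> W" using assms in_W by blast
  show "fm_ok B Rel A" using fm_ok_Gs[OF assms(1)] by (simp add: fm_ok_def)
  show "\<forall>\<^sub>F n in sequentially. good (addL a A (s n))"
    using W_ev[OF W] Gs_ev[OF assms(1), simplified] by eventually_elim (rule good_T[OF good_s _ _ assms(2)])
qed

lemma Gs_5:
  assumes "Box A \<in> Gs a" "a \<noteq> []" "b \<in> W" "Ax_5 \<in> L" shows "Box A \<in> Gs b"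
proof (cases "a = b")
  case False
  have W: "a \<in> W" using assms in_W by blast
  show ?thesis
  proof (rule Gs_add[OF assms(3)])
    show "fm_ok B Rel (Box A)" using fm_ok_Gs[OF assms(1)] .
    show "\<forall>\<^sub>F n in sequentially. good (addL b (Box A) (s n))"
      using W_ev[OF W] W_ev[OF assms(3)] Gs_ev[OF assms(1), simplified]
      by eventually_elim (rule good_5[OF good_s _ _ False assms(2) _ assms(4)])
  qed
qed (use assms in simp)

lemma Gs_Rig:
  assumes "Eq x y \<in> Gs a" "b \<in> W" shows "Eq x y \<in> Gs b"
proof (cases "a = b")
  case False
  have W: "a \<in> W" using assms in_W by blast
  show ?thesis
  proof (rule Gs_add[OF assms(2)])
    show "fm_ok B Rel (Eq x y)" using fm_ok_Gs[OF assms(1)] .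
    show "\<forall>\<^sub>F n in sequentially. good (addL b (Eq x y) (s n))"
      using W_ev[OF W] W_ev[OF assms(2)] Gs_ev[OF assms(1), simplified]
      by eventually_elim (rule good_Rig[OF good_s _ _ False])
  qed
qed (use assms in simp)

lemma Gs_Ref:
  assumes "a \<in> W" "x \<notin> B" shows "Eq x x \<in> Gs a"
proof (rule Gs_add[OF assms(1)])
  show "fm_ok B Rel (Eq x x)" using assms(2) by (simp add: fm_ok_def)
  show "\<forall>\<^sub>F n in sequentially. good (addL a (Eq x x) (s n))"
    using W_ev[OF assms(1)] by eventually_elim (rule good_Ref[OF good_s _ assms(2)])
qed

lemma Gs_Repl:
  assumes "Eq x y \<in> Gs a" "subst P x z \<in> Gs a" "atomic P" "Eq x y \<noteq> subst P x z"
  shows "subst P y z \<in> Gs a"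
proof (rule Gs_add)
  show W: "a \<in> W" using assms in_W by blast
  show "fm_ok B Rel (subst P y z)"
    using fm_ok_Gs[OF assms(1)] fm_ok_Gs[OF assms(2)] assms(3)
    by (cases P) (auto simp: fm_ok_def fv_subst subst_def split: if_splits)
  have "\<nexists>A1 A2. subst P x z = Imp A1 A2" using assms(3) by (cases P) (auto simp: subst_def)
  then have "\<forall>\<^sub>F n in sequentially. subst P x z \<in># ante (s n) a" by (rule Gs_ev[OF assms(2)])
  then show "\<forall>\<^sub>F n in sequentially. good (addL a (subst P y z) (s n))"
    using W_ev[OF W] Gs_ev[OF assms(1), simplified]
    by eventually_elim (rule good_Repl[OF good_s _ _ _ assms(3,4)])
qed

lemma Xs_cbf:
  assumes "a @ [i] \<in> W" "Ax_CBF \<in> L" shows "Xs a \<subseteq> Xs (a @ [i])"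
proof
  fix x assume x: "x \<in> Xs a"
  have "\<forall>\<^sub>F n in sequentially. good (addX (a @ [i]) x (s n))"
    using W_ev[OF assms(1)] Xs_ev[OF x] by eventually_elim (rule good_cbf[OF good_s _ _ assms(2)])
  then show "x \<in> Xs (a @ [i])" by (rule Xs_add[OF assms(1)])
qed

lemma Xs_bf:
  assumes "a @ [i] \<in> W" "Ax_BF \<in> L" shows "Xs (a @ [i]) \<subseteq> Xs a"
proof
  fix x assume x: "x \<in> Xs (a @ [i])"
  have "\<forall>\<^sub>F n in sequentially. good (addX a x (s n))"
    using W_ev[OF assms(1)] Xs_ev[OF x] by eventually_elim (rule good_bf[OF good_s _ _ assms(2)])
  then show "x \<in> Xs a" by (rule Xs_add[OF W_snoc[OF assms(1)]])
qed

lemma Xs_ui: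
  assumes "a \<in> W" "Ax_UI \<in> L" shows "Xs a = - B"
proof -
  have "x \<in> Xs a" if x: "x \<notin> B" for x
  proof (rule Xs_add[OF assms(1)])
    show "\<forall>\<^sub>F n in sequentially. good (addX a x (s n))"
      using W_ev[OF assms(1)] by eventually_elim (rule good_ui[OF good_s _ x assms(2)])
  qed
  then show ?thesis using Xs_B by blast
qed

lemma Xs_5dom:
  assumes "a \<in> W" "b \<in> W" "a \<noteq> []" "b \<noteq> []" "Ax_5 \<in> L" "{Ax_CBF, Ax_BF} \<inter> L \<noteq> {}"
  shows "Xs a = Xs b"
proof -
  have "Xs a \<subseteq> Xs b" if "a \<in> W" "b \<in> W" "a \<noteq> []" "b \<noteq> []" "a \<noteq> b" for a b
  proof
    fix x assume x: "x \<in> Xs a"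
    have "\<forall>\<^sub>F n in sequentially. good (addX b x (s n))"
      using W_ev[OF that(1)] W_ev[OF that(2)] Xs_ev[OF x]
      by eventually_elim (rule good_5dom[OF good_s _ _ that(5,3,4) _ assms(5,6)])
    then show "x \<in> Xs b" by (rule Xs_add[OF that(2)])
  qed
  then show ?thesis using assms by (cases "a = b") blast+
qed

lemma W_D:
  assumes "a \<in> W" "Ax_D \<in> L" shows "\<exists>i. a @ [i] \<in> W"
proof -
  obtain n where n: "addr (kids (s n)) a" using assms(1) by (auto simp: W_def)
  obtain k where k: "k \<ge> n" "does (TC a) (s k) (s (Suc k))" using tasks(3) by blast
  have "kids (s (Suc k)) a \<noteq> {}" "addr (kids (s (Suc k))) a"
    using k n assms(2) addr_le[of n k a] addr_le[of n "Suc k" a] by auto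
  then show ?thesis by (auto simp: W_def addr_snoc)
qed

end

section \<open>Countability of the language\<close>

instance fm :: (countable) countable
  by countable_datatype

text \<open>The type \<open>'p\<close> may be uncountable, but the indices of the language form a
  countable set \<open>?Q\<close>, so its formulas are images of formulas with natural numbers as
  indices.\<close>

lemma countable_in_lang:
  assumes "\<And>n. countable (Rel n)"
  shows "countable {A :: 'p fm. in_lang Rel A}"
proof -
  let ?Q = "\<Union>n. Rel n"
  have Q: "countable ?Q" using assms by simp
  have "set_fm A \<subseteq> ?Q" if "in_lang Rel A" for A using that by (induction A) auto
  moreover have "A \<in> range (map_fm (from_nat_into ?Q))" if "set_fm A \<subseteq> ?Q" for A
  proof -
    have "map_fm (from_nat_into ?Q) (map_fm (to_nat_on ?Q) A) = A"
      unfolding fm.map_comp using that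
      by (intro fm.map_ident_strong) (auto intro!: from_nat_into_to_nat_on[OF Q])
    then show ?thesis by (metis rangeI)
  qed
  ultimately have "{A. in_lang Rel A} \<subseteq> range (map_fm (from_nat_into ?Q))" by blast
  then show ?thesis by (rule countable_subset) simp
qed

section \<open>The countermodel\<close>

text \<open>What proper closure provides. \<open>T5_4\<close> and \<open>B5_4\<close> let boxes
  leave the root through \<open>R_4\<close>; \<open>B4_5\<close> makes \<open>R_5\<close> available
  where B and 4 already force a Euclidean relation; the last two turn one domain condition into
  both, as required over a symmetric relation.\<close>

locale countermodel = saturation Rel L B s for Rel :: "nat \<Rightarrow> 'p set" and L B and s :: "nat \<Rightarrow> 'p state" +
  assumes T5_4: "Ax_T \<in> L \<Longrightarrow> Ax_5 \<in> L \<Longrightarrow> Ax_4 \<in> L"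
    and B5_4: "Ax_B \<in> L \<Longrightarrow> Ax_5 \<in> L \<Longrightarrow> Ax_4 \<in> L"
    and B4_5: "Ax_B \<in> L \<Longrightarrow> Ax_4 \<in> L \<Longrightarrow> Ax_5 \<in> L"
    and B_dom: "Ax_B \<in> L \<Longrightarrow> Ax_CBF \<in> L \<longleftrightarrow> Ax_BF \<in> L"
    and T5_dom: "Ax_T \<in> L \<Longrightarrow> Ax_5 \<in> L \<Longrightarrow> Ax_CBF \<in> L \<longleftrightarrow> Ax_BF \<in> L"
begin

text \<open>The closure of the parent-child relation under the frame conditions of \<open>L\<close>, in explicit form.\<close>

definition R :: "nat list \<Rightarrow> nat list \<Rightarrow> bool" where
  "R a b \<longleftrightarrow> a \<in> W \<and> b \<in> W \<and>
    (if Ax_5 \<in> L then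
       if Ax_T \<in> L \<or> Ax_B \<in> L then Ax_T \<in> L \<or> W \<noteq> {[]}
       else if Ax_4 \<in> L then b \<noteq> []
       else if a = [] then (\<exists>i. b = [i]) else b \<noteq> []
     else if Ax_4 \<in> L then (\<exists>c. b = a @ c \<and> (c = [] \<longrightarrow> Ax_T \<in> L))
     else (\<exists>i. b = a @ [i]) \<or> (Ax_T \<in> L \<and> a = b) \<or> (Ax_B \<in> L \<and> (\<exists>i. a = b @ [i])))"

section \<open>Frame conditions of the explicit relation\<close>

lemma R_child: "a @ [i] \<in> W \<Longrightarrow> R a (a @ [i])"
  using W_snoc[of a i] by (auto simp: R_def)

lemma R_refl: "Ax_T \<in> L \<Longrightarrow> a \<in> W \<Longrightarrow> R a a"
  using T5_4 by (auto simp: R_def)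

text \<open>With B and 4 but without 5 the relation would be descent in the tree;
  \<open>B4_5\<close> excludes this combination.\<close>

lemma R_sym: "Ax_B \<in> L \<Longrightarrow> R a b \<Longrightarrow> R b a"
  using B4_5 by (auto simp: R_def split: if_splits)

lemma R_trans: "Ax_4 \<in> L \<Longrightarrow> R a b \<Longrightarrow> R b c \<Longrightarrow> R a c"
  by (auto simp: R_def split: if_splits)

text \<open>Under 5 the relation is universal when T or B is present, except that B without T leaves
  a lone root irreflexive. Otherwise all nodes other than the root form one cluster; the root is
  never seen, and it sees the whole cluster if 4 is present, else only its children.\<close>

lemma R_eucl: "Ax_5 \<in> L \<Longrightarrow> R a b \<Longrightarrow> R a c \<Longrightarrow> R b c"
  by (auto simp: R_def split: if_splits)

section \<open>Propagation of boxes along the relation\<close>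

lemma Gs_4_append: "Box A \<in> Gs a \<Longrightarrow> a @ c \<in> W \<Longrightarrow> Ax_4 \<in> L \<Longrightarrow> Box A \<in> Gs (a @ c)"
proof (induction c rule: rev_induct)
  case (snoc i c)
  then show ?case using W_append[of "a @ c" "[i]"] Gs_4[of A "a @ c" i] by simp
qed simp

text \<open>From the root the box moves down the tree by \<open>R_4\<close>; from any other node it
  jumps by \<open>R_5\<close>, whose first hole must not be at the root.\<close>

lemma Gs_everywhere:
  assumes "Box A \<in> Gs a" "b \<in> W" "Ax_5 \<in> L" "Ax_4 \<in> L \<or> a \<noteq> []"
  shows "Box A \<in> Gs b"
  using Gs_4_append[of A "[]" b] Gs_5[of A a b] assms by (cases "a = []") auto

lemma Gs_Box_nonroot:
  assumes "Box A \<in> Gs a" "b \<in> W" "b \<noteq> []" "Ax_5 \<in> L" "Ax_4 \<in> L \<or> a \<noteq> []"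
  shows "A \<in> Gs b"
proof -
  obtain p i where b: "b = p @ [i]" using assms(3) by (cases b rule: rev_cases) auto
  then have "Box A \<in> Gs p" using Gs_everywhere[OF assms(1) _ assms(4,5)] W_snoc assms(2) by blast
  then show ?thesis using Gs_Box assms(2) b by blast
qed

text \<open>Here the explicit relation has to match the propagation rules: each of its cases is
  served by transporting the box to \<open>b\<close>, to the parent of \<open>b\<close> or to a
  child of \<open>b\<close>, and then applying \<open>R_T\<close>, \<open>LBox\<close> or
  \<open>R_B\<close>.\<close>

lemma Gs_Box_R:
  assumes "Box A \<in> Gs a" "R a b"
  shows "A \<in> Gs b"
proof -
  have W: "a \<in> W" "b \<in> W" using assms(2) by (auto simp: R_def)
  show ?thesis
  proof (cases "Ax_5 \<in> L")
    case 5: True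
    consider (T) "Ax_T \<in> L" | (B) "Ax_T \<notin> L" "Ax_B \<in> L" | (no) "Ax_T \<notin> L" "Ax_B \<notin> L" by blast
    then show ?thesis
    proof cases
      case T
      then show ?thesis using Gs_T Gs_everywhere[OF assms(1) W(2) 5] T5_4[OF _ 5] by blast
    next
      case B
      have 4: "Ax_4 \<in> L" using B B5_4 5 by blast
      show ?thesis
      proof (cases "b = []")
        case True
        \<comment> \<open>The root receives \<open>A\<close> from a child by \<open>R_B\<close>;
          \<open>R\<close> holds here only if the tree has a second node, hence a child of the
          root.\<close>
        have "W \<noteq> {[]}" using assms(2) B 5 by (simp add: R_def)
        then obtain d where "d \<in> W" "d \<noteq> []" using W(2) by blast
        then obtain i where "[i] \<in> W" using W_append[of "[_]"] by (metis append_Cons append_Nil neq_Nil_conv)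
        then have "Box A \<in> Gs ([] @ [i])" using Gs_everywhere[OF assms(1) _ 5] 4 by simp
        then show ?thesis using Gs_B B True by blast
      next
        case False
        then show ?thesis using Gs_Box_nonroot[OF assms(1) W(2) False 5] 4 by blast
      qed
    next
      case no
      show ?thesis
      proof (cases "Ax_4 \<in> L \<or> a \<noteq> []")
        case True
        then have "b \<noteq> []" using assms(2) no 5 by (auto simp: R_def split: if_splits)
        then show ?thesis using Gs_Box_nonroot[OF assms(1) W(2) _ 5 True] by blast
      next
        case False
        then obtain i where "b = a @ [i]" using assms(2) no 5 by (auto simp: R_def)
        then show ?thesis using Gs_Box[OF assms(1)] W(2) by blast
      qed
    qed
  next
    case no5: False
    show ?thesis
    proof (cases "Ax_4 \<in> L")
      case True
      then obtain c where c: "b = a @ c" "c = [] \<longrightarrow> Ax_T \<in> L" using assms(2) no5 by (auto simp: R_def)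
      show ?thesis
      proof (cases c rule: rev_cases)
        case Nil
        then show ?thesis using c Gs_T assms(1) by simp
      next
        case (snoc d i)
        then have "Box A \<in> Gs (a @ d)"
          using Gs_4_append[OF assms(1) _ True, of d] W(2) W_append[of "a @ d" "[i]"] c by simp
        then show ?thesis using Gs_Box[of A "a @ d" i] W(2) c snoc by simp
      qed
    next
      case False
      then consider i where "b = a @ [i]" | "Ax_T \<in> L" "a = b" | i where "Ax_B \<in> L" "a = b @ [i]"
        using assms(2) no5 by (auto simp: R_def)
      then show ?thesis
      proof cases
        case 1
        then show ?thesis using Gs_Box[OF assms(1)] W(2) by blast
      next
        case 2
        then show ?thesis using Gs_T[OF assms(1)] by blast
      next
        case (3 i)
        then show ?thesis using Gs_B assms(1) by blast
      qed
    qed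
  qed
qed

section \<open>Propagation of signatures along the relation\<close>

lemma Xs_cbf_append: "Ax_CBF \<in> L \<Longrightarrow> a @ c \<in> W \<Longrightarrow> Xs a \<subseteq> Xs (a @ c)"
proof (induction c rule: rev_induct)
  case (snoc i c)
  then show ?case using W_append[of "a @ c" "[i]"] Xs_cbf[of "a @ c" i] by simp
qed simp

lemma Xs_bf_append: "Ax_BF \<in> L \<Longrightarrow> a @ c \<in> W \<Longrightarrow> Xs (a @ c) \<subseteq> Xs a"
proof (induction c rule: rev_induct)
  case (snoc i c)
  then show ?case using W_append[of "a @ c" "[i]"] Xs_bf[of "a @ c" i] by simp
qed simp

lemma Xs_const:
  assumes "Ax_CBF \<in> L" "Ax_BF \<in> L" "a \<in> W" "b \<in> W"
  shows "Xs a = Xs b"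
proof -
  have "Xs c = Xs []" if "c \<in> W" for c
    using Xs_cbf_append[OF assms(1), of "[]" c] Xs_bf_append[OF assms(2), of "[]" c] that by simp
  then show ?thesis using assms(3,4) by blast
qed

text \<open>Along a path down the tree the rule of the domain axiom at hand suffices. Any other
  related pair has equal signatures: either both domain axioms are present, or both nodes differ
  from the root and \<open>R_5dom\<close> applies.\<close>

lemma Xs_R:
  assumes "R a b"
  shows "Ax_CBF \<in> L \<Longrightarrow> Xs a \<subseteq> Xs b" and "Ax_BF \<in> L \<Longrightarrow> Xs b \<subseteq> Xs a"
proof -
  have W: "a \<in> W" "b \<in> W" using assms by (auto simp: R_def)
  have tree_or_const: "(\<exists>c. b = a @ c) \<or> Xs a = Xs b" if D: "Ax_CBF \<in> L \<or> Ax_BF \<in> L"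
  proof (cases "Ax_CBF \<in> L \<and> Ax_BF \<in> L")
    case True
    then show ?thesis using Xs_const W by blast
  next
    case False
    \<comment> \<open>With only one of the two domain axioms, proper closure excludes B, and also T
      together with 5, as these make the relation symmetric.\<close>
    then have noB: "Ax_B \<notin> L" and noT: "Ax_5 \<in> L \<Longrightarrow> Ax_T \<notin> L" using D B_dom T5_dom by blast+
    have "\<exists>c. b = a @ c" if "a = []" using that by simp
    moreover have "Xs a = Xs b" if "a \<noteq> []" "Ax_5 \<in> L"
    proof -
      have "b \<noteq> []" using assms that noB noT by (auto simp: R_def split: if_splits)
      then show ?thesis using Xs_5dom W that D by blast
    qed
    moreover have "\<exists>c. b = a @ c" if "Ax_5 \<notin> L"
      using assms that noB by (auto simp: R_def split: if_splits)
    ultimately show ?thesis by blast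
  qed
  show "Ax_CBF \<in> L \<Longrightarrow> Xs a \<subseteq> Xs b" using tree_or_const Xs_cbf_append W(2) by blast
  show "Ax_BF \<in> L \<Longrightarrow> Xs b \<subseteq> Xs a" using tree_or_const Xs_bf_append W(2) by blast
qed

section \<open>Equality in the limit\<close>

lemma Eq_B: "Eq x y \<in> Gs a \<Longrightarrow> x \<notin> B \<and> y \<notin> B"
  using fm_ok_Gs[of "Eq x y"] by (auto simp: fm_ok_def)

lemma Eq_sym: assumes "Eq x y \<in> Gs a" shows "Eq y x \<in> Gs a"
proof (cases "x = y")
  case False
  have "a \<in> W" "x \<notin> B" using assms in_W Eq_B by blast+
  then have "Eq x x \<in> Gs a" by (rule Gs_Ref)
  \<comment> \<open>\<open>Suc x\<close> is a placeholder different from \<open>x\<close>; it marks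
    the left occurrence in \<open>Eq x x\<close> as the one to be replaced.\<close>
  then have "subst (Eq (Suc x) x) x (Suc x) \<in> Gs a" by (simp add: subst_def)
  from Gs_Repl[OF assms this] show ?thesis using False by (simp add: subst_def)
qed (use assms in simp)

lemma Eq_trans: assumes "Eq x y \<in> Gs a" "Eq y u \<in> Gs a" shows "Eq x u \<in> Gs a"
proof (cases "x = u")
  case True
  then show ?thesis using assms in_W Eq_B Gs_Ref by blast
next
  case False
  have "subst (Eq (Suc u) u) y (Suc u) \<in> Gs a" using assms(2) by (simp add: subst_def)
  from Gs_Repl[OF Eq_sym[OF assms(1)] this] show ?thesis using False by (simp add: subst_def)
qed

lemma Pred_replace1:
  assumes "Eq x y \<in> Gs a" "Pred i (us @ x # vs) \<in> Gs a"
  shows "Pred i (us @ y # vs) \<in> Gs a"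
proof -
  \<comment> \<open>A placeholder that occurs in neither \<open>us\<close> nor \<open>vs\<close>
    singles out one argument; replacement through \<open>subst\<close> affects all occurrences of
    its variable.\<close>
  obtain z where z: "z \<notin> set us \<union> set vs" using ex_new_if_finite[OF infinite_UNIV_nat] by (metis finite_set finite_UnI)
  then have map: "map (id(z := w)) us = us" "map (id(z := w)) vs = vs" for w
    by (auto intro!: map_idI)
  have "subst (Pred i (us @ z # vs)) x z \<in> Gs a" using assms(2) map by (simp add: subst_def)
  from Gs_Repl[OF assms(1) this] show ?thesis using map by (simp add: subst_def)
qed

text \<open>\<open>us\<close> collects the arguments already replaced; the induction treats the
  remaining ones from the left.\<close>

lemma Pred_replace:
  "list_all2 (\<lambda>x y. Eq x y \<in> Gs a) xs ys \<Longrightarrow> Pred i (us @ xs) \<in> Gs a \<Longrightarrow> Pred i (us @ ys) \<in> Gs a"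
proof (induction arbitrary: us rule: list_all2_induct)
  case (Cons x xs y ys)
  then have "Pred i ((us @ [y]) @ xs) \<in> Gs a" using Pred_replace1 by simp
  from Cons.IH[OF this] show ?case by simp
qed simp

text \<open>By \<open>Gs_Rig\<close> all nodes contain the same equations, so the root decides them;
  the least variable equated with \<open>x\<close> represents its class.\<close>

definition rep :: "var \<Rightarrow> var" where
  "rep x = (LEAST y. Eq x y \<in> Gs [])"

text \<open>The value at a variable in \<open>B\<close> is irrelevant but has to lie in the domain.\<close>

definition val :: "var \<Rightarrow> var" where
  "val x = rep (if x \<in> B then SOME y. y \<notin> B else x)"

lemma some_B: "(SOME y. y \<notin> B) \<notin> B"
proof -
  have "infinite (vars (s 0))" "vars (s 0) \<inter> B = {}"
    using good_s[of 0] by (auto simp: good_def wf_state_def)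
  then have "\<exists>y. y \<notin> B" by (metis disjoint_iff equals0I finite.emptyI)
  then show ?thesis by (rule someI_ex)
qed

lemma val_image: "val ` (- B) = range val"
  using some_B by (force simp: val_def)

lemma val_eq:
  assumes "x \<notin> B" "y \<notin> B"
  shows "val x = val y \<longleftrightarrow> Eq x y \<in> Gs []"
proof
  have rep: "Eq x (rep x) \<in> Gs []" if "x \<notin> B" for x
    unfolding rep_def using Gs_Ref[OF Nil_in_W that] by (rule LeastI)
  assume "val x = val y"
  then have "rep x = rep y" using assms by (simp add: val_def)
  then show "Eq x y \<in> Gs []" using rep assms Eq_trans Eq_sym by metis
next
  assume "Eq x y \<in> Gs []"
  then have "Eq x u \<in> Gs [] \<longleftrightarrow> Eq y u \<in> Gs []" for u using Eq_trans Eq_sym by blast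
  then show "val x = val y" using assms by (simp add: val_def rep_def)
qed

text \<open>The isolated reflexive world \<open>None\<close> makes every object exist somewhere.\<close>

definition F :: "(nat list option, var) frame" where
  "F = \<lparr>worlds = insert None (Some ` W), acc = insert (None, None) {(Some a, Some b) |a b. R a b},
        dom = (\<lambda>w. case w of None \<Rightarrow> range val | Some a \<Rightarrow> val ` Xs a)\<rparr>"

lemma acc_F: "(w, v) \<in> acc F \<longleftrightarrow> w = None \<and> v = None \<or> (\<exists>a b. w = Some a \<and> v = Some b \<and> R a b)"
  by (auto simp: F_def)

lemma dom_F: "dom F None = range val" "dom F (Some a) = val ` Xs a"
  by (simp_all add: F_def)

definition V :: "(nat list option, var, 'p) valuation" where
  "V w n i = (case w of None \<Rightarrow> {} | Some a \<Rightarrow> {map val xs |xs. Pred i xs \<in> Gs a \<and> length xs = n})"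

lemma V_Some: "ds \<in> V (Some a) n i \<longleftrightarrow> (\<exists>xs. ds = map val xs \<and> Pred i xs \<in> Gs a \<and> length xs = n)"
  by (simp add: V_def)

text \<open>The assignment can stay \<open>val\<close> throughout: each object of a domain is
  \<open>val z\<close> with \<open>z\<close> in the signature, and by \<open>sat_subst\<close>
  evaluating the body there amounts to evaluating the instance for \<open>z\<close>.\<close>

lemma truth:
  "(A \<in> Gs a \<longrightarrow> sat F V val (Some a) A) \<and> (A \<in> Ds a \<longrightarrow> \<not> sat F V val (Some a) A)"
proof (induction "cpx A" arbitrary: A a rule: less_induct)
  case less
  note IH = less
  show ?case
  proof (cases A)
    case (Pred i xs)
    have "Pred i xs \<notin> Ds a" if v: "map val xs \<in> V (Some a) (length xs) i"
    proof
      assume D: "Pred i xs \<in> Ds a"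
      \<comment> \<open>The extension in \<open>V\<close> consists of tuples of objects, so
        membership only provides some \<open>ys\<close> with the same values as \<open>xs\<close>;
        they are turned into \<open>xs\<close> by equations, decided at the root and carried to
        \<open>a\<close> by \<open>Gs_Rig\<close>.\<close>
      obtain ys where ys: "map val xs = map val ys" "Pred i ys \<in> Gs a"
        using v unfolding V_Some by blast
      have "set xs \<inter> B = {}" "set ys \<inter> B = {}"
        using fm_ok_Ds[OF D] fm_ok_Gs[OF ys(2)] by (auto simp: fm_ok_def)
      then have "list_all2 (\<lambda>x y. Eq x y \<in> Gs []) ys xs"
        using ys(1)[symmetric] val_eq by (auto simp: list_all2_conv_all_nth list_eq_iff_nth_eq disjoint_iff)
      then have "list_all2 (\<lambda>x y. Eq x y \<in> Gs a) ys xs"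
        by (rule list_all2_mono) (use Gs_Rig in_W(2)[OF ys(2)] in blast)
      then have "Pred i xs \<in> Gs a" using Pred_replace[of a ys xs i "[]"] ys(2) by simp
      then show False using atomic_Gs_Ds[of "Pred i xs"] D by simp
    qed
    then show ?thesis by (auto simp: Pred V_def)
  next
    case (Eq x y)
    have "val x = val y" if "Eq x y \<in> Gs a"
      using Gs_Rig[OF that Nil_in_W] val_eq Eq_B[OF that] by blast
    moreover have "Eq x y \<in> Gs a" if "val x = val y" "Eq x y \<in> Ds a"
    proof -
      have "x \<notin> B" "y \<notin> B" using fm_ok_Ds[OF that(2)] by (auto simp: fm_ok_def)
      then show ?thesis using that val_eq Gs_Rig in_W(3) by blast
    qed
    ultimately show ?thesis using atomic_Gs_Ds[of "Eq x y" a] by (auto simp: Eq)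
  next
    case Bot
    then show ?thesis using Bot_Gs by auto
  next
    case (Imp A1 A2)
    then show ?thesis using IH[of A1 a] IH[of A2 a] Gs_Imp[of A1 A2 a] Ds_Imp[of A1 A2 a] by auto
  next
    case (All x A1)
    have "sat F V (val(x := val z)) (Some a) A1" if "All x A1 \<in> Gs a" "z \<in> Xs a" for z
      using IH[of "subst A1 z x" a] Gs_All[OF that] by (simp add: All sat_subst)
    moreover have "\<exists>z\<in>Xs a. \<not> sat F V (val(x := val z)) (Some a) A1" if D: "All x A1 \<in> Ds a"
    proof -
      obtain y where "y \<in> Xs a" "subst A1 y x \<in> Ds a" using Ds_All[OF D] by blast
      then show ?thesis using IH[of "subst A1 y x" a] by (auto simp: All sat_subst)
    qed
    ultimately show ?thesis by (auto simp: All F_def)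
  next
    case (Box A1)
    have "sat F V val (Some b) A1" if "Box A1 \<in> Gs a" "R a b" for b
      using IH[of A1 b] Gs_Box_R[OF that] by (simp add: Box)
    moreover have "\<exists>b. R a b \<and> \<not> sat F V val (Some b) A1" if D: "Box A1 \<in> Ds a"
    proof -
      obtain i where i: "a @ [i] \<in> W" "A1 \<in> Ds (a @ [i])" using Ds_Box[OF D] by blast
      then show ?thesis using IH[of A1 "a @ [i]"] R_child by (auto simp: Box)
    qed
    ultimately show ?thesis by (auto simp: Box F_def)
  qed
qed

lemma QL_frame_F: "QL_frame L F"
proof -
  have "a \<in> W \<and> b \<in> W" if "R a b" for a b using that by (simp add: R_def)
  then have "is_frame F" by (auto simp: is_frame_def F_def)
  moreover have "has_property F Z" if "Z \<in> L" for Z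
  proof (cases Z)
    case Ax_D
    then show ?thesis using that W_D R_child by (fastforce simp: F_def)
  next
    case Ax_T
    then show ?thesis using that R_refl by (auto simp: F_def)
  next
    case Ax_B
    then show ?thesis using that R_sym by (auto simp: F_def sym_def)
  next
    case Ax_4
    then show ?thesis using that R_trans by (auto simp: F_def intro!: transI)
  next
    case Ax_5
    then show ?thesis using \<open>Z \<in> L\<close> unfolding Ax_5 has_property.simps acc_F by (auto intro: R_eucl)
  next
    case Ax_CBF
    have "val ` Xs a \<subseteq> val ` Xs b" if "R a b" for a b
      using Xs_R(1)[OF that] \<open>Z \<in> L\<close> Ax_CBF by blast
    then show ?thesis unfolding Ax_CBF has_property.simps acc_F using dom_F by force
  next
    case Ax_BF
    have "val ` Xs b \<subseteq> val ` Xs a" if "R a b" for a b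
      using Xs_R(2)[OF that] \<open>Z \<in> L\<close> Ax_BF by blast
    then show ?thesis unfolding Ax_BF has_property.simps acc_F using dom_F by force
  next
    case Ax_UI
    \<comment> \<open>The extra world has the full domain; under UI all others must match it, which
      they do since their signatures are \<open>- B\<close>.\<close>
    then have "val ` Xs a = range val" if "a \<in> W" for a using Xs_ui[OF that] \<open>Z \<in> L\<close> val_image by simp
    then show ?thesis by (auto simp: Ax_UI F_def)
  qed
  ultimately show ?thesis by (simp add: QL_frame_def)
qed

section \<open>Refutation of the initial nested sequent\<close>

lemma dom_all_F: "dom_all F = range val"
  by (auto simp: dom_all_def F_def)

text \<open>Labels present at stage 0 belong to the limit sets even if they are consumed later, and
  edges of the initial tree are pairs related by \<open>R\<close>. Hence each node of the initial
  nested sequent is refuted at the world with its own address.\<close>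

lemma refutes_subtree:
  assumes "bounded m c" "\<And>b. addr c b \<Longrightarrow> addr (kids (s 0)) (a @ b)"
    "\<And>b. addr c b \<Longrightarrow> N b = node (s 0) (a @ b)"
  shows "\<not> nseq_sat F V val (tree m c N) (Some a)"
  using assms
proof (induction m arbitrary: c N a)
  have refuted: "(\<forall>x\<in>#sig (s 0) a. val x \<in> dom F (Some a)) \<and> (\<forall>A\<in>#ante (s 0) a. sat F V val (Some a) A) \<and>
      (\<forall>A\<in>#succ (s 0) a. \<not> sat F V val (Some a) A)" if "addr (kids (s 0)) a" for a
  proof -
    have "set_mset (sig (s 0) a) \<subseteq> Xs a" "set_mset (ante (s 0) a) \<subseteq> Gs a" "set_mset (succ (s 0) a) \<subseteq> Ds a"
      using that by (auto simp: Xs_def Gs_def Ds_def)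
    then show ?thesis using truth by (auto simp: F_def)
  qed
  {
    case 0
    have "addr (kids (s 0)) a" "N [] = node (s 0) a" using 0(2)[of "[]"] 0(3)[of "[]"] by simp_all
    then show ?case using refuted[of a] by (auto simp: node_def)
  next
    case (Suc m)
    have a: "addr (kids (s 0)) a" "N [] = node (s 0) a"
      using Suc.prems(2)[of "[]"] Suc.prems(3)[of "[]"] by simp_all
    have "\<not> nseq_sat F V val (tree m (\<lambda>b. c (i # b)) (\<lambda>b. N (i # b))) (Some (a @ [i])) \<and> R a (a @ [i])"
      if i: "i \<in> c []" for i
    proof -
      have "\<not> nseq_sat F V val (tree m (\<lambda>b. c (i # b)) (\<lambda>b. N (i # b))) (Some (a @ [i]))"
        by (rule Suc.IH)
          (use Suc.prems(2,3)[of "i # _"] i bounded_shift[OF Suc.prems(1)] in \<open>simp_all add: addr_Cons\<close>)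
      moreover have "addr (kids (s 0)) (a @ [i])"
        using Suc.prems(2)[of "[i]"] i by (simp add: addr_Cons)
      then have "R a (a @ [i])" by (intro R_child) (auto simp: W_def)
      ultimately show ?thesis by blast
    qed
    then show ?case
      using refuted[OF a(1)] a(2) bounded_finite[OF Suc.prems(1), of "[]"]
      by (fastforce simp: node_def F_def)
  }
qed

lemma refutes:
  "is_valuation F V" "is_assignment F val" "Some [] \<in> worlds F" "\<not> nseq_sat F V val (nseq_of (s 0)) (Some [])"
proof -
  show "is_valuation F V" by (auto simp: is_valuation_def V_def dom_all_F split: option.splits)
  show "is_assignment F val" by (simp add: is_assignment_def dom_all_F)
  show "Some [] \<in> worlds F" using Nil_in_W by (simp add: F_def)
  have "bounded (depth (s 0)) (kids (s 0))" using good_s[of 0] by (simp add: good_def wf_state_def)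
  then show "\<not> nseq_sat F V val (nseq_of (s 0)) (Some [])"
    unfolding nseq_of_def by (rule refutes_subtree) simp_all
qed

end

section \<open>Completeness\<close>

lemma inj_to_infinite:
  assumes "infinite (UNIV :: 'b set)"
  obtains f :: "'a :: countable \<Rightarrow> 'b" where "inj f"
proof -
  obtain g :: "nat \<Rightarrow> 'b" where "inj g" using infinite_countable_subset[OF assms] by blast
  then have "inj (g \<circ> to_nat :: 'a \<Rightarrow> 'b)" by (intro inj_compose) auto
  then show ?thesis using that by blast
qed

section \<open>Transfer of models along injections\<close>

definition image_frame :: "('v \<Rightarrow> 'w) \<Rightarrow> ('c \<Rightarrow> 'd) \<Rightarrow> ('v, 'c) frame \<Rightarrow> ('w, 'd) frame" where
  "image_frame e g F = \<lparr>worlds = e ` worlds F, acc = map_prod e e ` acc F, dom = (\<lambda>w. g ` dom F (inv e w))\<rparr>"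

definition image_val :: "('v \<Rightarrow> 'w) \<Rightarrow> ('c \<Rightarrow> 'd) \<Rightarrow> ('v, 'c, 'p) valuation \<Rightarrow> ('w, 'd, 'p) valuation" where
  "image_val e g V = (\<lambda>w n i. map g ` V (inv e w) n i)"

lemma sat_image:
  assumes "inj e" "inj g"
  shows "sat (image_frame e g F) (image_val e g V) (g \<circ> \<sigma>) (e w) A = sat F V \<sigma> w A"
proof (induction A arbitrary: \<sigma> w)
  case (Pred i xs)
  have "map g (map \<sigma> xs) \<in> map g ` V w (length xs) i \<longleftrightarrow> map \<sigma> xs \<in> V w (length xs) i"
    using assms(2) by (intro inj_image_mem_iff) simp
  then show ?case
    by (simp only: sat.simps image_val_def inv_f_f[OF assms(1)] map_map)
next
  case (Eq x y)
  then show ?case using assms(2) by (simp add: inj_eq)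
next
  case (All x A)
  have "(g \<circ> \<sigma>)(x := g d) = g \<circ> \<sigma>(x := d)" for d by auto
  moreover have "dom (image_frame e g F) (e w) = g ` dom F w"
    using assms(1) by (simp add: image_frame_def)
  ultimately show ?case by (simp del: fun_upd_apply o_apply flip: All.IH)
next
  case (Box A)
  have "(e w, v) \<in> acc (image_frame e g F) \<longleftrightarrow> (\<exists>u. v = e u \<and> (w, u) \<in> acc F)" for v
    using assms(1) by (auto simp: image_frame_def inj_eq)
  then show ?case using Box by auto
qed auto

lemma QL_frame_image:
  assumes "inj e" "inj g" "QL_frame L F"
  shows "QL_frame L (image_frame e g F)"
proof -
  have acc: "(e w, e v) \<in> acc (image_frame e g F) \<longleftrightarrow> (w, v) \<in> acc F" for w v
    using assms(1) by (auto simp: image_frame_def inj_eq)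
  have acc_e: "\<exists>w' v'. w = e w' \<and> v = e v'" if "(w, v) \<in> acc (image_frame e g F)" for w v
    using that by (auto simp: image_frame_def)
  have dom: "dom (image_frame e g F) (e w) = g ` dom F w" for w
    using assms(1) by (simp add: image_frame_def)
  have worlds: "worlds (image_frame e g F) = e ` worlds F" by (simp add: image_frame_def)
  have "is_frame (image_frame e g F)"
    using assms(3) dom unfolding QL_frame_def is_frame_def worlds
    by (auto simp: image_frame_def assms(1))
  moreover have "has_property (image_frame e g F) Z" if "Z \<in> L" for Z
  proof -
    have Z: "has_property F Z" using assms(3) that by (simp add: QL_frame_def)
    show ?thesis
    proof (cases Z)
      case Ax_D
      then show ?thesis using Z acc by (fastforce simp: worlds)
    next
      case Ax_T
      then show ?thesis using Z acc by (simp add: worlds)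
    next
      case Ax_B
      have "(v, w) \<in> acc (image_frame e g F)" if wv: "(w, v) \<in> acc (image_frame e g F)" for w v
      proof -
        obtain w' v' where "w = e w'" "v = e v'" using acc_e[OF wv] by blast
        then show ?thesis using wv Z unfolding Ax_B has_property.simps by (simp add: acc symD)
      qed
      then show ?thesis unfolding Ax_B has_property.simps by (rule symI)
    next
      case Ax_4
      have "(w, u) \<in> acc (image_frame e g F)"
        if wv: "(w, v) \<in> acc (image_frame e g F)" and vu: "(v, u) \<in> acc (image_frame e g F)" for w v u
      proof -
        obtain w' v' u' where e: "w = e w'" "v = e v'" "u = e u'" using acc_e[OF wv] acc_e[OF vu] by blast
        have "(w', v') \<in> acc F" "(v', u') \<in> acc F" using wv vu unfolding e acc .
        then show ?thesis using Z unfolding e acc Ax_4 has_property.simps by (blast dest: transD)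
      qed
      then show ?thesis unfolding Ax_4 has_property.simps by (rule transI)
    next
      case Ax_5
      have "(v, u) \<in> acc (image_frame e g F)"
        if wv: "(w, v) \<in> acc (image_frame e g F)" and wu: "(w, u) \<in> acc (image_frame e g F)" for w v u
      proof -
        obtain w' v' u' where e: "w = e w'" "v = e v'" "u = e u'" using acc_e[OF wv] acc_e[OF wu] by blast
        have "(w', v') \<in> acc F" "(w', u') \<in> acc F" using wv wu unfolding e acc .
        then show ?thesis using Z unfolding e acc Ax_5 has_property.simps by blast
      qed
      then show ?thesis unfolding Ax_5 has_property.simps by blast
    next
      case Ax_CBF
      have "dom (image_frame e g F) w \<subseteq> dom (image_frame e g F) v"
        if wv: "(w, v) \<in> acc (image_frame e g F)" for w v
      proof -
        obtain w' v' where e: "w = e w'" "v = e v'" using acc_e[OF wv] by blast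
        have "(w', v') \<in> acc F" using wv unfolding e acc .
        then show ?thesis using Z unfolding e dom Ax_CBF has_property.simps by blast
      qed
      then show ?thesis unfolding Ax_CBF has_property.simps by blast
    next
      case Ax_BF
      have "dom (image_frame e g F) v \<subseteq> dom (image_frame e g F) w"
        if wv: "(w, v) \<in> acc (image_frame e g F)" for w v
      proof -
        obtain w' v' where e: "w = e w'" "v = e v'" using acc_e[OF wv] by blast
        have "(w', v') \<in> acc F" using wv unfolding e acc .
        then show ?thesis using Z unfolding e dom Ax_BF has_property.simps by blast
      qed
      then show ?thesis unfolding Ax_BF has_property.simps by blast
    next
      case Ax_UI
      have "dom (image_frame e g F) (e w) = dom (image_frame e g F) (e v)"
        if "w \<in> worlds F" "v \<in> worlds F" for w v
        using Z that unfolding Ax_UI has_property.simps dom by metis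
      then show ?thesis unfolding Ax_UI has_property.simps worlds by blast
    qed
  qed
  ultimately show ?thesis by (simp add: QL_frame_def)
qed

text \<open>A countable model, such as the one built from addresses and variables, is copied into
  the given infinite types; injectivity on objects is what preserves the truth of equations.\<close>

lemma QL_valid_transfer:
  fixes F :: "('v :: countable, 'c :: countable) frame"
  assumes "infinite (UNIV :: 'w set)" "infinite (UNIV :: 'd set)"
    and "QL_valid TYPE('w) TYPE('d) L A"
    and "QL_frame L F" "is_valuation F V" "is_assignment F \<sigma>" "w \<in> worlds F"
  shows "sat F V \<sigma> w A"
proof -
  obtain e :: "'v \<Rightarrow> 'w" and g :: "'c \<Rightarrow> 'd" where eg: "inj e" "inj g"
    using inj_to_infinite[OF assms(1)] inj_to_infinite[OF assms(2)] by metis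
  let ?F = "image_frame e g F" and ?V = "image_val e g V"
  have dom_all: "dom_all ?F = g ` dom_all F"
    using eg(1) by (auto simp: dom_all_def image_frame_def)
  have "is_valuation ?F ?V"
    using assms(5) eg(1) unfolding is_valuation_def dom_all
    by (fastforce simp: image_frame_def image_val_def)
  moreover have "is_assignment ?F (g \<circ> \<sigma>)"
    using assms(6) unfolding is_assignment_def dom_all by auto
  moreover have "e w \<in> worlds ?F" using assms(7) by (simp add: image_frame_def)
  moreover have "QL_frame L ?F" using QL_frame_image[OF eg assms(4)] .
  ultimately have "sat ?F ?V (g \<circ> \<sigma>) (e w) A"
    using assms(3) unfolding QL_valid_def valid_in_def by blast
  then show ?thesis using sat_image[OF eg] by blast
qed

text \<open>Under T and 5, or under B, accessibility is symmetric. A symmetric Euclidean relation is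
  transitive, a symmetric transitive one is Euclidean, and over a symmetric relation the conditions
  of increasing and of decreasing domains coincide. Proper closure turns these implications into
  membership.\<close>

lemma properly_closed_props:
  assumes "properly_closed TYPE('w) TYPE('d) L"
  shows "Ax_T \<in> L \<Longrightarrow> Ax_5 \<in> L \<Longrightarrow> Ax_4 \<in> L"
    and "Ax_B \<in> L \<Longrightarrow> Ax_5 \<in> L \<Longrightarrow> Ax_4 \<in> L"
    and "Ax_B \<in> L \<Longrightarrow> Ax_4 \<in> L \<Longrightarrow> Ax_5 \<in> L"
    and "Ax_B \<in> L \<Longrightarrow> Ax_CBF \<in> L \<longleftrightarrow> Ax_BF \<in> L"
    and "Ax_T \<in> L \<Longrightarrow> Ax_5 \<in> L \<Longrightarrow> Ax_CBF \<in> L \<longleftrightarrow> Ax_BF \<in> L"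
proof -
  have L: "Z \<in> L" if "Z \<in> {Ax_4, Ax_5, Ax_CBF, Ax_BF}"
    "\<And>F :: ('w, 'd) frame. QL_frame L F \<Longrightarrow> has_property F Z" for Z
    using assms that unfolding properly_closed_def by blast
  have P: "has_property F Z" if "QL_frame L F" "Z \<in> L" for F :: "('w, 'd) frame" and Z
    using that by (simp add: QL_frame_def)
  have sym: "sym (acc F)" if "Ax_T \<in> L" "Ax_5 \<in> L" "QL_frame L F" for F :: "('w, 'd) frame"
  proof (rule symI)
    fix w v assume wv: "(w, v) \<in> acc F"
    have "w \<in> worlds F" using that(3) wv by (auto simp: QL_frame_def is_frame_def)
    then have "(w, w) \<in> acc F" using P[OF that(3,1)] by simp
    then show "(v, w) \<in> acc F" using P[OF that(3,2)] wv unfolding has_property.simps by blast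
  qed
  have trans: "trans (acc F)" if "sym (acc F)" "Ax_5 \<in> L" "QL_frame L F" for F :: "('w, 'd) frame"
    using that(1) P[OF that(3,2)] unfolding trans_def sym_def has_property.simps by blast
  have dom: "has_property F Ax_CBF \<longleftrightarrow> has_property F Ax_BF" if "sym (acc F)" for F :: "('w, 'd) frame"
    using that unfolding sym_def has_property.simps by blast
  show "Ax_T \<in> L \<Longrightarrow> Ax_5 \<in> L \<Longrightarrow> Ax_4 \<in> L"
    by (rule L) (use sym trans in auto)
  show "Ax_B \<in> L \<Longrightarrow> Ax_5 \<in> L \<Longrightarrow> Ax_4 \<in> L"
    by (rule L) (use P[of _ Ax_B] trans in auto)
  show "Ax_5 \<in> L" if "Ax_B \<in> L" "Ax_4 \<in> L"
  proof (rule L)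
    fix F :: "('w, 'd) frame" assume F: "QL_frame L F"
    show "has_property F Ax_5"
      using P[OF F that(1)] P[OF F that(2)] unfolding has_property.simps sym_def trans_def by blast
  qed simp
  show "Ax_CBF \<in> L \<longleftrightarrow> Ax_BF \<in> L" if "Ax_B \<in> L"
  proof -
    have "has_property F Ax_CBF \<longleftrightarrow> has_property F Ax_BF" if "QL_frame L F" for F :: "('w, 'd) frame"
      using dom P[OF that \<open>Ax_B \<in> L\<close>] by simp
    then show ?thesis using L[of Ax_CBF] L[of Ax_BF] P by blast
  qed
  show "Ax_CBF \<in> L \<longleftrightarrow> Ax_BF \<in> L" if "Ax_T \<in> L" "Ax_5 \<in> L"
  proof -
    have "has_property F Ax_CBF \<longleftrightarrow> has_property F Ax_BF" if "QL_frame L F" for F :: "('w, 'd) frame"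
      using dom sym[OF \<open>Ax_T \<in> L\<close> \<open>Ax_5 \<in> L\<close> that] by simp
    then show ?thesis using L[of Ax_CBF] L[of Ax_BF] P by blast
  qed
qed

lemma recurrent_enumeration:
  assumes "countable T"
  shows "\<exists>f :: nat \<Rightarrow> 'a. \<forall>t\<in>T. \<forall>n. \<exists>k\<ge>n. f k = t"
proof -
  \<comment> \<open>The second component of the pair is a free counter that pushes the code of
    \<open>t\<close> beyond any \<open>n\<close>.\<close>
  let ?f = "\<lambda>k. from_nat_into T (fst (prod_decode k))"
  have "\<exists>k\<ge>n. ?f k = t" if t: "t \<in> T" for t and n :: nat
  proof -
    have "?f (prod_encode (to_nat_on T t, n)) = t" using assms t by simp
    moreover have "n \<le> prod_encode (to_nat_on T t, n)" by (rule le_prod_encode_2)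
    ultimately show ?thesis by blast
  qed
  then show ?thesis by (intro exI[of _ ?f]) blast
qed

lemma (in calculus) saturated_sequence:
  assumes "\<And>n. countable (Rel n)" "good s0"
  obtains s where "s 0 = s0" "saturation Rel L B s"
proof -
  let ?P = "{A. in_lang Rel A}"
  define T where "T = range (\<lambda>(a, x). TX a x) \<union> (\<lambda>(a, A). TL a A) ` (UNIV \<times> ?P) \<union> range TC
    \<union> (\<lambda>(a, A). TRedL a A) ` (UNIV \<times> ?P) \<union> (\<lambda>(a, A). TRedR a A) ` (UNIV \<times> ?P)"
  have "countable ?P" using assms(1) by (rule countable_in_lang)
  then have "countable T" unfolding T_def by auto
  have T: "TX a x \<in> T" "in_lang Rel A \<Longrightarrow> TL a A \<in> T" "TC a \<in> T"
    "in_lang Rel A \<Longrightarrow> TRedL a A \<in> T" "in_lang Rel A \<Longrightarrow> TRedR a A \<in> T" for a x A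
    unfolding T_def by (auto intro: rev_image_eqI)
  obtain f :: "nat \<Rightarrow> 'p task" where f: "\<And>t n. t \<in> T \<Longrightarrow> \<exists>k\<ge>n. f k = t"
    using recurrent_enumeration[OF \<open>countable T\<close>] by blast
  have "\<exists>s. (s 0 = s0 \<and> (\<forall>n. good (s n))) \<and> (\<forall>n. extends (s n) (s (Suc n)) \<and> does (f n) (s n) (s (Suc n)))"
  proof -
    \<comment> \<open>Dependent choice prescribes no start, so the start is put into the invariant
      for \<open>n = 0\<close>.\<close>
    have "\<exists>s. \<forall>n. (good (s n) \<and> (n = 0 \<longrightarrow> s n = s0)) \<and>
        (extends (s n) (s (Suc n)) \<and> does (f n) (s n) (s (Suc n)))"
    proof (rule dependent_nat_choice)
      show "\<exists>x. good x \<and> (0 = (0 :: nat) \<longrightarrow> x = s0)" using assms(2) by blast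
      show "\<exists>y. (good y \<and> (Suc n = 0 \<longrightarrow> y = s0)) \<and> extends x y \<and> does (f n) x y"
        if "good x \<and> (n = 0 \<longrightarrow> x = s0)" for x n
        using step[of x "f n"] that by auto
    qed
    then show ?thesis by blast
  qed
  then obtain s where s: "s 0 = s0" "\<And>n. good (s n)" "\<And>n. extends (s n) (s (Suc n))"
    "\<And>n. does (f n) (s n) (s (Suc n))" by blast
  have "\<exists>k\<ge>n. does t (s k) (s (Suc k))" if "t \<in> T" for t n
    using f[OF that, of n] s(4) by metis
  then have "saturation Rel L B s"
    by unfold_locales (blast intro: s T)+
  then show ?thesis using that s(1) by blast
qed

theorem theorem4:
  fixes Rel :: "nat \<Rightarrow> 'p set" and L :: "axm set" and S :: "'p nseq"
  assumes "\<And>n. countable (Rel n)"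
    and "infinite (UNIV :: 'w set)" and "infinite (UNIV :: 'd set)"
    and "properly_closed TYPE('w) TYPE('d) L"
    and "nseq_in_lang Rel S"
    and "QL_valid TYPE('w) TYPE('d) L (fm_of S)"
  shows "provable Rel L S"
proof (rule ccontr)
  assume not: "\<not> provable Rel L S"
  have "finite (nseq_fv S \<union> nseq_bv S)" by (simp add: finite_nseq_fv finite_nseq_bv)
  \<comment> \<open>Every variable of \<open>S\<close> lies below \<open>k\<close>, so the renamed
    binders, numbered from \<open>k\<close> on, are disjoint from the free variables.\<close>
  then obtain k where k: "nseq_fv S \<union> nseq_bv S \<subseteq> {..<k}"
    by (metis finite_nat_iff_bounded)
  define S' where "S' = map_nseq_fm (ren k) S"
  define B where "B = nseq_bv S'"
  have S': "nseq_alpha S S'" "nseq_fv S' = nseq_fv S" "B \<subseteq> {k..}" "nseq_in_lang Rel S'"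
    using nseq_rename[OF k, of Rel] assms(5) by (auto simp: S'_def B_def)
  have "{..<k} \<inter> {k..} = {}" by auto
  then have "nseq_fv S' \<inter> B = {}" using k S'(2,3) by blast
  then have ok: "fmls_ok B Rel S'" using S'(4) by (simp add: fmls_ok_def B_def)
  have "infinite (- B)" unfolding B_def using finite_nseq_bv by (metis finite_compl infinite_UNIV_nat)
  obtain m c N where t: "bounded m c" "\<And>a. \<exists>X \<Gamma> \<Delta>. N a = seq X \<Gamma> \<Delta>" "tree m c N = S'"
    using tree_exists[of S'] by blast
  obtain X \<Gamma> \<Delta> where N: "\<And>a. N a = seq (X a) (\<Gamma> a) (\<Delta> a)" using t(2) by metis
  interpret calculus Rel L B .
  \<comment> \<open>The initial pool is everything outside \<open>B\<close>; it may contain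
    variables of the sequent, since freshness is checked when an eigenvariable is chosen.\<close>
  define s0 where "s0 = \<lparr>depth = m, kids = c, sig = X, ante = \<Gamma>, succ = \<Delta>, vars = - B\<rparr>"
  have s0: "nseq_of s0 = S'"
    using t(3) N by (simp add: nseq_of_def node_def[abs_def] s0_def flip: N)
  have "good s0"
    using not S'(1) ok t(1) \<open>infinite (- B)\<close> s0
    by (auto simp: good_def wf_state_def underivable_def provable_def s0_def)
  then obtain s where s: "s 0 = s0" "saturation Rel L B s"
    using saturated_sequence assms(1) by metis
  interpret countermodel Rel L B s
    using s(2) properly_closed_props[OF assms(4)]
    by (simp add: countermodel_def countermodel_axioms_def)
  have "sat F V val (Some []) (fm_of S)"
    using QL_valid_transfer[OF assms(2,3,6) QL_frame_F refutes(1,2,3)] .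
  then have "nseq_sat F V val S' (Some [])"
    using nseq_sat_rename[OF k, of F V val] by (simp add: sat_fm_of S'_def)
  then show False using refutes(4) s(1) s0 by simp
qed

end
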